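(* Let $\mathfrak a\subseteq S=k[x_1,\dots,x_n]$ be a monomial ideal, $A=S/\mathfrak a$, $\mathcal M$ a standard matching on the Taylor resolution of $\mathfrak a$, $\varphi$ a map as described below, and $R'$ the algebra defined below from $\varphi$. Then $R'$ is isomorphic to the Koszul homology $H_\bullet(K^A)$ (via $Y_I\mapsto[\varphi(I)]$).
   Context: $\mathrm{MinGen}(\mathfrak a)$ is the minimal monomial generating set; $m_I=\mathrm{lcm}(I)$; $cl(I)$ is the number of classes of $I$ under the transitive closure of $m\sim m'\iff\gcd(m,m')\ne1$. Taylor resolution $T_\bullet$ of $\mathfrak a$: basis indexed by nonempty $I\subseteq\mathrm{MinGen}(\mathfrak a)$ (degree $|I|-1$, multidegree $m_I$), $\partial(I)=\sum_j(-1)^{j+1}\frac{m_I}{m_{I\setminus\{m_{i_j}\}}}(I\setminus\{m_{i_j}\})$. An acyclic matching on a based free complex is a set of edges $c\to c'$ (nonzero coefficient of $c'$ in $\partial c$) with each basis element in at most one edge, matched coefficients central units, no directed cycles after reversing matched edges; the Morse complex is free on unmatched elements with differential given by weighted path sums, homotopy equivalent to the original. A standard matching is $\mathcal M=\bigcup_{i\ge1}\mathcal M_i$, each $\mathcal M_i$ a (sequence of) acyclic matching(s) on the Morse complex from $T_\bullet$ via $\bigcup_{j<i}\mathcal M_j$, such that: matched edges $I\to J$ have $m_I=m_J$ and $|I|=|J|+1$; the final Morse complex $T^{\mathcal M}_\bullet$ has no edge $I\to J$ with $m_I=m_J$ (so it is a minimal free resolution); $I\to J\in\mathcal M_i$ implies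 $cl(J)-cl(I)=i-1$; and $\mathcal M_i=\mathcal B_i\cup\{I\cup K\to J\cup K:I\to J\in\mathcal B_i,\gcd(m_I,m_K)=1\}$ for some $\mathcal B_i$ whose edges $I\to J$ have $cl(I)=1,cl(J)=i$. $I\notin\mathcal M$ means $I$ is unmatched; such $I$ form a $k$-basis of $T^{\mathcal M}_\bullet\otimes_Sk$. $K^A_\bullet$ is the Koszul complex of $A$ with respect to $x_1,\dots,x_n$: $K_i$ is free over $A$ on $e_{\{j_1<\dots<j_i\}}$, $\partial e_{\{j_1<\dots<j_i\}}=\sum_l(-1)^{l+1}x_{j_l}e_{\{\dots\widehat{j_l}\dots\}}$, with exterior-algebra product; $H_\bullet(K^A)$ is its (graded-commutative) homology. $\varphi:T^{\mathcal M}_\bullet\otimes_Sk\to K^A_\bullet$ is a homogeneous homomorphism obtained by diagram chasing in the double complex $T^{\mathcal M}_\bullet\otimes_SK^S_\bullet$, so that $I\mapsto[\varphi(I)]$ identifies $T^{\mathcal M}_\bullet\otimes_Sk$ with $H_\bullet(K^A)$, and such that for all $I,J\notin\mathcal M$ with $\gcd(m_I,m_J)=1$: each $\varphi(I)$ is a cycle; $\varphi(I)\varphi(J)=\varphi(I\cup J)$ if $I\cup J\notin\mathcal M$; and if $I\cup J\in\mathcal M$ then $\varphi(I)\varphi(J)=\partial(c)+\sum_{L\notin\mathcal M,\,cl(L)\ge cl(I)+cl(J)}a_L\varphi(L)$ for some $c\in K^A_\bullet$, $a_L\in k$. $R'=k(Y_I:I\notin\mathcal M,\,cl(I)=1)/\mathfrak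 r'$ where $k(\dots)$ is the graded-commutative polynomial ring ($Y_IY_J=(-1)^{|I||J|}Y_JY_I$), $Y_I$ of total degree $|I|$ and multidegree $m_I$; for $L\notin\mathcal M$ with classes $L_1,\dots,L_r$ put $Y_L=Y_{L_1}\cdots Y_{L_r}$. The ideal $\mathfrak r'$ is generated by: $Y_IY_J$ if $\gcd(m_I,m_J)\ne1$; $Y_{I_{1}}\cdots Y_{I_{r}}-\sum a_LY_L$ whenever $\varphi(I_1)\cdots\varphi(I_r)=\sum a_L\varphi(L)+$boundary; $Y_{I_1}\cdots Y_{I_r}$ whenever $[\varphi(I_1)\cdots\varphi(I_r)]=0$.
   Formalization: φ(I)φ(J)=φ(I∪J) and Y_L=Y_{L_1}⋯Y_{L_r} are taken with the shuffle sign of the ordered generators (unsigned, 𝔞=(x,y) forces 2φ({x,y})=0), and I↦[φ(I)] is a basis of the homology in positive degrees only, H_0=k being spanned by the unit. *)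

theory Defs
  imports "HOL-Algebra.Algebraic_Closure_Type" "HOL-Library.Poly_Mapping"
begin

section \<open>Monomials, polynomials, monomial ideals\<close>

text \<open>
  The variables are indexed by a finite linearly ordered type \<open>'n\<close>, so that \<open>n = CARD('n)\<close>.
  A monomial is identified with its exponent vector; the monomial \<open>1\<close> is the vector \<open>0\<close>, and the
  product of monomials is the sum of exponent vectors.
\<close>

type_synonym 'n monomial = "'n \<Rightarrow>\<^sub>0 nat"
type_synonym ('n, 'k) mpol = "('n \<Rightarrow>\<^sub>0 nat) \<Rightarrow>\<^sub>0 'k"

abbreviation poly_ring :: "('n::linorder, 'k::field) mpol ring" where
  "poly_ring \<equiv> ring_of_type_algebra"

definition xmon :: "'n::linorder monomial \<Rightarrow> ('n, 'k::field) mpol" where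
  "xmon m = Poly_Mapping.single m 1"

definition xvar :: "'n::linorder \<Rightarrow> ('n, 'k::field) mpol" where
  "xvar j = xmon (Poly_Mapping.single j 1)"

definition xconst :: "'k::field \<Rightarrow> ('n::linorder, 'k) mpol" where
  "xconst c = Poly_Mapping.single 0 c"

definition mon_gcd :: "'n::finite monomial \<Rightarrow> 'n monomial \<Rightarrow> 'n monomial" where
  "mon_gcd m m' = Abs_poly_mapping (\<lambda>j. min (Poly_Mapping.lookup m j) (Poly_Mapping.lookup m' j))"

definition mon_coprime :: "'n::finite monomial \<Rightarrow> 'n monomial \<Rightarrow> bool" where
  "mon_coprime m m' \<longleftrightarrow> mon_gcd m m' = 0"

definition mon_lcm :: "'n::finite monomial set \<Rightarrow> 'n monomial" where
  "mon_lcm I = Abs_poly_mapping (\<lambda>j. Max (insert 0 ((\<lambda>m. Poly_Mapping.lookup m j) ` I)))"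

definition mon_ideal :: "'n::linorder monomial set \<Rightarrow> ('n, 'k::field) mpol set" where
  "mon_ideal G = genideal poly_ring (xmon ` G)"

definition monomial_ideal :: "('n::linorder, 'k::field) mpol set \<Rightarrow> bool" where
  "monomial_ideal a \<longleftrightarrow> (\<exists>G. a = mon_ideal G)"

definition minimal_mon_gens :: "'n::linorder monomial set \<Rightarrow> ('n, 'k::field) mpol set \<Rightarrow> bool" where
  "minimal_mon_gens G a \<longleftrightarrow> mon_ideal G = a \<and> (\<forall>G'. G' \<subset> G \<longrightarrow> mon_ideal G' \<noteq> a)"

text \<open>
  Throughout, \<open>gs\<close> is a list without repetition enumerating the minimal monomial generators; the
  signs in the Taylor resolution refer to this enumeration.
\<close>

definition gpos :: "'b list \<Rightarrow> 'b \<Rightarrow> nat" where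
  "gpos gs m = length (takeWhile (\<lambda>m'. m' \<noteq> m) gs)"

text \<open>
  For disjoint \<open>G\<close>, \<open>H\<close>, the number of transpositions needed to sort the concatenation of the
  increasing listings of \<open>G\<close> and of \<open>H\<close>; its parity is the sign of the shuffle.
\<close>

definition inversions :: "('b \<Rightarrow> 'o::linorder) \<Rightarrow> 'b set \<Rightarrow> 'b set \<Rightarrow> nat" where
  "inversions f G H = card {(g, h). g \<in> G \<and> h \<in> H \<and> f h < f g}"

fun list_inversions :: "('b \<Rightarrow> 'o::linorder) \<Rightarrow> 'b set list \<Rightarrow> nat" where
  "list_inversions f [] = 0"
| "list_inversions f (G # Gs) = inversions f G (\<Union>(set Gs)) + list_inversions f Gs"

definition class_rel :: "'n::finite monomial set \<Rightarrow> 'n monomial rel" where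
  "class_rel I = {(m, m'). m \<in> I \<and> m' \<in> I \<and> \<not> mon_coprime m m'}\<^sup>+"

definition gcd_classes :: "'n::finite monomial set \<Rightarrow> 'n monomial set set" where
  "gcd_classes I = I // class_rel I"

definition cl :: "'n::finite monomial set \<Rightarrow> nat" where
  "cl I = card (gcd_classes I)"

definition class_list :: "'n::finite monomial list \<Rightarrow> 'n monomial set \<Rightarrow> 'n monomial set list" where
  "class_list gs L = remdups (map (\<lambda>m. class_rel L `` {m}) (filter (\<lambda>m. m \<in> L) gs))"


section \<open>Algebraic discrete Morse theory\<close>

text \<open>
  A based complex of free modules over a commutative ring: a basis, the homological degree of its
  elements, and the coefficient \<open>bc_coef C c c'\<close> of \<open>c'\<close> in the differential of \<open>c\<close>.
\<close>

record ('b, 'r) based_complex =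
  bc_basis :: "'b set"
  bc_deg :: "'b \<Rightarrow> nat"
  bc_coef :: "'b \<Rightarrow> 'b \<Rightarrow> 'r"

definition bc_edges :: "('b, 'r::comm_ring_1) based_complex \<Rightarrow> 'b rel" where
  "bc_edges C = {(c, c'). c \<in> bc_basis C \<and> c' \<in> bc_basis C \<and> bc_coef C c c' \<noteq> 0}"

definition morse_graph :: "('b, 'r::comm_ring_1) based_complex \<Rightarrow> 'b rel \<Rightarrow> 'b rel" where
  "morse_graph C A = (bc_edges C - A) \<union> A\<inverse>"

definition acyclic_matching :: "('b, 'r::comm_ring_1) based_complex \<Rightarrow> 'b rel \<Rightarrow> bool" where
  "acyclic_matching C A \<longleftrightarrow>
     A \<subseteq> bc_edges C \<and>
     (\<forall>e\<in>A. \<forall>e'\<in>A. {fst e, snd e} \<inter> {fst e', snd e'} \<noteq> {} \<longrightarrow> e = e') \<and>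
     (\<forall>(c, c')\<in>A. bc_coef C c c' dvd 1) \<and>
     acyclic (morse_graph C A)"

definition unit_inverse :: "'r::comm_ring_1 \<Rightarrow> 'r" where
  "unit_inverse u = (THE v. u * v = 1)"

definition step_weight :: "('b, 'r::comm_ring_1) based_complex \<Rightarrow> 'b rel \<Rightarrow> 'b \<Rightarrow> 'b \<Rightarrow> 'r" where
  "step_weight C A u v =
     (if (v, u) \<in> A then - unit_inverse (bc_coef C v u) else bc_coef C u v)"

definition path_weight :: "('b, 'r::comm_ring_1) based_complex \<Rightarrow> 'b rel \<Rightarrow> 'b list \<Rightarrow> 'r" where
  "path_weight C A p = (\<Prod>i<length p - 1. step_weight C A (p ! i) (p ! Suc i))"

definition morse_paths :: "('b, 'r::comm_ring_1) based_complex \<Rightarrow> 'b rel \<Rightarrow> 'b \<Rightarrow> 'b \<Rightarrow> 'b list set" where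
  "morse_paths C A c c' =
     {p. p \<noteq> [] \<and> hd p = c \<and> last p = c' \<and> successively (\<lambda>u v. (u, v) \<in> morse_graph C A) p}"

definition morse_complex :: "('b, 'r::comm_ring_1) based_complex \<Rightarrow> 'b rel \<Rightarrow> ('b, 'r) based_complex" where
  "morse_complex C A =
     \<lparr> bc_basis = {c \<in> bc_basis C. \<forall>e\<in>A. c \<noteq> fst e \<and> c \<noteq> snd e},
       bc_deg = bc_deg C,
       bc_coef = (\<lambda>c c'. if bc_deg C c = Suc (bc_deg C c')
                         then \<Sum>p\<in>morse_paths C A c c'. path_weight C A p else 0) \<rparr>"

text \<open>Sequences of acyclic matchings, each one on the Morse complex of its predecessors.\<close>

definition morse_iter :: "('b, 'r::comm_ring_1) based_complex \<Rightarrow> 'b rel list \<Rightarrow> ('b, 'r) based_complex" where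
  "morse_iter C As = foldl morse_complex C As"

fun acyclic_matching_seq :: "('b, 'r::comm_ring_1) based_complex \<Rightarrow> 'b rel list \<Rightarrow> bool" where
  "acyclic_matching_seq C [] \<longleftrightarrow> True"
| "acyclic_matching_seq C (A # As) \<longleftrightarrow>
     acyclic_matching C A \<and> acyclic_matching_seq (morse_complex C A) As"


section \<open>Taylor resolution and standard matchings\<close>

definition taylor :: "'n::{finite,linorder} monomial list \<Rightarrow> ('n monomial set, ('n, 'k::field) mpol) based_complex" where
  "taylor gs =
     \<lparr> bc_basis = {I. I \<noteq> {} \<and> I \<subseteq> set gs},
       bc_deg = (\<lambda>I. card I - 1),
       bc_coef = (\<lambda>I J. \<Sum>m\<in>{m\<in>I. J = I - {m} \<and> J \<noteq> {}}.
          (- 1) ^ card {m'\<in>I. gpos gs m' < gpos gs m} * xmon (mon_lcm I - mon_lcm J)) \<rparr>"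

text \<open>
  \<open>Ms ! j\<close> is the sequence of acyclic matchings whose union is \<open>\<M>\<^sub>i\<close> for \<open>i = j + 1\<close>. As the
  basis is finite, only finitely many \<open>\<M>\<^sub>i\<close> are nonempty, and a finite list suffices. The first
  argument only fixes the coefficient field.
\<close>

type_synonym 'n matching_seq = "'n monomial set rel list list"

definition all_edges :: "'n matching_seq \<Rightarrow> 'n monomial set rel" where
  "all_edges Ms = \<Union>(set (concat Ms))"

definition critical :: "'n monomial list \<Rightarrow> 'n matching_seq \<Rightarrow> 'n monomial set set" where
  "critical gs Ms =
     {I. I \<noteq> {} \<and> I \<subseteq> set gs \<and> (\<forall>e\<in>all_edges Ms. I \<noteq> fst e \<and> I \<noteq> snd e)}"

definition taylor_morse :: "'n::{finite,linorder} monomial list \<Rightarrow> 'n matching_seq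
    \<Rightarrow> ('n monomial set, ('n, 'k::field) mpol) based_complex" where
  "taylor_morse gs Ms = morse_iter (taylor gs) (concat Ms)"

definition standard_matching :: "'k::field itself \<Rightarrow> 'n::{finite,linorder} monomial list \<Rightarrow> 'n matching_seq \<Rightarrow> bool" where
  "standard_matching (_ :: 'k itself) gs Ms \<longleftrightarrow>
     acyclic_matching_seq (taylor gs :: ('n monomial set, ('n, 'k) mpol) based_complex) (concat Ms) \<and>
     (\<forall>(I, J)\<in>all_edges Ms. mon_lcm I = mon_lcm J \<and> card I = card J + 1) \<and>
     (\<forall>(I, J)\<in>bc_edges (taylor_morse gs Ms :: ('n monomial set, ('n, 'k) mpol) based_complex).
        mon_lcm I \<noteq> mon_lcm J) \<and>
     (\<forall>j<length Ms. \<forall>(I, J)\<in>\<Union>(set (Ms ! j)). int (cl J) - int (cl I) = int j) \<and>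
     (\<forall>j<length Ms. \<exists>B.
        \<Union>(set (Ms ! j)) =
          B \<union> {(I \<union> K, J \<union> K) | I J K. (I, J) \<in> B \<and> K \<subseteq> set gs \<and> mon_coprime (mon_lcm I) (mon_lcm K)} \<and>
        (\<forall>(I, J)\<in>B. cl I = 1 \<and> cl J = j + 1))"


section \<open>Koszul complex and Koszul homology\<close>

definition alt_sign :: "('r, 's) ring_scheme \<Rightarrow> nat \<Rightarrow> 'r \<Rightarrow> 'r" where
  "alt_sign R p r = (if even p then r else \<ominus>\<^bsub>R\<^esub> r)"

text \<open>
  The exterior algebra over \<open>R\<close> on the basis \<open>e\<^sub>F\<close>, \<open>F\<close> a set of indices; an element is its family of
  coefficients.
\<close>

definition koszul_ring :: "('r, 's) ring_scheme \<Rightarrow> ('n::{finite,linorder} set \<Rightarrow> 'r) ring" where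
  "koszul_ring R =
     \<lparr> carrier = {f. \<forall>F. f F \<in> carrier R},
       monoid.mult = (\<lambda>f g F. \<Oplus>\<^bsub>R\<^esub>G\<in>Pow F. alt_sign R (inversions id G (F - G)) (f G \<otimes>\<^bsub>R\<^esub> g (F - G))),
       one = (\<lambda>F. if F = {} then \<one>\<^bsub>R\<^esub> else \<zero>\<^bsub>R\<^esub>),
       ring.zero = (\<lambda>F. \<zero>\<^bsub>R\<^esub>),
       add = (\<lambda>f g F. f F \<oplus>\<^bsub>R\<^esub> g F) \<rparr>"

definition koszul_diff :: "('r, 's) ring_scheme \<Rightarrow> ('n::{finite,linorder} \<Rightarrow> 'r) \<Rightarrow> ('n set \<Rightarrow> 'r) \<Rightarrow> 'n set \<Rightarrow> 'r" where
  "koszul_diff R x f = (\<lambda>G. \<Oplus>\<^bsub>R\<^esub>j\<in>- G. alt_sign R (card {l\<in>G. l < j}) (x j \<otimes>\<^bsub>R\<^esub> f (insert j G)))"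

context
  fixes a :: "('n::{finite,linorder}, 'k::field) mpol set"
begin

definition quot_class :: "('n, 'k) mpol \<Rightarrow> ('n, 'k) mpol set" where
  "quot_class p = a +>\<^bsub>poly_ring\<^esub> p"

definition KA :: "('n set \<Rightarrow> ('n, 'k) mpol set) ring" where
  "KA = koszul_ring (poly_ring Quot a)"

definition KA_diff :: "('n set \<Rightarrow> ('n, 'k) mpol set) \<Rightarrow> 'n set \<Rightarrow> ('n, 'k) mpol set" where
  "KA_diff = koszul_diff (poly_ring Quot a) (\<lambda>j. quot_class (xvar j))"

definition KA_scale :: "'k \<Rightarrow> ('n set \<Rightarrow> ('n, 'k) mpol set) \<Rightarrow> 'n set \<Rightarrow> ('n, 'k) mpol set" where
  "KA_scale c f = (\<lambda>F. quot_class (xconst c) \<otimes>\<^bsub>poly_ring Quot a\<^esub> f F)"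

definition KA_hom :: "nat \<Rightarrow> 'n monomial \<Rightarrow> ('n set \<Rightarrow> ('n, 'k) mpol set) set" where
  "KA_hom i \<alpha> = {f \<in> carrier KA. \<forall>F. f F = \<zero>\<^bsub>poly_ring Quot a\<^esub> \<or>
     (card F = i \<and> (\<exists>\<beta> c. \<beta> + (\<Sum>j\<in>F. Poly_Mapping.single j 1) = \<alpha> \<and>
        f F = quot_class (Poly_Mapping.single \<beta> c)))}"

definition cycles :: "('n set \<Rightarrow> ('n, 'k) mpol set) set" where
  "cycles = {z \<in> carrier KA. KA_diff z = \<zero>\<^bsub>KA\<^esub>}"

definition boundaries :: "('n set \<Rightarrow> ('n, 'k) mpol set) set" where
  "boundaries = KA_diff ` carrier KA"

definition koszul_homology :: "('n set \<Rightarrow> ('n, 'k) mpol set) set ring" where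
  "koszul_homology = (KA\<lparr>carrier := cycles\<rparr>) Quot boundaries"

definition hclass :: "('n set \<Rightarrow> ('n, 'k) mpol set) \<Rightarrow> ('n set \<Rightarrow> ('n, 'k) mpol set) set" where
  "hclass z = boundaries +>\<^bsub>KA\<^esub> z"


section \<open>The map from the minimal resolution to the Koszul complex\<close>

text \<open>
  The Morse complex resolves the ideal. Adjoining the basis element \<open>{}\<close> in front of it, with the
  augmentation \<open>{m} \<mapsto> x\<^sup>m\<close>, gives a resolution of \<open>A\<close>, in which \<open>I\<close> sits in degree \<open>card I\<close>.
  (Singletons are never matched, since an edge \<open>{m, m'} \<rightarrow> {m}\<close> with equal multidegrees would make
  \<open>m'\<close> redundant; so the augmentation of the Taylor resolution needs no correction.)
\<close>

definition aug_coef :: "('n monomial set, ('n, 'k) mpol) based_complex \<Rightarrow> 'n monomial set \<Rightarrow> 'n monomial set \<Rightarrow> ('n, 'k) mpol" where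
  "aug_coef C I J =
     (if J = {} then (if card I = 1 then xmon (mon_lcm I) else 0) else bc_coef C I J)"

text \<open>
  \<open>u\<close> results from \<open>I\<close> by a diagram chase in the double complex of the augmented Morse complex and
  the Koszul complex over the polynomial ring: there is a cycle \<open>z\<close> of the total complex, with
  differential \<open>\<partial>(J \<otimes> e\<^sub>F) = \<partial>J \<otimes> e\<^sub>F + (-1)\<^bsup>card J\<^esup> J \<otimes> \<partial>e\<^sub>F\<close>, whose component in Koszul degree \<open>0\<close> is
  \<open>I \<otimes> 1\<close> and whose component in resolution degree \<open>0\<close> maps to \<open>u\<close>. These signs are the ones for
  which the identification with Koszul homology respects products.
\<close>

definition diagram_chase ::
  "'n monomial list \<Rightarrow> 'n matching_seq \<Rightarrow> 'n monomial set \<Rightarrow> ('n set \<Rightarrow> ('n, 'k) mpol set) \<Rightarrow> bool" where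
  "diagram_chase gs Ms I u \<longleftrightarrow>
     (let C = (taylor_morse gs Ms :: ('n monomial set, ('n, 'k) mpol) based_complex); U = bc_basis C in
      \<exists>z :: 'n monomial set \<Rightarrow> 'n set \<Rightarrow> ('n, 'k) mpol.
        (\<forall>J F. z J F \<noteq> 0 \<longrightarrow> J \<in> insert {} U \<and> card J + card F = card I) \<and>
        (\<forall>J\<in>insert {} U. \<forall>F.
           (\<Sum>I'\<in>U. aug_coef C I' J * z I' F)
             + (- 1) ^ card J * koszul_diff poly_ring xvar (z J) F = 0) \<and>
        (\<forall>J\<in>U. z J {} = (if J = I then 1 else 0)) \<and>
        u = (\<lambda>F. quot_class (z {} F)))"

text \<open>
  \<open>\<phi>\<close> is given by its values on the basis of critical sets. As \<open>T\<close> resolves the ideal, the basis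
  elements \<open>I\<close>, placed in degree \<open>card I\<close>, account for the homology in positive degrees; \<open>H\<^sub>0 = k\<close>
  is spanned by the unit. A set \<open>I\<close> as a basis element of \<open>T\<close> stands for its increasing listing, so
  that the union of disjoint \<open>I\<close>, \<open>J\<close> carries the sign of the shuffle: without it the product rule
  would contradict graded commutativity for \<open>card I\<close>, \<open>card J\<close> odd.
\<close>

definition comb :: "('n monomial set \<Rightarrow> 'n set \<Rightarrow> ('n, 'k) mpol set) \<Rightarrow> 'n monomial set set
    \<Rightarrow> ('n monomial set \<Rightarrow> 'k) \<Rightarrow> 'n set \<Rightarrow> ('n, 'k) mpol set" where
  "comb \<phi> U b = (\<Oplus>\<^bsub>KA\<^esub>L\<in>U. KA_scale (b L) (\<phi> L))"

definition koszul_map ::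
  "'n monomial list \<Rightarrow> 'n matching_seq \<Rightarrow> ('n monomial set \<Rightarrow> 'n set \<Rightarrow> ('n, 'k) mpol set) \<Rightarrow> bool" where
  "koszul_map gs Ms \<phi> \<longleftrightarrow>
     (\<forall>I\<in>critical gs Ms.
        \<phi> I \<in> KA_hom (card I) (mon_lcm I) \<and> diagram_chase gs Ms I (\<phi> I) \<and> \<phi> I \<in> cycles) \<and>
     bij_betw (\<lambda>b. hclass (comb \<phi> (critical gs Ms) b))
        {b. \<forall>L. L \<notin> critical gs Ms \<longrightarrow> b L = 0}
        (hclass ` {z \<in> cycles. z {} = \<zero>\<^bsub>poly_ring Quot a\<^esub>}) \<and>
     (\<forall>I\<in>critical gs Ms. \<forall>J\<in>critical gs Ms. mon_coprime (mon_lcm I) (mon_lcm J) \<longrightarrow>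
        (I \<union> J \<in> critical gs Ms \<longrightarrow>
           \<phi> I \<otimes>\<^bsub>KA\<^esub> \<phi> J = alt_sign KA (inversions (gpos gs) I J) (\<phi> (I \<union> J))) \<and>
        (I \<union> J \<notin> critical gs Ms \<longrightarrow>
           (\<exists>c\<in>carrier KA. \<exists>b. \<phi> I \<otimes>\<^bsub>KA\<^esub> \<phi> J =
              KA_diff c \<oplus>\<^bsub>KA\<^esub> comb \<phi> {L \<in> critical gs Ms. cl L \<ge> cl I + cl J} b)))"

end


section \<open>The algebra \<open>R'\<close>\<close>

text \<open>
  The free associative algebra on letters \<open>Y\<^sub>v\<close>, \<open>v \<in> V\<close>, is the monoid algebra of the words in \<open>V\<close>.
\<close>

datatype 'v word = Word (letters: "'v list")

instantiation word :: (type) monoid_add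
begin
definition "0 = Word []"
definition "v + w = Word (letters v @ letters w)"
instance by standard (simp_all add: zero_word_def plus_word_def)
end

definition free_algebra :: "'v set \<Rightarrow> ('v word \<Rightarrow>\<^sub>0 'k::field) ring" where
  "free_algebra V = ring_of_type_algebra\<lparr>carrier := {p. \<forall>w\<in>Poly_Mapping.keys p. set (letters w) \<subseteq> V}\<rparr>"

definition Yword :: "'v list \<Rightarrow> ('v word \<Rightarrow>\<^sub>0 'k::field)" where
  "Yword vs = Poly_Mapping.single (Word vs) 1"

definition gc_ideal :: "'v set \<Rightarrow> ('v \<Rightarrow> nat) \<Rightarrow> ('v word \<Rightarrow>\<^sub>0 'k::field) set" where
  "gc_ideal V d = genideal (free_algebra V)
     {Yword [v, w] - (- 1) ^ (d v * d w) * Yword [w, v] | v w. v \<in> V \<and> w \<in> V}"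

definition gc_poly_ring :: "'v set \<Rightarrow> ('v \<Rightarrow> nat) \<Rightarrow> ('v word \<Rightarrow>\<^sub>0 'k::field) set ring" where
  "gc_poly_ring V d = free_algebra V Quot gc_ideal V d"

definition gc_class :: "'v set \<Rightarrow> ('v \<Rightarrow> nat) \<Rightarrow> ('v word \<Rightarrow>\<^sub>0 'k::field) \<Rightarrow> ('v word \<Rightarrow>\<^sub>0 'k) set" where
  "gc_class V d p = gc_ideal V d +>\<^bsub>free_algebra V\<^esub> p"

definition gens :: "'n::finite monomial list \<Rightarrow> 'n matching_seq \<Rightarrow> 'n monomial set set" where
  "gens gs Ms = {I \<in> critical gs Ms. cl I = 1}"

text \<open>
  \<open>Y\<^sub>L\<close> is the product of the \<open>Y\<close> of the classes of \<open>L\<close>, with the sign of the shuffle sorting the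
  concatenated classes; by graded commutativity this does not depend on the order of the classes.
\<close>

definition Ycl :: "'n::finite monomial list \<Rightarrow> 'n monomial set \<Rightarrow> ('n monomial set word \<Rightarrow>\<^sub>0 'k::field)" where
  "Ycl gs L = (- 1) ^ list_inversions (gpos gs) (class_list gs L) * Yword (class_list gs L)"

context
  fixes a :: "('n::{finite,linorder}, 'k::field) mpol set"
    and gs :: "'n monomial list"
    and Ms :: "'n matching_seq"
    and \<phi> :: "'n monomial set \<Rightarrow> 'n set \<Rightarrow> ('n, 'k) mpol set"
begin

definition phi_prod :: "'n monomial set list \<Rightarrow> 'n set \<Rightarrow> ('n, 'k) mpol set" where
  "phi_prod Is = foldr (\<lambda>I z. \<phi> I \<otimes>\<^bsub>KA a\<^esub> z) Is \<one>\<^bsub>KA a\<^esub>"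

definition R_relations :: "('n monomial set word \<Rightarrow>\<^sub>0 'k) set" where
  "R_relations =
     {Yword [I, J] | I J. I \<in> gens gs Ms \<and> J \<in> gens gs Ms \<and> \<not> mon_coprime (mon_lcm I) (mon_lcm J)}
   \<union> {Yword Is - (\<Sum>L\<in>critical gs Ms. Poly_Mapping.single 0 (b L) * Ycl gs L) | Is b.
        Is \<noteq> [] \<and> set Is \<subseteq> gens gs Ms \<and>
        (\<exists>u\<in>boundaries a. phi_prod Is = comb a \<phi> (critical gs Ms) b \<oplus>\<^bsub>KA a\<^esub> u)}
   \<union> {Yword Is | Is. Is \<noteq> [] \<and> set Is \<subseteq> gens gs Ms \<and> phi_prod Is \<in> boundaries a}"

definition R_ideal :: "('n monomial set word \<Rightarrow>\<^sub>0 'k) set set" where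
  "R_ideal = genideal (gc_poly_ring (gens gs Ms) card) (gc_class (gens gs Ms) card ` R_relations)"

definition R_ring :: "('n monomial set word \<Rightarrow>\<^sub>0 'k) set set ring" where
  "R_ring = gc_poly_ring (gens gs Ms) card Quot R_ideal"

definition R_class :: "('n monomial set word \<Rightarrow>\<^sub>0 'k) \<Rightarrow> ('n monomial set word \<Rightarrow>\<^sub>0 'k) set set" where
  "R_class p = R_ideal +>\<^bsub>gc_poly_ring (gens gs Ms) card\<^esub> gc_class (gens gs Ms) card p"

definition R_hom :: "nat \<Rightarrow> 'n monomial \<Rightarrow> ('n monomial set word \<Rightarrow>\<^sub>0 'k) set set set" where
  "R_hom i \<alpha> = R_class ` {p \<in> carrier (free_algebra (gens gs Ms)).
     \<forall>w\<in>Poly_Mapping.keys p. sum_list (map card (letters w)) = i \<and> sum_list (map mon_lcm (letters w)) = \<alpha>}"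

end

end

theory Submission
  imports Defs
begin

text \<open>
  The classes \<open>[\<phi>(L)]\<close> of the critical \<open>L\<close> are a basis of the homology in positive degrees. If \<open>L\<close> is
  critical with classes \<open>L\<^sub>1, \<dots>, L\<^sub>r\<close>, the closure of the \<open>\<M>\<^sub>i\<close> under coprime unions makes every \<open>L\<^sub>i\<close>
  critical, so \<open>\<phi>(L)\<close> is up to sign the product of the \<open>\<phi>(L\<^sub>i)\<close>, that is, the image of \<open>Y\<^sub>L\<close>. Hence
  \<open>Y\<^sub>I \<mapsto> [\<phi>(I)]\<close> is onto. The relations of the second kind rewrite every word into a combination of
  the \<open>Y\<^sub>L\<close>, and those are mapped to a basis; so the map is injective as soon as it is well defined.
  For this, beyond graded commutativity of the exterior algebra, only \<open>Y\<^sub>I Y\<^sub>J = 0\<close> for \<open>m\<^sub>I\<close>, \<open>m\<^sub>J\<close> with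
  a common variable \<open>x\<^sub>j\<close> needs an argument: a cycle whose multidegree is divisible by \<open>x\<^sub>j\<close> is homologous to a multiple of \<open>e\<^sub>j\<close>, and
  \<open>e\<^sub>j\<close> has square zero.
\<close>


section \<open>Signs\<close>

text \<open>Words are evaluated, by \<open>\<Theta>\<close>, one level above the homology: in the
  exterior algebra over the polynomial ring, at homogeneous lifts of the \<phi>(I). There the lifts
  commute up to sign on the nose; the other relations hold modulo boundaries and
  \<open>null_ext\<close>. The rewriting takes a single step and needs no termination argument: the
  product of the \<phi>(I) over a nonempty word is itself a cycle of positive degree, hence
  homologous to a combination of the \<phi>(L), and this is one of the relations. The basis says
  nothing about degree 0, so a normal form is a constant plus a combination of the Y_L. The
  constants survive because a proper monomial ideal contains no polynomial with a constant term.
  That multidegrees are matched is a separate argument: the projection to one multidegree commutes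
  with the Koszul differential and preserves a monomial ideal. The generator 1 must be ruled out
  beforehand, since it is coprime to itself and so not even related to itself.\<close>

lemma inversions_Un_left:
  assumes "finite A" "finite B" "finite H" "A \<inter> B = {}"
  shows "inversions f (A \<union> B) H = inversions f A H + inversions f B H"
proof -
  have "{(g, h). g \<in> A \<union> B \<and> h \<in> H \<and> f h < f g} =
        {(g, h). g \<in> A \<and> h \<in> H \<and> f h < f g} \<union> {(g, h). g \<in> B \<and> h \<in> H \<and> f h < f g}"
    by auto
  moreover have "finite {(g, h). g \<in> C \<and> h \<in> H \<and> f h < f g}" if "finite C" for C
    by (rule finite_subset[of _ "C \<times> H"]) (use that assms in auto)
  ultimately show ?thesis
    unfolding inversions_def using assms by (subst card_Un_disjoint[symmetric]) auto
qed

lemma inversions_Un_right: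
  assumes "finite A" "finite B" "finite G" "A \<inter> B = {}"
  shows "inversions f G (A \<union> B) = inversions f G A + inversions f G B"
proof -
  have "{(g, h). g \<in> G \<and> h \<in> A \<union> B \<and> f h < f g} =
        {(g, h). g \<in> G \<and> h \<in> A \<and> f h < f g} \<union> {(g, h). g \<in> G \<and> h \<in> B \<and> f h < f g}"
    by auto
  moreover have "finite {(g, h). g \<in> G \<and> h \<in> C \<and> f h < f g}" if "finite C" for C
    by (rule finite_subset[of _ "G \<times> C"]) (use that assms in auto)
  ultimately show ?thesis
    unfolding inversions_def using assms by (subst card_Un_disjoint[symmetric]) auto
qed

text \<open>Each pair of \<open>G \<times> H\<close> is out of order in exactly one of the two
  concatenations; injectivity of \<open>f\<close> excludes ties. This is the source of the sign in
  graded commutativity.\<close>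

lemma inversions_swap:
  assumes "finite G" "finite H" "G \<inter> H = {}" "inj_on f (G \<union> H)"
  shows "inversions f G H + inversions f H G = card G * card H"
proof -
  let ?X = "{(g, h). g \<in> G \<and> h \<in> H \<and> f h < f g}"
  let ?Y = "{(g, h). g \<in> G \<and> h \<in> H \<and> f g < f h}"
  have "inversions f H G = card ?Y"
    unfolding inversions_def
    by (rule bij_betw_same_card[of prod.swap]) (auto intro!: bij_betwI[where g = prod.swap])
  moreover have "?X \<union> ?Y = G \<times> H"
    using assms(3,4) by (auto simp: inj_on_def) (metis UnCI disjoint_iff linorder_neqE)
  moreover have "?X \<inter> ?Y = {}" by auto
  moreover have "finite ?X" "finite ?Y"
    by (rule finite_subset[of _ "G \<times> H"]; use assms in auto)+
  ultimately show ?thesis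
    using card_Un_disjoint[of ?X ?Y] card_cartesian_product[of G H] by (simp add: inversions_def[of f G H])
qed

text \<open>The sign of the Koszul differential is thereby the sign of shuffling \<open>j\<close>
  into a set, so that it can be compared with the signs of the product.\<close>

lemma inversions_single_left: "inversions id {j} H = card {l \<in> H. l < j}"
  unfolding inversions_def
  by (rule bij_betw_same_card[of snd]) (auto intro!: bij_betwI[where g = "\<lambda>l. (j, l)"])

lemma inversions_single_right: "inversions id G {j} = card {l \<in> G. j < l}"
  unfolding inversions_def
  by (rule bij_betw_same_card[of fst]) (auto intro!: bij_betwI[where g = "\<lambda>l. (l, j)"])

lemma card_less_Un:
  fixes A B :: "'n::{finite,linorder} set"
  assumes "A \<inter> B = {}"
  shows "card {l \<in> A \<union> B. l < j} = card {l \<in> A. l < j} + card {l \<in> B. l < j}"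
  using inversions_Un_right[of A B "{j}" id] assms by (simp add: inversions_single_left)

lemma card_less_greater:
  fixes G :: "'n::{finite,linorder} set"
  assumes "j \<notin> G"
  shows "card {l \<in> G. l < j} + card {l \<in> G. j < l} = card G"
  using inversions_swap[of "{j}" G id] assms
  by (simp add: inversions_single_left inversions_single_right)

text \<open>Parity of the sum instead of the difference keeps the exponents within the natural
  numbers and leaves a goal for \<open>presburger\<close>.\<close>

lemma minus_one_power_congI:
  "even (m + n) \<Longrightarrow> (- 1 :: 'r::ring_1) ^ m = (- 1) ^ n"
  by (cases "even m") auto

lemma minus_one_power_negI:
  "odd (m + n) \<Longrightarrow> (- 1 :: 'r::ring_1) ^ m = - ((- 1) ^ n)"
  by (cases "even m") auto

text \<open>Signs are central even where the ring is not commutative, as in the exterior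
  algebra.\<close>

lemma minus_one_power_left_commute: "x * ((- 1) ^ n * y) = (- 1) ^ n * (x * (y :: 'r::ring_1))"
  by (cases "even n") simp_all


section \<open>The Koszul complex as an exterior algebra\<close>

text \<open>A copy of the functions \<open>'i set \<Rightarrow> 'r\<close>, made into a separate
  type so that the exterior product can be the multiplication of a \<open>ring_1\<close> and the
  usual arithmetic rules apply.\<close>

typedef ('i, 'r) exterior = "UNIV :: ('i set \<Rightarrow> 'r) set"
  morphisms ecoef Exterior
  by simp

setup_lifting type_definition_exterior

instantiation exterior :: ("{finite,linorder}", comm_ring_1) ring_1
begin

lift_definition zero_exterior :: "('a, 'b) exterior" is "\<lambda>F. 0" .
lift_definition one_exterior :: "('a, 'b) exterior" is "\<lambda>F. if F = {} then 1 else 0" .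
lift_definition plus_exterior :: "('a, 'b) exterior \<Rightarrow> ('a, 'b) exterior \<Rightarrow> ('a, 'b) exterior"
  is "\<lambda>f g F. f F + g F" .
lift_definition minus_exterior :: "('a, 'b) exterior \<Rightarrow> ('a, 'b) exterior \<Rightarrow> ('a, 'b) exterior"
  is "\<lambda>f g F. f F - g F" .
lift_definition uminus_exterior :: "('a, 'b) exterior \<Rightarrow> ('a, 'b) exterior"
  is "\<lambda>f F. - f F" .
lift_definition times_exterior :: "('a, 'b) exterior \<Rightarrow> ('a, 'b) exterior \<Rightarrow> ('a, 'b) exterior"
  is "\<lambda>f g F. \<Sum>G\<in>Pow F. (- 1) ^ inversions id G (F - G) * (f G * g (F - G))" .

instance
proof
  fix f g h :: "('a, 'b) exterior"
  show "f * g * h = f * (g * h)"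
  proof (transfer, rule ext)
    fix f g h :: "'a set \<Rightarrow> 'b" and F :: "'a set"
    let ?s = "\<lambda>A B. (- 1 :: 'b) ^ inversions id A B"
    have "(\<Sum>A\<in>Pow F. ?s A (F - A) * ((\<Sum>B\<in>Pow A. ?s B (A - B) * (f B * g (A - B))) * h (F - A)))
        = (\<Sum>(A, B)\<in>(SIGMA A:Pow F. Pow A). ?s A (F - A) * (?s B (A - B) * (f B * g (A - B)) * h (F - A)))"
      by (simp add: sum_distrib_left sum_distrib_right sum.Sigma)
    \<comment> \<open>Both sums run over the ordered partitions of \<open>F\<close> into three parts
      \<open>B\<close>, \<open>C\<close>, \<open>D\<close>; on the left \<open>B\<close> and
      \<open>C\<close> come grouped as \<open>A\<close>, on the right \<open>C\<close> and
      \<open>D\<close> as \<open>F - B\<close>. The signs agree because both count the inversions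
      between \<open>B\<close> and \<open>C\<close>, \<open>B\<close> and \<open>D\<close>,
      \<open>C\<close> and \<open>D\<close>.\<close>
    also have "\<dots> = (\<Sum>(B, C)\<in>(SIGMA B:Pow F. Pow (F - B)).
        ?s B (F - B) * (f B * (?s C (F - B - C) * (g C * h (F - B - C)))))"
    proof (rule sum.reindex_bij_witness[where i = "\<lambda>(B, C). (B \<union> C, B)" and j = "\<lambda>(A, B). (B, A - B)"])
      fix p assume "p \<in> (SIGMA A:Pow F. Pow A)"
      then obtain A B where p: "p = (A, B)" "B \<subseteq> A" "A \<subseteq> F" by auto
      define C D where "C = A - B" and "D = F - A"
      have A: "A = B \<union> C" and FB: "F - B = C \<union> D" and CD: "C \<union> D - C = D"
        and dj: "B \<inter> C = {}" "C \<inter> D = {}"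
        using p by (auto simp: C_def D_def)
      have eq: "?s A D * ?s B C = ?s B (C \<union> D) * ?s C D"
        unfolding A by (simp add: inversions_Un_left inversions_Un_right dj power_add)
      have "?s A D * (?s B C * (f B * g C) * h D) = (?s A D * ?s B C) * (f B * (g C * h D))"
        by (simp only: mult.assoc)
      also have "\<dots> = ?s B (C \<union> D) * (f B * (?s C D * (g C * h D)))"
        unfolding eq by (simp only: mult.assoc mult.left_commute)
      finally show "(case case p of (A, B) \<Rightarrow> (B, A - B) of (B, C) \<Rightarrow>
          ?s B (F - B) * (f B * (?s C (F - B - C) * (g C * h (F - B - C))))) =
        (case p of (A, B) \<Rightarrow> ?s A (F - A) * (?s B (A - B) * (f B * g (A - B)) * h (F - A)))"
        by (simp only: p prod.case C_def[symmetric] D_def[symmetric] FB CD)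
    qed auto
    also have "\<dots> = (\<Sum>B\<in>Pow F. ?s B (F - B) *
        (f B * (\<Sum>C\<in>Pow (F - B). ?s C (F - B - C) * (g C * h (F - B - C)))))"
      by (simp add: sum_distrib_left sum.Sigma)
    finally show "(\<Sum>A\<in>Pow F. ?s A (F - A) * ((\<Sum>B\<in>Pow A. ?s B (A - B) * (f B * g (A - B))) * h (F - A)))
        = (\<Sum>B\<in>Pow F. ?s B (F - B) *
        (f B * (\<Sum>C\<in>Pow (F - B). ?s C (F - B - C) * (g C * h (F - B - C)))))" .
  qed
  show "1 * f = f"
  proof (transfer, rule ext)
    fix f :: "'a set \<Rightarrow> 'b" and F :: "'a set"
    show "(\<Sum>G\<in>Pow F. (- 1) ^ inversions id G (F - G) * ((if G = {} then 1 else 0) * f (F - G))) = f F"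
      by (subst sum.mono_neutral_right[where S = "{{}}"]) (auto simp: inversions_def)
  qed
  show "f * 1 = f"
  proof (transfer, rule ext)
    fix f :: "'a set \<Rightarrow> 'b" and F :: "'a set"
    show "(\<Sum>G\<in>Pow F. (- 1) ^ inversions id G (F - G) * (f G * (if F - G = {} then 1 else 0))) = f F"
      by (subst sum.mono_neutral_right[where S = "{F}"]) (auto simp: inversions_def)
  qed
  show "(f + g) * h = f * h + g * h"
    by transfer (simp add: algebra_simps sum.distrib)
  show "f * (g + h) = f * g + f * h"
    by transfer (simp add: algebra_simps sum.distrib)
  show "(0 :: ('a, 'b) exterior) \<noteq> 1"
    by transfer (auto simp: fun_eq_iff)
  show "f + g + h = f + (g + h)" "f + g = g + f" "0 + f = f" "- f + f = 0" "f - g = f + - g"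
    by (transfer; simp add: algebra_simps)+
qed

end

lemma exterior_eqI: "(\<And>F. ecoef f F = ecoef g F) \<Longrightarrow> f = g"
  by (simp add: ecoef_inject[symmetric] fun_eq_iff)

lemma ecoef_Exterior [simp]: "ecoef (Exterior f) = f"
  by (simp add: Exterior_inverse)

lemma ecoef_simps [simp]:
  fixes f g :: "('i::{finite,linorder}, 'r::comm_ring_1) exterior"
  shows "ecoef (0 :: ('i, 'r) exterior) F = 0"
    and "ecoef (1 :: ('i, 'r) exterior) F = (if F = {} then 1 else 0)"
    and "ecoef (f + g) F = ecoef f F + ecoef g F"
    and "ecoef (f - g) F = ecoef f F - ecoef g F"
    and "ecoef (- f) F = - ecoef f F"
  by (simp_all add: zero_exterior.rep_eq one_exterior.rep_eq plus_exterior.rep_eq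
      minus_exterior.rep_eq uminus_exterior.rep_eq)

lemma ecoef_times:
  "ecoef (f * g) F = (\<Sum>G\<in>Pow F. (- 1) ^ inversions id G (F - G) * (ecoef f G * ecoef g (F - G)))"
  by (simp add: times_exterior.rep_eq)

lemma ecoef_sum [simp]: "ecoef (\<Sum>a\<in>A. f a) F = (\<Sum>a\<in>A. ecoef (f a) F)"
  by (induction A rule: infinite_finite_induct) auto

definition escalar :: "'r \<Rightarrow> ('i::{finite,linorder}, 'r::comm_ring_1) exterior" where
  "escalar c = Exterior (\<lambda>F. if F = {} then c else 0)"

lemma ecoef_escalar [simp]: "ecoef (escalar c) F = (if F = {} then c else 0)"
  by (simp add: escalar_def)

lemma ecoef_escalar_times [simp]: "ecoef (escalar c * f) F = c * ecoef f F"
  unfolding ecoef_times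
  by (subst sum.mono_neutral_right[where S = "{{}}"]) (auto simp: inversions_def)

lemma ecoef_times_escalar [simp]: "ecoef (f * escalar c) F = c * ecoef f F"
  unfolding ecoef_times
  by (subst sum.mono_neutral_right[where S = "{F}"]) (auto simp: inversions_def)

lemma escalar_commute: "f * escalar c = escalar c * f"
  by (rule exterior_eqI) simp

lemma escalar_hom [simp]:
  "escalar 0 = 0" "escalar 1 = 1" "escalar (c + d) = escalar c + escalar d"
  "escalar (c * d) = escalar c * escalar d" "escalar (- c) = - escalar c"
  by (rule exterior_eqI; simp)+

section \<open>The Koszul differential and its product rule\<close>

definition kdiff :: "('i \<Rightarrow> 'r) \<Rightarrow> ('i::{finite,linorder}, 'r::comm_ring_1) exterior \<Rightarrow> ('i, 'r) exterior" where
  "kdiff x f = Exterior (\<lambda>G. \<Sum>j\<in>- G. (- 1) ^ card {l \<in> G. l < j} * (x j * ecoef f (insert j G)))"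

text \<open>The factor (-1)^deg of the product rule, written as an operator so that the rule also
  holds for elements that are not homogeneous.\<close>

definition grade_involution :: "('i::{finite,linorder}, 'r::comm_ring_1) exterior \<Rightarrow> ('i, 'r) exterior" where
  "grade_involution f = Exterior (\<lambda>F. (- 1) ^ card F * ecoef f F)"

lemma ecoef_kdiff:
  "ecoef (kdiff x f) G = (\<Sum>j\<in>- G. (- 1) ^ card {l \<in> G. l < j} * (x j * ecoef f (insert j G)))"
  by (simp add: kdiff_def)

lemma ecoef_grade_involution [simp]: "ecoef (grade_involution f) F = (- 1) ^ card F * ecoef f F"
  by (simp add: grade_involution_def)

lemma kdiff_add: "kdiff x (f + g) = kdiff x f + kdiff x g"
  by (rule exterior_eqI) (simp add: ecoef_kdiff algebra_simps sum.distrib)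

lemma kdiff_diff: "kdiff x (f - g) = kdiff x f - kdiff x g"
  by (rule exterior_eqI) (simp add: ecoef_kdiff algebra_simps sum_subtractf)

lemma kdiff_0 [simp]: "kdiff x 0 = 0"
  by (rule exterior_eqI) (simp add: ecoef_kdiff)

lemma kdiff_escalar [simp]: "kdiff x (escalar c) = 0"
  by (rule exterior_eqI) (simp add: ecoef_kdiff)

text \<open>Two indices can be removed in two orders, with opposite signs: inserting the smaller one
  shifts the position of the larger by one, but not conversely. The sum over ordered pairs therefore
  cancels.\<close>

lemma kdiff_kdiff [simp]: "kdiff x (kdiff x f) = 0"
proof (rule exterior_eqI)
  fix G
  let ?c = "\<lambda>j H. (- 1) ^ card {l \<in> H. l < j}"
  let ?T = "\<lambda>(j, l). ?c j G * (x j * (?c l (insert j G) * (x l * ecoef f (insert l (insert j G)))))"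
  let ?A = "{(j, l). j \<notin> G \<and> l \<notin> G \<and> j < l}" and ?B = "{(j, l). j \<notin> G \<and> l \<notin> G \<and> l < j}"
  have anti: "?T (l, j) = - ?T (j, l)" if "j \<notin> G" "l \<notin> G" "j < l" for j l
  proof -
    have "card {k \<in> insert j G. k < l} = Suc (card {k \<in> G. k < l})"
    proof -
      have "{k \<in> insert j G. k < l} = insert j {k \<in> G. k < l}"
        using that by auto
      then show ?thesis
        using that by simp
    qed
    moreover have "{k \<in> insert l G. k < j} = {k \<in> G. k < j}"
      using that by auto
    ultimately show ?thesis
      by (simp add: insert_commute algebra_simps)
  qed
  have "ecoef (kdiff x (kdiff x f)) G = (\<Sum>p\<in>(SIGMA j:-G. - insert j G). ?T p)"
    by (simp add: ecoef_kdiff sum_distrib_left sum.Sigma)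
  also have "(SIGMA j:-G. - insert j G) = ?A \<union> ?B" by auto
  also have "(\<Sum>p\<in>?A \<union> ?B. ?T p) = (\<Sum>p\<in>?A. ?T p) + (\<Sum>p\<in>?B. ?T p)"
    by (rule sum.union_disjoint) auto
  also have "(\<Sum>p\<in>?B. ?T p) = (\<Sum>p\<in>?A. - ?T p)"
  proof (rule sum.reindex_bij_witness[where i = prod.swap and j = prod.swap])
    fix p assume "p \<in> ?B"
    then obtain j l where p: "p = (l, j)" "j \<notin> G" "l \<notin> G" "j < l" by blast
    show "- ?T (prod.swap p) = ?T p"
      unfolding p(1) swap_simp by (rule anti[OF p(2-4), symmetric])
  qed auto
  also have "(\<Sum>p\<in>?A. ?T p) + (\<Sum>p\<in>?A. - ?T p) = 0"
    by (simp add: sum_negf)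
  finally show "ecoef (kdiff x (kdiff x f)) G = ecoef 0 G" by simp
qed

text \<open>At \<open>F\<close>, the left side only removes indices outside \<open>F\<close>. On the
  right the two factors may also share an index of \<open>F\<close>; these extra terms come once
  from each summand, with opposite signs. \<open>U\<close> and \<open>W\<close> collect the terms in
  which \<open>j\<close> is taken from \<open>f\<close> and from \<open>g\<close>.\<close>

lemma kdiff_times: "kdiff x (f * g) = kdiff x f * g + grade_involution f * kdiff x g"
proof (rule exterior_eqI)
  fix F
  let ?c = "\<lambda>j H. card {l \<in> H. l < j}"
  let ?i = "\<lambda>G H. inversions id G H"
  define U where "U j G = (- 1) ^ (?i G (F - G) + ?c j G) * (x j * (ecoef f (insert j G) * ecoef g (F - G)))" for j G
  define W where "W j G = (- 1) ^ (card G + ?i G (F - G) + ?c j (F - G)) * (x j * (ecoef f G * ecoef g (insert j (F - G))))" for j G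
  have disj: "sum h (A \<union> B) = sum h A + sum h B" if "A \<inter> B = {}" for A B :: "'a set" and h :: "'a \<Rightarrow> 'b"
    using that by (simp add: sum.union_disjoint)
  have U: "(\<Sum>G\<in>Pow F. \<Sum>j\<in>-G. U j G) = (\<Sum>G\<in>Pow F. \<Sum>j\<in>-F. U j G) + (\<Sum>G\<in>Pow F. \<Sum>j\<in>F - G. U j G)"
    unfolding sum.distrib[symmetric]
  proof (rule sum.cong[OF refl])
    fix G assume "G \<in> Pow F"
    then have "-G = -F \<union> (F - G)" "-F \<inter> (F - G) = {}" by auto
    then show "(\<Sum>j\<in>-G. U j G) = (\<Sum>j\<in>-F. U j G) + (\<Sum>j\<in>F - G. U j G)"
      by (simp add: disj)
  qed
  have W: "(\<Sum>G\<in>Pow F. \<Sum>j\<in>-(F - G). W j G) = (\<Sum>G\<in>Pow F. \<Sum>j\<in>-F. W j G) + (\<Sum>G\<in>Pow F. \<Sum>j\<in>G. W j G)"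
    unfolding sum.distrib[symmetric]
  proof (rule sum.cong[OF refl])
    fix G assume "G \<in> Pow F"
    then have "-(F - G) = -F \<union> G" "-F \<inter> G = {}" by auto
    then show "(\<Sum>j\<in>-(F - G). W j G) = (\<Sum>j\<in>-F. W j G) + (\<Sum>j\<in>G. W j G)"
      by (simp add: disj)
  qed
  \<comment> \<open>The terms with a shared index: moving \<open>j\<close> from the set
    \<open>G\<close> of \<open>W\<close> to its complement gives the same pair of coefficients, and
    the sign exponents differ in parity.\<close>
  have "(\<Sum>G\<in>Pow F. \<Sum>j\<in>G. W j G) = (\<Sum>(G, j)\<in>(SIGMA G:Pow F. G). W j G)"
    by (simp add: sum.Sigma)
  also have "\<dots> = (\<Sum>(G, j)\<in>(SIGMA G:Pow F. F - G). - U j G)"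
  proof (rule sum.reindex_bij_witness[where i = "\<lambda>(G, j). (insert j G, j)" and j = "\<lambda>(G, j). (G - {j}, j)"])
    fix p assume "p \<in> (SIGMA G:Pow F. G)"
    then obtain G j where p: "p = (insert j G, j)" and G: "j \<notin> G" "insert j G \<subseteq> F"
      by (metis (no_types, lifting) PowD SigmaE mk_disjoint_insert)
    let ?D = "F - insert j G"
    have "F - G = insert j ?D" using G by auto
    then have FG: "F - G = ?D \<union> {j}" by simp
    have 1: "?i G (F - G) = ?i G ?D + card {l \<in> G. j < l}"
      unfolding FG by (simp add: inversions_Un_right inversions_single_right del: Un_insert_right)
    have 2: "?i (insert j G) ?D = ?i G ?D + ?c j ?D"
      using inversions_Un_left[of "{j}" G ?D id] G by (simp add: inversions_single_left)
    have "W j (insert j G) = - U j G"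
      unfolding U_def W_def mult_minus_left[symmetric]
    proof (rule arg_cong2[where f = "(*)"])
      show "(- 1 :: 'b) ^ (card (insert j G) + ?i (insert j G) ?D + ?c j ?D) = - ((- 1) ^ (?i G (F - G) + ?c j G))"
        by (rule minus_one_power_negI) (use card_less_greater[OF G(1)] G(1) in \<open>simp add: 1 2, presburger\<close>)
    qed (simp add: FG)
    then show "(case case p of (G, j) \<Rightarrow> (G - {j}, j) of (G, j) \<Rightarrow> - U j G) = (case p of (G, j) \<Rightarrow> W j G)"
      using G by (simp add: p)
  qed auto
  also have "\<dots> = - (\<Sum>G\<in>Pow F. \<Sum>j\<in>F - G. U j G)"
    by (simp add: sum.Sigma[symmetric] sum_negf)
  finally have cancel: "(\<Sum>G\<in>Pow F. \<Sum>j\<in>G. W j G) = - (\<Sum>G\<in>Pow F. \<Sum>j\<in>F - G. U j G)" .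
  \<comment> \<open>A subset of \<open>insert j F\<close> either contains \<open>j\<close>, so that
    \<open>j\<close> goes to the factor \<open>f\<close>, or leaves it to \<open>g\<close>.\<close>
  have Leibniz_term: "(\<Sum>G\<in>Pow (insert j F). (- 1) ^ ?c j F * (x j * ((- 1) ^ ?i G (insert j F - G) *
      (ecoef f G * ecoef g (insert j F - G))))) = (\<Sum>G\<in>Pow F. U j G) + (\<Sum>G\<in>Pow F. W j G)"
    (is "(\<Sum>G\<in>_. ?T G) = _") if j: "j \<notin> F" for j
  proof -
    have "(\<Sum>G\<in>Pow (insert j F). ?T G) = (\<Sum>G\<in>insert j ` Pow F. ?T G) + (\<Sum>G\<in>Pow F. ?T G)"
      unfolding Pow_insert using j by (subst Un_commute, intro sum.union_disjoint) auto
    also have "(\<Sum>G\<in>insert j ` Pow F. ?T G) = (\<Sum>G\<in>Pow F. ?T (insert j G))"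
      by (rule sum.reindex[unfolded o_def]) (use j in \<open>auto simp: inj_on_def\<close>)
    also have "\<dots> = (\<Sum>G\<in>Pow F. U j G)"
    proof (rule sum.cong[OF refl])
      fix G assume "G \<in> Pow F"
      then have G: "j \<notin> G" "F = G \<union> (F - G)" "G \<inter> (F - G) = {}" and D: "insert j F - insert j G = F - G"
        using j by auto
      have 1: "?c j F = ?c j G + ?c j (F - G)"
        using card_less_Un[OF G(3)] G(2) by metis
      have 2: "?i (insert j G) (F - G) = ?i G (F - G) + ?c j (F - G)"
        using inversions_Un_left[of "{j}" G "F - G" id] G by (simp add: inversions_single_left)
      have "(- 1 :: 'b) ^ (?c j F + ?i (insert j G) (F - G)) = (- 1) ^ (?i G (F - G) + ?c j G)"
        by (rule minus_one_power_congI) (simp add: 1 2, presburger)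
      then show "?T (insert j G) = U j G"
        unfolding D U_def by (simp add: power_add ac_simps)
    qed
    also have "(\<Sum>G\<in>Pow F. ?T G) = (\<Sum>G\<in>Pow F. W j G)"
    proof (rule sum.cong[OF refl])
      fix G assume "G \<in> Pow F"
      then have G: "j \<notin> G" "F = G \<union> (F - G)" "G \<inter> (F - G) = {}" and D: "insert j F - G = insert j (F - G)"
        using j by auto
      have 1: "?c j F = ?c j G + ?c j (F - G)"
        using card_less_Un[OF G(3)] G(2) by metis
      have 2: "?i G (insert j (F - G)) = card {l \<in> G. j < l} + ?i G (F - G)"
        using inversions_Un_right[of "{j}" "F - G" G id] j by (simp add: inversions_single_right)
      have "(- 1 :: 'b) ^ (?c j F + ?i G (insert j (F - G))) = (- 1) ^ (card G + ?i G (F - G) + ?c j (F - G))"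
        by (rule minus_one_power_congI) (use card_less_greater[OF G(1)] in \<open>simp add: 1 2, presburger\<close>)
      then show "?T G = W j G"
        unfolding D W_def by (simp add: power_add ac_simps)
    qed
    finally show ?thesis .
  qed
  have "ecoef (kdiff x (f * g)) F = (\<Sum>j\<in>-F. (\<Sum>G\<in>Pow F. U j G) + (\<Sum>G\<in>Pow F. W j G))"
    by (simp add: ecoef_kdiff ecoef_times sum_distrib_left Leibniz_term)
  also have "\<dots> = (\<Sum>G\<in>Pow F. \<Sum>j\<in>-F. U j G) + (\<Sum>G\<in>Pow F. \<Sum>j\<in>-F. W j G)"
    by (simp add: sum.distrib sum.swap[of _ "Pow F"])
  also have "\<dots> = (\<Sum>G\<in>Pow F. \<Sum>j\<in>-G. U j G) + (\<Sum>G\<in>Pow F. \<Sum>j\<in>-(F - G). W j G)"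
    unfolding U W cancel by simp
  also have "\<dots> = ecoef (kdiff x f * g + grade_involution f * kdiff x g) F"
    by (simp add: ecoef_kdiff ecoef_times sum_distrib_left sum_distrib_right U_def W_def power_add ac_simps)
  finally show "ecoef (kdiff x (f * g)) F = ecoef (kdiff x f * g + grade_involution f * kdiff x g) F" .
qed

text \<open>The differential lowers the degree by one, which costs one sign.\<close>

lemma kdiff_grade_involution: "kdiff x (grade_involution f) = - grade_involution (kdiff x f)"
proof (rule exterior_eqI)
  fix G
  have "ecoef (kdiff x (grade_involution f)) G =
      (\<Sum>j\<in>-G. - ((- 1) ^ card G * ((- 1) ^ card {l \<in> G. l < j} * (x j * ecoef f (insert j G)))))"
    unfolding ecoef_kdiff by (rule sum.cong) (auto simp: ac_simps)
  then show "ecoef (kdiff x (grade_involution f)) G = ecoef (- grade_involution (kdiff x f)) G"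
    by (simp add: ecoef_kdiff sum_distrib_left sum_negf)
qed

text \<open>Exchanging a set with its complement turns one product into the other; on the supports
  the two shuffle signs multiply to (-1)^(pq) by \<open>inversions_swap\<close>.\<close>

lemma times_graded_commute:
  assumes f: "\<And>F. ecoef f F \<noteq> 0 \<Longrightarrow> card F = p" and g: "\<And>F. ecoef g F \<noteq> 0 \<Longrightarrow> card F = q"
  shows "f * g = (- 1) ^ (p * q) * (g * f)"
proof (rule exterior_eqI)
  fix F
  have "ecoef (f * g) F = (\<Sum>G\<in>Pow F. (- 1) ^ (p * q) *
      ((- 1) ^ inversions id G (F - G) * (ecoef g G * ecoef f (F - G))))"
    unfolding ecoef_times
  proof (rule sum.reindex_bij_witness[where i = "\<lambda>G. F - G" and j = "\<lambda>G. F - G"])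
    fix G assume "G \<in> Pow F"
    then have [simp]: "F - (F - G) = G" by auto
    have "(- 1 :: 'b) ^ (p * q + inversions id (F - G) G) = (- 1) ^ inversions id G (F - G)"
      if "card G = p" "card (F - G) = q"
    proof (rule minus_one_power_congI)
      have "inversions id G (F - G) + inversions id (F - G) G = p * q"
        using inversions_swap[of G "F - G" id] that by (metis Diff_disjoint finite inj_on_id)
      then have "p * q + inversions id (F - G) G + inversions id G (F - G) = 2 * (p * q)"
        by linarith
      then show "even (p * q + inversions id (F - G) G + inversions id G (F - G))"
        by (metis dvd_triv_left)
    qed
    then show "(- 1) ^ (p * q) * ((- 1) ^ inversions id (F - G) (F - (F - G)) * (ecoef g (F - G) * ecoef f (F - (F - G))))
      = (- 1) ^ inversions id G (F - G) * (ecoef f G * ecoef g (F - G))"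
      using f[of G] g[of "F - G"]
      by (cases "ecoef f G = 0 \<or> ecoef g (F - G) = 0") (auto simp: power_add ac_simps)
  qed auto
  also have "\<dots> = (- 1) ^ (p * q) * ecoef (g * f) F"
    by (simp add: ecoef_times sum_distrib_left)
  also have "\<dots> = ecoef ((- 1) ^ (p * q) * (g * f)) F"
    by (cases "even (p * q)") auto
  finally show "ecoef (f * g) F = ecoef ((- 1) ^ (p * q) * (g * f)) F" .
qed

text \<open>The elements supported on the sets containing \<open>j\<close> form the ideal of multiples of \<open>e\<^sub>j\<close>.\<close>

lemma times_eq_0_if_common_index:
  assumes "\<And>F. j \<notin> F \<Longrightarrow> ecoef f F = 0" "\<And>F. j \<notin> F \<Longrightarrow> ecoef g F = 0"
  shows "f * g = 0"
proof (rule exterior_eqI)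
  fix F
  have "ecoef f G * ecoef g (F - G) = 0" for G
    by (cases "j \<in> G") (auto simp: assms)
  then show "ecoef (f * g) F = ecoef 0 F"
    by (simp add: ecoef_times)
qed

text \<open>A primitive for the part of \<open>f\<close> without \<open>e\<^sub>j\<close>, which is \<open>x\<^sub>j u\<close>, is \<open>e\<^sub>j u\<close>.\<close>

lemma kdiff_clear_index:
  fixes f :: "('i::{finite,linorder}, 'r::comm_ring_1) exterior"
  assumes "\<And>F. j \<notin> F \<Longrightarrow> x j dvd ecoef f F"
  obtains h where "\<And>F. j \<notin> F \<Longrightarrow> ecoef (f - kdiff x h) F = 0"
proof -
  obtain u where u: "\<And>F. j \<notin> F \<Longrightarrow> ecoef f F = x j * u F"
    using assms unfolding dvd_def by metis
  \<comment> \<open>The sign is that of moving e_j past the smaller indices; it cancels the sign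
    with which the differential removes \<open>j\<close> again.\<close>
  define h where "h = Exterior (\<lambda>G. if j \<in> G then (- 1) ^ card {l \<in> G - {j}. l < j} * u (G - {j}) else 0)"
  have "ecoef (f - kdiff x h) F = 0" if j: "j \<notin> F" for F
  proof -
    \<comment> \<open>At a set without \<open>j\<close>, only the removal of \<open>j\<close> itself
      reaches the support of \<open>h\<close>.\<close>
    have "ecoef (kdiff x h) F = (\<Sum>l\<in>{j}. (- 1) ^ card {k \<in> F. k < l} * (x l * ecoef h (insert l F)))"
      unfolding ecoef_kdiff by (rule sum.mono_neutral_right) (use j in \<open>auto simp: h_def\<close>)
    also have "\<dots> = x j * u F"
      using j by (simp add: h_def algebra_simps flip: power_add mult_2)
    finally show ?thesis by (simp add: u j)
  qed
  then show ?thesis by (rule that)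
qed


section \<open>Monomials and monomial ideals\<close>

lemma poly_mapping_eq_sum_single:
  "p = (\<Sum>k\<in>Poly_Mapping.keys p. Poly_Mapping.single k (Poly_Mapping.lookup p k))"
  by (rule poly_mapping_eqI)
    (auto simp: lookup_sum lookup_single when_def in_keys_iff)

text \<open>The induction is confined to the exponents that occur in \<open>p\<close>, so a
  condition on the support of \<open>p\<close> remains available for the single terms.\<close>

lemma poly_mapping_induct_sum [case_names zero single add]:
  fixes p :: "'a \<Rightarrow>\<^sub>0 'b::comm_monoid_add"
  assumes "P 0" "\<And>k c. k \<in> Poly_Mapping.keys p \<Longrightarrow> P (Poly_Mapping.single k c)"
    and "\<And>q r. P q \<Longrightarrow> P r \<Longrightarrow> P (q + r)"
  shows "P p"
proof -
  have "P (\<Sum>k\<in>A. Poly_Mapping.single k (Poly_Mapping.lookup p k))"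
    if "finite A" "A \<subseteq> Poly_Mapping.keys p" for A
    using that by (induction A rule: finite_induct) (use assms in auto)
  from this[of "Poly_Mapping.keys p"] show ?thesis
    by (simp flip: poly_mapping_eq_sum_single)
qed

lemma lookup_mon_gcd:
  "Poly_Mapping.lookup (mon_gcd m m') j = min (Poly_Mapping.lookup m j) (Poly_Mapping.lookup m' j)"
  by (simp add: mon_gcd_def)

lemma mon_coprime_iff:
  "mon_coprime m m' \<longleftrightarrow> (\<forall>j. Poly_Mapping.lookup m j = 0 \<or> Poly_Mapping.lookup m' j = 0)"
proof -
  have "min u v = 0 \<longleftrightarrow> u = 0 \<or> v = 0" for u v :: nat
    by (auto simp: min_def)
  then show ?thesis
    by (simp add: mon_coprime_def poly_mapping_eq_iff lookup_mon_gcd fun_eq_iff)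
qed

lemma mon_coprime_commute: "mon_coprime m m' \<longleftrightarrow> mon_coprime m' m"
  by (simp add: mon_coprime_iff disj_commute)

lemma mon_coprime_self: "mon_coprime m m \<longleftrightarrow> m = 0"
  by (simp add: mon_coprime_iff poly_mapping_eq_iff fun_eq_iff)

lemma lookup_mon_lcm:
  "Poly_Mapping.lookup (mon_lcm I) j = Max (insert 0 ((\<lambda>m. Poly_Mapping.lookup m j) ` I))"
  by (simp add: mon_lcm_def)

lemma lookup_mon_lcm_eq_0:
  assumes "finite I"
  shows "Poly_Mapping.lookup (mon_lcm I) j = 0 \<longleftrightarrow> (\<forall>m\<in>I. Poly_Mapping.lookup m j = 0)"
proof -
  have "Max (insert 0 ((\<lambda>m. Poly_Mapping.lookup m j) ` I)) \<le> 0 \<longleftrightarrow> (\<forall>m\<in>I. Poly_Mapping.lookup m j \<le> 0)"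
    using assms by (subst Max_le_iff) auto
  then show ?thesis
    by (simp add: lookup_mon_lcm)
qed

lemma mon_coprime_lcm_iff:
  assumes "finite I" "finite J"
  shows "mon_coprime (mon_lcm I) (mon_lcm J) \<longleftrightarrow> (\<forall>m\<in>I. \<forall>m'\<in>J. mon_coprime m m')"
  by (simp add: mon_coprime_iff lookup_mon_lcm_eq_0 assms) metis

lemma mon_lcm_empty [simp]: "mon_lcm {} = 0"
  by (rule poly_mapping_eqI) (simp add: lookup_mon_lcm)

text \<open>At each variable one of the two exponents is 0, so their maximum is their sum.\<close>

lemma mon_lcm_Un_coprime:
  assumes "finite I" "finite J" "mon_coprime (mon_lcm I) (mon_lcm J)"
  shows "mon_lcm (I \<union> J) = mon_lcm I + mon_lcm J"
proof (rule poly_mapping_eqI)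
  fix j
  have "insert 0 ((\<lambda>m. Poly_Mapping.lookup m j) ` (I \<union> J)) =
      insert 0 ((\<lambda>m. Poly_Mapping.lookup m j) ` I) \<union> insert 0 ((\<lambda>m. Poly_Mapping.lookup m j) ` J)"
    by auto
  then have "Poly_Mapping.lookup (mon_lcm (I \<union> J)) j =
      max (Poly_Mapping.lookup (mon_lcm I) j) (Poly_Mapping.lookup (mon_lcm J) j)"
    using assms by (simp only: lookup_mon_lcm) (subst Max_Un; simp)
  then show "Poly_Mapping.lookup (mon_lcm (I \<union> J)) j = Poly_Mapping.lookup (mon_lcm I + mon_lcm J) j"
    using assms(3) by (auto simp: lookup_add mon_coprime_iff max_def dest: spec[of _ j])
qed

lemma carrier_ring_of_type_algebra [simp]: "carrier ring_of_type_algebra = UNIV"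
  and mult_ring_of_type_algebra [simp]: "monoid.mult ring_of_type_algebra x y = x * y"
  and one_ring_of_type_algebra [simp]: "one ring_of_type_algebra = 1"
  and zero_ring_of_type_algebra [simp]: "zero ring_of_type_algebra = 0"
  and add_ring_of_type_algebra [simp]: "add ring_of_type_algebra x y = x + y"
  by (simp_all add: ring_of_type_algebra_def)

lemma ring_ring_of_type_algebra: "ring (ring_of_type_algebra :: 'a::ring_1 ring)"
proof -
  have "\<exists>y. x + y = 0" for x :: 'a
    using add.right_inverse by blast
  then show ?thesis
    unfolding ring_of_type_algebra_def using add.right_inverse
    by unfold_locales (auto simp: algebra_simps Units_def)
qed

lemma a_inv_ring_of_type_algebra [simp]: "a_inv ring_of_type_algebra x = - (x :: 'a::ring_1)"
proof -
  interpret ring "ring_of_type_algebra :: 'a ring" by (rule ring_ring_of_type_algebra)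
  show ?thesis by (rule minus_equality) auto
qed

text \<open>Translates ideals of the record-based ring into closure rules for type class
  arithmetic.\<close>

lemma ideal_typeD:
  assumes "ideal a (ring_of_type_algebra :: 'a::ring_1 ring)"
  shows "0 \<in> a" "x \<in> a \<Longrightarrow> y \<in> a \<Longrightarrow> x + y \<in> a" "x \<in> a \<Longrightarrow> - x \<in> a"
    "x \<in> a \<Longrightarrow> y \<in> a \<Longrightarrow> x - y \<in> a" "x \<in> a \<Longrightarrow> y * x \<in> a" "x \<in> a \<Longrightarrow> x * y \<in> a"
    "(\<And>i. i \<in> A \<Longrightarrow> f i \<in> a) \<Longrightarrow> sum f A \<in> a"
proof -
  interpret ideal a "ring_of_type_algebra :: 'a ring" by fact
  show 0: "0 \<in> a" using additive_subgroup.zero_closed[OF additive_subgroup_axioms] by simp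
  show add: "x \<in> a \<Longrightarrow> y \<in> a \<Longrightarrow> x + y \<in> a" for x y using additive_subgroup.a_closed[OF additive_subgroup_axioms, of x y] by simp
  show neg: "x \<in> a \<Longrightarrow> - x \<in> a" for x using additive_subgroup.a_inv_closed[OF additive_subgroup_axioms, of x] by simp
  show "x \<in> a \<Longrightarrow> y \<in> a \<Longrightarrow> x - y \<in> a" using add[of x "- y"] neg[of y] by simp
  show "x \<in> a \<Longrightarrow> y * x \<in> a" using I_l_closed[of x y] by simp
  show "x \<in> a \<Longrightarrow> x * y \<in> a" using I_r_closed[of x y] by simp
  show "(\<And>i. i \<in> A \<Longrightarrow> f i \<in> a) \<Longrightarrow> sum f A \<in> a"
    by (induction A rule: infinite_finite_induct) (auto intro: 0 add)
qed

lemma ideal_mon_ideal: "ideal (mon_ideal G) poly_ring"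
proof -
  interpret ring "poly_ring :: ('n::linorder, 'k::field) mpol ring"
    by (rule ring_ring_of_type_algebra)
  show ?thesis
    unfolding mon_ideal_def by (rule genideal_ideal) simp
qed

text \<open>The polynomials all of whose terms are multiples of generators form an ideal containing
  the generators; conversely such a polynomial is the sum of its terms, which lie in the ideal one
  by one. Membership is thus decided term by term, which makes the ideal compatible with
  multidegrees and, without the generator 1, free of constant terms.\<close>

lemma mon_ideal_iff:
  fixes p :: "('n::linorder, 'k::field) mpol"
  shows "p \<in> mon_ideal G \<longleftrightarrow> (\<forall>k\<in>Poly_Mapping.keys p. \<exists>g\<in>G. \<exists>d. k = d + g)"
proof
  interpret R: ring "poly_ring :: ('n::linorder, 'k::field) mpol ring"
    by (rule ring_ring_of_type_algebra)
  let ?J = "{p :: ('n, 'k) mpol. \<forall>k\<in>Poly_Mapping.keys p. \<exists>g\<in>G. \<exists>d. k = d + g}"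
  have mult: "q * p \<in> ?J" if p: "p \<in> ?J" for p q
  proof
    show "\<forall>k\<in>Poly_Mapping.keys (q * p). \<exists>g\<in>G. \<exists>d. k = d + g"
    proof
      fix k assume "k \<in> Poly_Mapping.keys (q * p)"
      then obtain u v where "k = u + v" "v \<in> Poly_Mapping.keys p"
        using keys_mult[of q p] by blast
      moreover from this obtain g d where "g \<in> G" "v = d + g"
        using p by blast
      ultimately have "g \<in> G" "k = (u + d) + g"
        by (simp_all add: add.assoc)
      then show "\<exists>g\<in>G. \<exists>d. k = d + g"
        by blast
    qed
  qed
  have "ideal ?J poly_ring"
  proof (rule idealI)
    show "subgroup ?J (add_monoid poly_ring)"
    proof
      fix p q assume "p \<in> ?J" "q \<in> ?J"
      then show "p \<otimes>\<^bsub>add_monoid poly_ring\<^esub> q \<in> ?J"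
        using keys_add[of p q] by auto
    next
      fix p assume "p \<in> ?J"
      then show "inv\<^bsub>add_monoid poly_ring\<^esub> p \<in> ?J"
        using mult[of p "-1"] unfolding a_inv_def[symmetric] by simp
    qed auto
  next
    fix p q assume "p \<in> ?J" "q \<in> carrier (poly_ring :: ('n, 'k) mpol ring)"
    then show "q \<otimes>\<^bsub>poly_ring\<^esub> p \<in> ?J" "p \<otimes>\<^bsub>poly_ring\<^esub> q \<in> ?J"
      using mult[of p q] by (simp_all add: mult.commute)
  qed (rule ring_ring_of_type_algebra)
  moreover have "xmon ` G \<subseteq> ?J"
    by (auto simp: xmon_def) (metis add_0)
  ultimately have "mon_ideal G \<subseteq> ?J"
    unfolding mon_ideal_def by (rule R.genideal_minimal)
  then show "p \<in> mon_ideal G \<Longrightarrow> \<forall>k\<in>Poly_Mapping.keys p. \<exists>g\<in>G. \<exists>d. k = d + g"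
    by blast
next
  assume p: "\<forall>k\<in>Poly_Mapping.keys p. \<exists>g\<in>G. \<exists>d. k = d + g"
  interpret R: ring "poly_ring :: ('n::linorder, 'k::field) mpol ring"
    by (rule ring_ring_of_type_algebra)
  note I = ideal_typeD[OF ideal_mon_ideal[of G]]
  show "p \<in> mon_ideal G"
  proof (rule poly_mapping_induct_sum[of _ p])
    fix k and c :: 'k assume "k \<in> Poly_Mapping.keys p"
    then obtain g d where g: "g \<in> G" "k = d + g" using p by blast
    have "(xmon g :: ('n, 'k) mpol) \<in> mon_ideal G"
      unfolding mon_ideal_def by (rule subsetD[OF R.genideal_self]) (use g in auto)
    then have "Poly_Mapping.single d c * xmon g \<in> mon_ideal G" by (rule I)
    then show "Poly_Mapping.single k c \<in> mon_ideal G"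
      by (simp add: xmon_def mult_single g)
  qed (auto intro: I)
qed

lemma xconst_hom [simp]:
  "xconst 0 = 0" "xconst 1 = 1" "xconst (c + d) = xconst c + xconst d"
  "xconst (c * d) = xconst c * xconst d" "xconst (- c) = - xconst c"
  by (simp_all add: xconst_def single_add mult_single single_uminus)

lemma lookup_xconst_times: "Poly_Mapping.lookup (xconst c * p) k = c * Poly_Mapping.lookup p k"
proof -
  have "xconst c * p = (\<Sum>l\<in>Poly_Mapping.keys p. Poly_Mapping.single l (c * Poly_Mapping.lookup p l))"
    by (subst (1) poly_mapping_eq_sum_single[of p]) (simp add: xconst_def sum_distrib_left mult_single)
  then show ?thesis
    by (auto simp: lookup_sum lookup_single when_def in_keys_iff)
qed

lemma lookup_xvar_times_0 [simp]: "Poly_Mapping.lookup (xvar j * p) 0 = 0"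
proof (rule ccontr)
  assume "Poly_Mapping.lookup (xvar j * p) 0 \<noteq> 0"
  then have "0 \<in> Poly_Mapping.keys (xvar j * p)" by (simp add: in_keys_iff)
  then obtain u where "0 = Poly_Mapping.single j (1 :: nat) + u"
    using keys_mult[of "xvar j" p] by (auto simp: xvar_def xmon_def)
  then have "Poly_Mapping.lookup (Poly_Mapping.single j (1 :: nat) + u) j = 0" by (metis lookup_zero)
  then show False by (simp add: lookup_add)
qed

lemma single_eq_xvar_times:
  fixes k :: "'n::linorder monomial"
  assumes "Poly_Mapping.lookup k j \<noteq> 0"
  shows "Poly_Mapping.single k c = xvar j * Poly_Mapping.single (k - Poly_Mapping.single j 1) c"
proof -
  have "Poly_Mapping.single j 1 + (k - Poly_Mapping.single j 1) = k"
    by (rule poly_mapping_eqI) (use assms in \<open>auto simp: lookup_add lookup_minus lookup_single when_def\<close>)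
  then show ?thesis
    by (simp add: xvar_def xmon_def mult_single)
qed

text \<open>A monomial other than 1 is divisible by some variable. The quotients \<open>q\<close>
  become the coefficients of a primitive in degree 1 of the Koszul complex.\<close>

lemma mpol_eq_const_plus_vars:
  fixes p :: "('n::{finite,linorder}, 'k::field) mpol"
  obtains q where "p = xconst (Poly_Mapping.lookup p 0) + (\<Sum>j\<in>UNIV. xvar j * q j)"
proof -
  have "\<exists>q. p = xconst (Poly_Mapping.lookup p 0) + (\<Sum>j\<in>UNIV. xvar j * q j)"
  proof (induction p rule: poly_mapping_induct_sum)
    case zero
    show ?case by (rule exI[of _ "\<lambda>_. 0"]) simp
  next
    case (single k c)
    show ?case
    proof (cases "k = 0")
      case True
      then show ?thesis
        by (intro exI[of _ "\<lambda>_. 0"]) (simp add: xconst_def)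
    next
      case False
      then obtain j where j: "Poly_Mapping.lookup k j \<noteq> 0"
        by (metis lookup_zero poly_mapping_eqI)
      define q where "q = Poly_Mapping.single (k - Poly_Mapping.single j 1) c"
      have "(\<Sum>l\<in>UNIV. xvar l * (if l = j then q else 0)) = xvar j * q"
        by (simp add: if_distrib[of "\<lambda>x. _ * x"] cong: if_cong)
      then show ?thesis
        using single_eq_xvar_times[OF j, of c] False
        by (intro exI[of _ "\<lambda>l. if l = j then q else 0"]) (simp add: q_def lookup_single)
    qed
  next
    case (add p p')
    then obtain q q' where
      "p = xconst (Poly_Mapping.lookup p 0) + (\<Sum>j\<in>UNIV. xvar j * q j)"
      "p' = xconst (Poly_Mapping.lookup p' 0) + (\<Sum>j\<in>UNIV. xvar j * q' j)"
      by blast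
    then have "p + p' = xconst (Poly_Mapping.lookup (p + p') 0) + (\<Sum>j\<in>UNIV. xvar j * (q j + q' j))"
      by (simp add: lookup_add algebra_simps sum.distrib)
    then show ?case by (intro exI[of _ "\<lambda>j. q j + q' j"])
  qed
  then show ?thesis using that by blast
qed


section \<open>Multigraded pieces\<close>

text \<open>The multidegree of e_F. As e_j has the degree of x_j, the Koszul differential preserves
  multidegrees.\<close>

definition set_degree :: "'n::finite set \<Rightarrow> 'n monomial" where
  "set_degree F = (\<Sum>j\<in>F. Poly_Mapping.single j 1)"

lemma lookup_set_degree: "Poly_Mapping.lookup (set_degree F) j = (if j \<in> F then 1 else 0)"
  by (simp add: set_degree_def lookup_sum lookup_single when_def)

lemma set_degree_insert: "j \<notin> F \<Longrightarrow> set_degree (insert j F) = set_degree F + Poly_Mapping.single j 1"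
  by (simp add: set_degree_def add.commute)

lemma set_degree_split: "G \<subseteq> F \<Longrightarrow> set_degree F = set_degree G + set_degree (F - G)"
  unfolding set_degree_def by (subst sum.subset_diff[of G F]) (simp_all add: add.commute)

text \<open>The counterpart of \<open>KA_hom\<close> over the polynomial ring. A vanishing
  coefficient is allowed at every \<open>F\<close>, also at one of the wrong size or with a degree
  that does not fit into \<alpha>.\<close>

definition homogeneous :: "nat \<Rightarrow> 'n::{finite,linorder} monomial \<Rightarrow> ('n, ('n, 'k::field) mpol) exterior set" where
  "homogeneous i \<alpha> = {f. \<forall>F. ecoef f F = 0 \<or>
     (card F = i \<and> (\<exists>\<beta> c. \<beta> + set_degree F = \<alpha> \<and> ecoef f F = Poly_Mapping.single \<beta> c))}"

lemma homogeneousE: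
  assumes "f \<in> homogeneous i \<alpha>" "ecoef f F \<noteq> 0"
  obtains \<beta> c where "card F = i" "\<beta> + set_degree F = \<alpha>" "ecoef f F = Poly_Mapping.single \<beta> c"
  using assms unfolding homogeneous_def by blast

lemma homogeneousI:
  assumes "\<And>F. ecoef f F \<noteq> 0 \<Longrightarrow> card F = i \<and> (\<exists>\<beta> c. \<beta> + set_degree F = \<alpha> \<and> ecoef f F = Poly_Mapping.single \<beta> c)"
  shows "f \<in> homogeneous i \<alpha>"
  using assms unfolding homogeneous_def by blast

lemma homogeneous_0: "0 \<in> homogeneous i \<alpha>"
  by (rule homogeneousI) simp

lemma homogeneous_1: "1 \<in> homogeneous 0 0"
  by (rule homogeneousI) (auto simp: set_degree_def split: if_splits intro!: exI[of _ 1])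

lemma homogeneous_add:
  assumes "f \<in> homogeneous i \<alpha>" "g \<in> homogeneous i \<alpha>"
  shows "f + g \<in> homogeneous i \<alpha>"
proof (rule homogeneousI)
  fix F assume "ecoef (f + g) F \<noteq> 0"
  then consider "ecoef f F \<noteq> 0" "ecoef g F \<noteq> 0" | "ecoef f F \<noteq> 0" "ecoef g F = 0" | "ecoef f F = 0" "ecoef g F \<noteq> 0"
    by fastforce
  then show "card F = i \<and> (\<exists>\<beta> c. \<beta> + set_degree F = \<alpha> \<and> ecoef (f + g) F = Poly_Mapping.single \<beta> c)"
  proof cases
    case 1
    obtain \<beta> c where f: "card F = i" "\<beta> + set_degree F = \<alpha>" "ecoef f F = Poly_Mapping.single \<beta> c"
      using assms(1) 1(1) by (rule homogeneousE)
    obtain \<beta>' c' where g: "\<beta>' + set_degree F = \<alpha>" "ecoef g F = Poly_Mapping.single \<beta>' c'"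
      using assms(2) 1(2) by (rule homogeneousE)
    \<comment> \<open>The exponent is determined by \<alpha> and \<open>F\<close>, so that the two
      terms combine into one.\<close>
    have "\<beta>' = \<beta>"
      using f(2) g(1) by (metis add_right_cancel)
    then have "ecoef (f + g) F = Poly_Mapping.single \<beta> (c + c')"
      using f g by (simp add: single_add)
    then show ?thesis using f by blast
  next
    case 2
    then show ?thesis using homogeneousE[OF assms(1) 2(1)] by (metis add.right_neutral ecoef_simps(3))
  next
    case 3
    then show ?thesis using homogeneousE[OF assms(2) 3(2)] by (metis add.left_neutral ecoef_simps(3))
  qed
qed

lemma homogeneous_sum:
  "(\<And>x. x \<in> A \<Longrightarrow> f x \<in> homogeneous i \<alpha>) \<Longrightarrow> sum f A \<in> homogeneous i \<alpha>"
  by (induction A rule: infinite_finite_induct) (auto intro: homogeneous_0 homogeneous_add)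

lemma homogeneous_scale:
  assumes "f \<in> homogeneous i \<alpha>"
  shows "escalar (xconst c) * f \<in> homogeneous i \<alpha>"
proof (rule homogeneousI)
  fix F assume "ecoef (escalar (xconst c) * f) F \<noteq> 0"
  then have "ecoef f F \<noteq> 0" by auto
  with assms obtain \<beta> d where "card F = i" "\<beta> + set_degree F = \<alpha>" "ecoef f F = Poly_Mapping.single \<beta> d"
    by (rule homogeneousE)
  moreover from this have "ecoef (escalar (xconst c) * f) F = Poly_Mapping.single \<beta> (c * d)"
    by (simp add: xconst_def mult_single)
  ultimately show "card F = i \<and> (\<exists>\<beta> d. \<beta> + set_degree F = \<alpha> \<and> ecoef (escalar (xconst c) * f) F = Poly_Mapping.single \<beta> d)"
    by blast
qed

lemma homogeneous_times:
  assumes f: "f \<in> homogeneous i \<alpha>" and g: "g \<in> homogeneous i' \<alpha>'"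
  shows "f * g \<in> homogeneous (i + i') (\<alpha> + \<alpha>')"
proof -
  let ?t = "\<lambda>F G. (- 1) ^ inversions id G (F - G) * (ecoef f G * ecoef g (F - G))"
  \<comment> \<open>The product is cut into one summand for each set \<open>G\<close> taken from the
    left factor: such a summand has a single term at each \<open>F\<close>, and sums are covered by
    \<open>homogeneous_sum\<close>.\<close>
  have "Exterior (\<lambda>F. if G \<subseteq> F then ?t F G else 0) \<in> homogeneous (i + i') (\<alpha> + \<alpha>')" for G
  proof (rule homogeneousI)
    fix F assume "ecoef (Exterior (\<lambda>F. if G \<subseteq> F then ?t F G else 0)) F \<noteq> 0"
    then have G: "G \<subseteq> F" and nz: "ecoef f G \<noteq> 0" "ecoef g (F - G) \<noteq> 0"
      by (auto split: if_splits)
    obtain \<beta> c where fG: "card G = i" "\<beta> + set_degree G = \<alpha>" "ecoef f G = Poly_Mapping.single \<beta> c"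
      using f nz(1) by (rule homogeneousE)
    obtain \<beta>' c' where gG: "card (F - G) = i'" "\<beta>' + set_degree (F - G) = \<alpha>'" "ecoef g (F - G) = Poly_Mapping.single \<beta>' c'"
      using g nz(2) by (rule homogeneousE)
    have "card F = i + i'"
      using G fG(1) gG(1) by (metis card_Un_disjoint Diff_disjoint Diff_partition finite)
    moreover have "(\<beta> + \<beta>') + set_degree F = \<alpha> + \<alpha>'"
      unfolding set_degree_split[OF G] fG(2)[symmetric] gG(2)[symmetric] by (simp add: ac_simps)
    moreover have "?t F G = Poly_Mapping.single (\<beta> + \<beta>') ((- 1) ^ inversions id G (F - G) * (c * c'))"
      by (cases "even (inversions id G (F - G))") (simp_all add: fG gG mult_single single_uminus)
    ultimately show "card F = i + i' \<and> (\<exists>\<beta> c. \<beta> + set_degree F = \<alpha> + \<alpha>' \<and>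
        ecoef (Exterior (\<lambda>F. if G \<subseteq> F then ?t F G else 0)) F = Poly_Mapping.single \<beta> c)"
      using G by auto
  qed
  moreover have "f * g = (\<Sum>G\<in>UNIV. Exterior (\<lambda>F. if G \<subseteq> F then ?t F G else 0))"
  proof (rule exterior_eqI)
    fix F
    have "(\<Sum>G\<in>UNIV. if G \<subseteq> F then ?t F G else 0) = (\<Sum>G\<in>Pow F. ?t F G)"
      by (rule sum.mono_neutral_cong_right) auto
    then show "ecoef (f * g) F = ecoef (\<Sum>G\<in>UNIV. Exterior (\<lambda>F. if G \<subseteq> F then ?t F G else 0)) F"
      by (simp add: ecoef_times)
  qed
  ultimately show ?thesis
    by (simp add: homogeneous_sum)
qed

lemma homogeneous_graded_commute:
  assumes "f \<in> homogeneous p \<alpha>" "g \<in> homogeneous q \<beta>"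
  shows "f * g = (- 1) ^ (p * q) * (g * f)"
  using assms by (intro times_graded_commute) (blast elim: homogeneousE)+

text \<open>\<delta> is the degree of the basis element that \<open>p\<close> multiplies. The
  condition reads \<open>k + \<delta> = \<alpha>\<close> because the difference of \<alpha> and
  \<delta> would be truncated when \<delta> does not divide \<alpha> as a monomial.\<close>

definition monomial_part :: "'n monomial \<Rightarrow> 'n monomial \<Rightarrow> ('n::linorder, 'k::field) mpol \<Rightarrow> ('n, 'k) mpol" where
  "monomial_part \<alpha> \<delta> p = (\<Sum>k\<in>{k \<in> Poly_Mapping.keys p. k + \<delta> = \<alpha>}. Poly_Mapping.single k (Poly_Mapping.lookup p k))"

lemma lookup_monomial_part:
  "Poly_Mapping.lookup (monomial_part \<alpha> \<delta> p) k = (if k + \<delta> = \<alpha> then Poly_Mapping.lookup p k else 0)"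
  by (auto simp: monomial_part_def lookup_sum lookup_single when_def in_keys_iff)

lemma monomial_part_add: "monomial_part \<alpha> \<delta> (p + q) = monomial_part \<alpha> \<delta> p + monomial_part \<alpha> \<delta> q"
  by (rule poly_mapping_eqI) (simp add: lookup_monomial_part lookup_add)

lemma monomial_part_diff: "monomial_part \<alpha> \<delta> (p - q) = monomial_part \<alpha> \<delta> p - monomial_part \<alpha> \<delta> q"
  by (rule poly_mapping_eqI) (simp add: lookup_monomial_part lookup_minus)

lemma monomial_part_0 [simp]: "monomial_part \<alpha> \<delta> 0 = 0"
  by (rule poly_mapping_eqI) (simp add: lookup_monomial_part)

lemma monomial_part_uminus: "monomial_part \<alpha> \<delta> (- p) = - monomial_part \<alpha> \<delta> p"
  by (rule poly_mapping_eqI) (simp add: lookup_monomial_part)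

lemma monomial_part_sum: "monomial_part \<alpha> \<delta> (sum f A) = (\<Sum>x\<in>A. monomial_part \<alpha> \<delta> (f x))"
  by (induction A rule: infinite_finite_induct) (auto simp: monomial_part_add)

lemma monomial_part_scale: "monomial_part \<alpha> \<delta> (xconst c * p) = xconst c * monomial_part \<alpha> \<delta> p"
  by (rule poly_mapping_eqI) (simp add: lookup_monomial_part lookup_xconst_times)

lemma monomial_part_single:
  "monomial_part \<alpha> \<delta> (Poly_Mapping.single k c) = (if k + \<delta> = \<alpha> then Poly_Mapping.single k c else 0)"
  by (rule poly_mapping_eqI) (auto simp: lookup_monomial_part lookup_single when_def)

lemma monomial_part_xvar_times:
  "monomial_part \<alpha> \<delta> (xvar j * p) = xvar j * monomial_part \<alpha> (\<delta> + Poly_Mapping.single j 1) p"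
proof (induction p rule: poly_mapping_induct_sum)
  case (single k c)
  then show ?case
    by (simp add: monomial_part_single xvar_def xmon_def mult_single ac_simps)
qed (simp_all add: monomial_part_add distrib_left)

lemma monomial_part_in_mon_ideal: "p \<in> mon_ideal G \<Longrightarrow> monomial_part \<alpha> \<delta> p \<in> mon_ideal G"
  unfolding mon_ideal_iff by (auto simp: in_keys_iff lookup_monomial_part split: if_splits)

definition graded_part :: "nat \<Rightarrow> 'n monomial \<Rightarrow> ('n::{finite,linorder}, ('n, 'k::field) mpol) exterior \<Rightarrow> ('n, ('n, 'k) mpol) exterior" where
  "graded_part i \<alpha> f = Exterior (\<lambda>F. if card F = i then monomial_part \<alpha> (set_degree F) (ecoef f F) else 0)"

lemma ecoef_graded_part:
  "ecoef (graded_part i \<alpha> f) F = (if card F = i then monomial_part \<alpha> (set_degree F) (ecoef f F) else 0)"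
  by (simp add: graded_part_def)

lemma graded_part_linear:
  "graded_part i \<alpha> (f + g) = graded_part i \<alpha> f + graded_part i \<alpha> g"
  "graded_part i \<alpha> (f - g) = graded_part i \<alpha> f - graded_part i \<alpha> g"
  "graded_part i \<alpha> (escalar (xconst c) * f) = escalar (xconst c) * graded_part i \<alpha> f"
  "graded_part i \<alpha> 0 = 0"
  by (rule exterior_eqI; simp add: ecoef_graded_part monomial_part_add monomial_part_diff monomial_part_scale)+

lemma graded_part_sum: "graded_part i \<alpha> (sum f A) = (\<Sum>x\<in>A. graded_part i \<alpha> (f x))"
  by (induction A rule: infinite_finite_induct) (auto simp: graded_part_linear)

lemma graded_part_homogeneous:
  assumes "f \<in> homogeneous i' \<alpha>'"
  shows "graded_part i \<alpha> f = (if i = i' \<and> \<alpha> = \<alpha>' then f else 0)"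
proof (rule exterior_eqI)
  fix F
  show "ecoef (graded_part i \<alpha> f) F = ecoef (if i = i' \<and> \<alpha> = \<alpha>' then f else 0) F"
  proof (cases "ecoef f F = 0")
    case False
    with assms obtain \<beta> c where "card F = i'" "\<beta> + set_degree F = \<alpha>'" "ecoef f F = Poly_Mapping.single \<beta> c"
      by (rule homogeneousE)
    then show ?thesis
      by (auto simp: ecoef_graded_part monomial_part_single)
  qed (simp add: ecoef_graded_part)
qed

text \<open>x_j and e_j have the same multidegree, so trading e_j for the factor x_j keeps \<alpha>;
  only the number of indices drops, whence \<open>Suc i\<close>.\<close>

lemma graded_part_kdiff: "graded_part i \<alpha> (kdiff xvar f) = kdiff xvar (graded_part (Suc i) \<alpha> f)"
proof (rule exterior_eqI)
  fix G
  have sgn: "monomial_part \<alpha> (set_degree G) ((- 1) ^ m * p) = (- 1) ^ m * monomial_part \<alpha> (set_degree G) p" for m p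
    by (cases "even m") (simp_all add: monomial_part_uminus)
  have "monomial_part \<alpha> (set_degree G) (ecoef (kdiff xvar f) G) =
      (\<Sum>j\<in>-G. (- 1) ^ card {l \<in> G. l < j} * (xvar j * monomial_part \<alpha> (set_degree (insert j G)) (ecoef f (insert j G))))"
    by (auto simp: ecoef_kdiff monomial_part_sum sgn monomial_part_xvar_times set_degree_insert intro!: sum.cong)
  moreover have "card (insert j G) = Suc i \<longleftrightarrow> card G = i" if "j \<in> -G" for j
    using that by simp
  ultimately show "ecoef (graded_part i \<alpha> (kdiff xvar f)) G = ecoef (kdiff xvar (graded_part (Suc i) \<alpha> f)) G"
    by (auto simp: ecoef_graded_part ecoef_kdiff intro!: sum.cong sum.neutral)
qed


section \<open>Koszul homology as a quotient of polynomial cycles\<close>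

locale quotient_koszul =
  fixes a :: "('n::{finite,linorder}, 'k::field) mpol set"
  assumes ideal: "ideal a poly_ring"
begin

lemmas in_ideal = ideal_typeD[OF ideal]

lemma quot_class_ring_hom_ring: "ring_hom_ring poly_ring (poly_ring Quot a) (quot_class a)"
proof -
  have "quot_class a = (+>\<^bsub>poly_ring\<^esub>) a"
    by (simp add: fun_eq_iff quot_class_def)
  then show ?thesis
    using ideal.rcos_ring_hom_ring[OF ideal] by simp
qed

interpretation quot: ring_hom_ring poly_ring "poly_ring Quot a" "quot_class a"
  by (rule quot_class_ring_hom_ring)

lemma quot_class_simps [simp]:
  "quot_class a p \<oplus>\<^bsub>poly_ring Quot a\<^esub> quot_class a q = quot_class a (p + q)"
  "quot_class a p \<otimes>\<^bsub>poly_ring Quot a\<^esub> quot_class a q = quot_class a (p * q)"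
  "\<one>\<^bsub>poly_ring Quot a\<^esub> = quot_class a 1"
  "\<zero>\<^bsub>poly_ring Quot a\<^esub> = quot_class a 0"
  "\<ominus>\<^bsub>poly_ring Quot a\<^esub> quot_class a p = quot_class a (- p)"
  using quot.hom_add[of p q] quot.hom_mult[of p q] quot.hom_one quot.hom_zero quot.hom_a_inv[of p] by simp_all

lemma quot_class_carrier [simp]: "quot_class a p \<in> carrier (poly_ring Quot a)"
  using quot.hom_closed[of p] by simp

lemma quot_carrier: "carrier (poly_ring Quot a) = range (quot_class a)"
  by (auto simp: FactRing_def A_RCOSETS_defs quot_class_def a_r_coset_def)

lemma quot_class_eq_iff: "quot_class a p = quot_class a q \<longleftrightarrow> p - q \<in> a"
proof -
  have eq: "quot_class a p = {x + p |x. x \<in> a}" for p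
    by (auto simp: quot_class_def a_r_coset_def r_coset_def)
  show ?thesis
  proof
    assume "quot_class a p = quot_class a q"
    moreover have "p \<in> quot_class a p"
      unfolding eq using in_ideal(1) by (intro CollectI exI[of _ 0]) simp
    ultimately obtain x where "x \<in> a" "p = x + q"
      unfolding eq by blast
    then show "p - q \<in> a" by simp
  next
    assume pq: "p - q \<in> a"
    have "x + p \<in> quot_class a q" if "x \<in> a" for x
      unfolding eq using that pq in_ideal(2) by (intro CollectI exI[of _ "x + (p - q)"]) auto
    moreover have "x + q \<in> quot_class a p" if "x \<in> a" for x
      unfolding eq using that pq in_ideal(4) by (intro CollectI exI[of _ "x - (p - q)"]) auto
    ultimately show "quot_class a p = quot_class a q"
      unfolding eq by blast
  qed
qed

lemma quot_finsum: "(\<Oplus>\<^bsub>poly_ring Quot a\<^esub>x\<in>A. quot_class a (f x)) = quot_class a (sum f A)"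
  by (induction A rule: infinite_finite_induct) (simp_all add: quot.S.finsum_insert)

lemma alt_sign_quot: "alt_sign (poly_ring Quot a) m (quot_class a p) = quot_class a ((- 1) ^ m * p)"
  by (simp add: alt_sign_def)

text \<open>
  Elements of the Koszul complex of the quotient are handled through lifts to the polynomial ring,
  where type class arithmetic is available.
\<close>

definition proj :: "('n, ('n, 'k) mpol) exterior \<Rightarrow> 'n set \<Rightarrow> ('n, 'k) mpol set" where
  "proj f = (\<lambda>F. quot_class a (ecoef f F))"

text \<open>The kernel of \<open>proj\<close>, that is, a K^S.\<close>

definition null_ext :: "('n, ('n, 'k) mpol) exterior set" where
  "null_ext = {f. \<forall>F. ecoef f F \<in> a}"

lemma proj_eq_iff: "proj f = proj g \<longleftrightarrow> f - g \<in> null_ext"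
  by (simp add: proj_def fun_eq_iff quot_class_eq_iff null_ext_def)

lemma KA_carrier: "carrier (KA a) = range proj"
proof -
  have "f \<in> range proj" if "\<forall>F. f F \<in> carrier (poly_ring Quot a)" for f
  proof -
    have "\<forall>F. \<exists>p. f F = quot_class a p"
      using that by (simp add: quot_carrier image_iff)
    then obtain g where "\<forall>F. f F = quot_class a (g F)"
      by (rule choice[THEN exE])
    then have "f = proj (Exterior g)"
      by (simp add: proj_def fun_eq_iff)
    then show ?thesis by blast
  qed
  then show ?thesis
    by (auto simp: KA_def koszul_ring_def proj_def)
qed

lemma proj_simps [simp]:
  "proj f \<oplus>\<^bsub>KA a\<^esub> proj g = proj (f + g)"
  "proj f \<otimes>\<^bsub>KA a\<^esub> proj g = proj (f * g)"
  "\<one>\<^bsub>KA a\<^esub> = proj 1"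
  "\<zero>\<^bsub>KA a\<^esub> = proj 0"
  "KA_diff a (proj f) = proj (kdiff xvar f)"
  by (auto simp: KA_def koszul_ring_def proj_def KA_diff_def koszul_diff_def ecoef_times
      ecoef_kdiff alt_sign_quot quot_finsum fun_eq_iff)

lemma KA_scale_proj [simp]: "KA_scale a c (proj f) = proj (escalar (xconst c) * f)"
  by (simp add: proj_def KA_scale_def fun_eq_iff)

lemma proj_in_KA [simp]: "proj f \<in> carrier (KA a)"
  by (simp add: KA_carrier)

text \<open>The ring axioms pass from the exterior algebra over the polynomial ring to its image
  under the surjection \<open>proj\<close>, so none has to be checked with coset
  coefficients.\<close>

lemma ring_KA: "ring (KA a)"
proof -
  interpret R: ring "ring_of_type_algebra :: ('n, ('n, 'k) mpol) exterior ring"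
    by (rule ring_ring_of_type_algebra)
  have "proj \<in> ring_hom ring_of_type_algebra (KA a)"
    by (rule ring_hom_memI) simp_all
  then have "ring (KA a \<lparr>carrier := range proj, zero := proj 0\<rparr>)"
    using R.ring_hom_imp_img_ring by fastforce
  moreover have "KA a \<lparr>carrier := range proj, zero := proj 0\<rparr> = KA a"
    by (simp flip: KA_carrier proj_simps(4))
  ultimately show ?thesis by simp
qed

interpretation KA: ring "KA a"
  by (rule ring_KA)

lemma proj_uminus [simp]: "\<ominus>\<^bsub>KA a\<^esub> proj f = proj (- f)"
  by (rule KA.minus_equality) simp_all

lemma proj_finsum [simp]: "(\<Oplus>\<^bsub>KA a\<^esub>x\<in>A. proj (f x)) = proj (sum f A)"
  by (induction A rule: infinite_finite_induct) (simp_all add: KA.finsum_insert)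

lemma alt_sign_proj [simp]: "alt_sign (KA a) m (proj f) = proj ((- 1) ^ m * f)"
  by (simp add: alt_sign_def)

text \<open>A homogeneous element lifts to a homogeneous one, since the lift may be chosen
  separately at each \<open>F\<close>; at a zero coset the lift 0 is taken, which imposes no
  degree.\<close>

lemma KA_hom_eq: "KA_hom a i \<alpha> = proj ` homogeneous i \<alpha>"
proof
  show "proj ` homogeneous i \<alpha> \<subseteq> KA_hom a i \<alpha>"
  proof (rule image_subsetI)
    fix f :: "('n, ('n, 'k) mpol) exterior" assume f: "f \<in> homogeneous i \<alpha>"
    have "proj f F = \<zero>\<^bsub>poly_ring Quot a\<^esub> \<or> (card F = i \<and>
        (\<exists>\<beta> c. \<beta> + set_degree F = \<alpha> \<and> proj f F = quot_class a (Poly_Mapping.single \<beta> c)))" for F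
    proof (cases "ecoef f F = 0")
      case True
      then show ?thesis by (simp add: proj_def)
    next
      case False
      with f obtain \<beta> c where "card F = i" "\<beta> + set_degree F = \<alpha>" "ecoef f F = Poly_Mapping.single \<beta> c"
        by (rule homogeneousE)
      moreover from this have "proj f F = quot_class a (Poly_Mapping.single \<beta> c)"
        by (simp add: proj_def)
      ultimately show ?thesis by blast
    qed
    then show "proj f \<in> KA_hom a i \<alpha>"
      unfolding KA_hom_def set_degree_def by (simp only: proj_in_KA mem_Collect_eq simp_thms)
  qed
next
  show "KA_hom a i \<alpha> \<subseteq> proj ` homogeneous i \<alpha>"
  proof
    fix f assume f: "f \<in> KA_hom a i \<alpha>"
    let ?P = "\<lambda>F p. f F = quot_class a p \<and> (p = 0 \<or>
        (card F = i \<and> (\<exists>\<beta> c. \<beta> + set_degree F = \<alpha> \<and> p = Poly_Mapping.single \<beta> c)))"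
    have "\<exists>p. ?P F p" for F
      using f unfolding KA_hom_def set_degree_def quot_class_simps(4) by blast
    then have "\<forall>F. \<exists>p. ?P F p" ..
    then obtain g where g: "\<forall>F. ?P F (g F)"
      by (rule choice[THEN exE])
    then have "f = proj (Exterior g)"
      by (simp add: proj_def fun_eq_iff)
    moreover have "Exterior g \<in> homogeneous i \<alpha>"
      by (rule homogeneousI) (use g in auto)
    ultimately show "f \<in> proj ` homogeneous i \<alpha>" by blast
  qed
qed

lemma null_ext_closed:
  "0 \<in> null_ext" "f \<in> null_ext \<Longrightarrow> g \<in> null_ext \<Longrightarrow> f + g \<in> null_ext"
  "f \<in> null_ext \<Longrightarrow> g \<in> null_ext \<Longrightarrow> f - g \<in> null_ext" "f \<in> null_ext \<Longrightarrow> - f \<in> null_ext"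
  "f \<in> null_ext \<Longrightarrow> f * h \<in> null_ext" "f \<in> null_ext \<Longrightarrow> h * f \<in> null_ext"
  "f \<in> null_ext \<Longrightarrow> kdiff xvar f \<in> null_ext" "f \<in> null_ext \<Longrightarrow> grade_involution f \<in> null_ext"
proof -
  show "f * h \<in> null_ext" "h * f \<in> null_ext" "kdiff xvar f \<in> null_ext" "grade_involution f \<in> null_ext"
    if "f \<in> null_ext"
    using that unfolding null_ext_def mem_Collect_eq ecoef_times ecoef_kdiff ecoef_grade_involution
    by (intro allI in_ideal(7) in_ideal(5)[of _ "(- 1) ^ _"], simp add: in_ideal(5,6))+
qed (auto simp: null_ext_def intro!: in_ideal(1-4))

section \<open>Cycles, boundaries and homology, through preimages under \<open>proj\<close>\<close>

definition ext_cycles :: "('n, ('n, 'k) mpol) exterior set" where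
  "ext_cycles = {f. kdiff xvar f \<in> null_ext}"

definition ext_boundaries :: "('n, ('n, 'k) mpol) exterior set" where
  "ext_boundaries = {f. \<exists>g. f - kdiff xvar g \<in> null_ext}"

lemma proj_in_cycles_iff: "proj f \<in> cycles a \<longleftrightarrow> f \<in> ext_cycles"
  by (simp add: cycles_def ext_cycles_def proj_eq_iff)

lemma proj_in_boundaries_iff: "proj f \<in> boundaries a \<longleftrightarrow> f \<in> ext_boundaries"
proof -
  have "boundaries a = range (\<lambda>g. proj (kdiff xvar g))"
    by (simp add: boundaries_def KA_carrier image_image)
  then show ?thesis
    by (auto simp: ext_boundaries_def proj_eq_iff)
qed

lemma cycles_eq: "cycles a = proj ` ext_cycles"
proof -
  have "cycles a \<subseteq> range proj"
    by (auto simp: cycles_def KA_carrier)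
  then show ?thesis
    by (auto simp: proj_in_cycles_iff)
qed

lemma boundaries_eq: "boundaries a = proj ` ext_boundaries"
proof -
  have "boundaries a \<subseteq> range proj"
    by (auto simp: boundaries_def KA_carrier)
  then show ?thesis
    by (auto simp: proj_in_boundaries_iff)
qed

lemma ext_boundariesI: "f - kdiff xvar g \<in> null_ext \<Longrightarrow> f \<in> ext_boundaries"
  unfolding ext_boundaries_def by blast

lemma kdiff_in_ext_boundaries: "kdiff xvar g \<in> ext_boundaries"
  by (rule ext_boundariesI[of _ g]) (simp add: null_ext_closed)

lemma null_ext_subset_boundaries: "f \<in> null_ext \<Longrightarrow> f \<in> ext_boundaries"
  by (rule ext_boundariesI[of _ 0]) simp

lemma ext_boundaries_subset: "f \<in> ext_boundaries \<Longrightarrow> f \<in> ext_cycles"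
  unfolding ext_boundaries_def ext_cycles_def
  using null_ext_closed(7) by (fastforce simp: kdiff_diff)

lemma kdiff_1 [simp]: "kdiff xvar (1 :: ('n, ('n, 'k) mpol) exterior) = 0"
  using kdiff_escalar[of xvar 1] by simp

lemma kdiff_uminus: "kdiff xvar (- f) = - kdiff xvar f"
  using kdiff_diff[of xvar 0 f] by simp

lemma ext_cycles_closed:
  "0 \<in> ext_cycles" "1 \<in> ext_cycles" "f \<in> ext_cycles \<Longrightarrow> g \<in> ext_cycles \<Longrightarrow> f + g \<in> ext_cycles"
  "f \<in> ext_cycles \<Longrightarrow> g \<in> ext_cycles \<Longrightarrow> f - g \<in> ext_cycles" "f \<in> ext_cycles \<Longrightarrow> - f \<in> ext_cycles"
  "f \<in> ext_cycles \<Longrightarrow> g \<in> ext_cycles \<Longrightarrow> f * g \<in> ext_cycles" "escalar c \<in> ext_cycles"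
  by (auto simp: ext_cycles_def kdiff_add kdiff_diff kdiff_uminus kdiff_times intro: null_ext_closed)

lemma ext_cycles_sum: "(\<And>x. x \<in> A \<Longrightarrow> f x \<in> ext_cycles) \<Longrightarrow> sum f A \<in> ext_cycles"
  by (induction A rule: infinite_finite_induct) (auto intro: ext_cycles_closed)

lemma ext_boundaries_closed:
  "0 \<in> ext_boundaries" "f \<in> ext_boundaries \<Longrightarrow> g \<in> ext_boundaries \<Longrightarrow> f + g \<in> ext_boundaries"
  "f \<in> ext_boundaries \<Longrightarrow> g \<in> ext_boundaries \<Longrightarrow> f - g \<in> ext_boundaries"
  "f \<in> ext_boundaries \<Longrightarrow> - f \<in> ext_boundaries"
proof -
  show 0: "0 \<in> ext_boundaries"
    by (simp add: null_ext_closed null_ext_subset_boundaries)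
  show sub: "f - g \<in> ext_boundaries" if fg: "f \<in> ext_boundaries" "g \<in> ext_boundaries" for f g
  proof -
    obtain u v where "f - kdiff xvar u \<in> null_ext" "g - kdiff xvar v \<in> null_ext"
      using fg unfolding ext_boundaries_def by blast
    then have "(f - kdiff xvar u) - (g - kdiff xvar v) \<in> null_ext"
      by (rule null_ext_closed)
    then show ?thesis
      by (intro ext_boundariesI[of _ "u - v"]) (simp add: kdiff_diff algebra_simps)
  qed
  show neg: "- f \<in> ext_boundaries" if "f \<in> ext_boundaries" for f
    using sub[OF 0 that] by simp
  show "f + g \<in> ext_boundaries" if "f \<in> ext_boundaries" "g \<in> ext_boundaries"
    using sub[OF that(1) neg[OF that(2)]] by simp
qed

text \<open>If \<open>u\<close> is a primitive of \<open>b\<close>, then, up to sign,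
  \<open>z * u\<close> and \<open>u * z\<close> are primitives of the products. What the product
  rule leaves over contains the differential of \<open>z\<close>, which lies in
  \<open>null_ext\<close>.\<close>

lemma ext_boundaries_times:
  assumes "z \<in> ext_cycles" "b \<in> ext_boundaries"
  shows "z * b \<in> ext_boundaries" "b * z \<in> ext_boundaries"
proof -
  obtain u where u: "b - kdiff xvar u \<in> null_ext"
    using assms(2) unfolding ext_boundaries_def by blast
  have z: "kdiff xvar z \<in> null_ext"
    using assms(1) by (simp add: ext_cycles_def)
  \<comment> \<open>The involution put into the primitive is undone by the one in the product
    rule.\<close>
  have "grade_involution (grade_involution z) = z"
    by (rule exterior_eqI) (simp flip: power_add mult.assoc mult_2)
  then have "z * b - kdiff xvar (grade_involution z * u) =
      z * (b - kdiff xvar u) + grade_involution (kdiff xvar z) * u"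
    by (simp add: kdiff_times kdiff_grade_involution algebra_simps)
  also have "\<dots> \<in> null_ext"
    by (rule null_ext_closed(2)[OF null_ext_closed(6)[OF u] null_ext_closed(5)[OF null_ext_closed(8)[OF z]]])
  finally show "z * b \<in> ext_boundaries" by (rule ext_boundariesI)
  have "b * z - kdiff xvar (u * z) = (b - kdiff xvar u) * z - grade_involution u * kdiff xvar z"
    by (simp add: kdiff_times algebra_simps)
  also have "\<dots> \<in> null_ext"
    by (rule null_ext_closed(3)[OF null_ext_closed(5)[OF u] null_ext_closed(6)[OF z]])
  finally show "b * z \<in> ext_boundaries" by (rule ext_boundariesI)
qed

lemma ring_cycles: "ring (KA a \<lparr>carrier := cycles a\<rparr>)"
proof -
  have "subring (cycles a) (KA a)"
    by (rule KA.subringI) (auto simp: cycles_eq intro!: ext_cycles_closed)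
  then show ?thesis by (rule KA.subring_is_ring)
qed

lemma ideal_boundaries: "ideal (boundaries a) (KA a \<lparr>carrier := cycles a\<rparr>)"
proof (rule idealI[OF ring_cycles])
  interpret C: ring "KA a \<lparr>carrier := cycles a\<rparr>" by (rule ring_cycles)
  show "subgroup (boundaries a) (add_monoid (KA a \<lparr>carrier := cycles a\<rparr>))"
  proof (rule C.add.subgroupI)
    show "boundaries a \<subseteq> carrier (KA a \<lparr>carrier := cycles a\<rparr>)"
      by (auto simp: boundaries_eq cycles_eq ext_boundaries_subset)
    show "boundaries a \<noteq> {}"
      using ext_boundaries_closed(1) by (auto simp: boundaries_eq)
  next
    fix x assume "x \<in> boundaries a"
    then obtain f where f: "x = proj f" "f \<in> ext_boundaries"
      by (auto simp: boundaries_eq)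
    have "\<ominus>\<^bsub>KA a \<lparr>carrier := cycles a\<rparr>\<^esub> x = proj (- f)"
      by (rule C.minus_equality)
        (use f in \<open>auto simp: proj_in_cycles_iff intro!: ext_boundaries_subset ext_boundaries_closed\<close>)
    then show "\<ominus>\<^bsub>KA a \<lparr>carrier := cycles a\<rparr>\<^esub> x \<in> boundaries a"
      using f by (simp add: proj_in_boundaries_iff ext_boundaries_closed)
  next
    fix x y assume "x \<in> boundaries a" "y \<in> boundaries a"
    then show "x \<oplus>\<^bsub>KA a \<lparr>carrier := cycles a\<rparr>\<^esub> y \<in> boundaries a"
      by (auto simp: boundaries_eq intro!: ext_boundaries_closed)
  qed
qed (auto simp: boundaries_eq cycles_eq intro!: imageI intro: ext_boundaries_times)

definition hproj :: "('n, ('n, 'k) mpol) exterior \<Rightarrow> ('n set \<Rightarrow> ('n, 'k) mpol set) set" where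
  "hproj f = hclass a (proj f)"

lemma hclass_ring_hom_ring:
  "ring_hom_ring (KA a \<lparr>carrier := cycles a\<rparr>) (koszul_homology a) (hclass a)"
proof -
  have "hclass a = (+>\<^bsub>KA a \<lparr>carrier := cycles a\<rparr>\<^esub>) (boundaries a)"
    by (simp add: fun_eq_iff hclass_def a_r_coset_def r_coset_def)
  then show ?thesis
    using ideal.rcos_ring_hom_ring[OF ideal_boundaries] by (simp add: koszul_homology_def)
qed

lemma ring_koszul_homology: "ring (koszul_homology a)"
  using hclass_ring_hom_ring by (rule ring_hom_ring.axioms)

lemma hproj_simps:
  assumes "f \<in> ext_cycles" "g \<in> ext_cycles"
  shows "hproj f \<oplus>\<^bsub>koszul_homology a\<^esub> hproj g = hproj (f + g)"
    and "hproj f \<otimes>\<^bsub>koszul_homology a\<^esub> hproj g = hproj (f * g)"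
proof -
  interpret H: ring_hom_ring "KA a \<lparr>carrier := cycles a\<rparr>" "koszul_homology a" "hclass a"
    by (rule hclass_ring_hom_ring)
  show "hproj f \<oplus>\<^bsub>koszul_homology a\<^esub> hproj g = hproj (f + g)"
    using H.hom_add[of "proj f" "proj g"] assms by (simp add: hproj_def proj_in_cycles_iff)
  show "hproj f \<otimes>\<^bsub>koszul_homology a\<^esub> hproj g = hproj (f * g)"
    using H.hom_mult[of "proj f" "proj g"] assms by (simp add: hproj_def proj_in_cycles_iff)
qed

lemma hproj_one: "hproj 1 = \<one>\<^bsub>koszul_homology a\<^esub>"
proof -
  interpret H: ring_hom_ring "KA a \<lparr>carrier := cycles a\<rparr>" "koszul_homology a" "hclass a"
    by (rule hclass_ring_hom_ring)
  show ?thesis using H.hom_one by (simp add: hproj_def)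
qed

lemma koszul_homology_carrier: "carrier (koszul_homology a) = hproj ` ext_cycles"
proof -
  have "carrier (koszul_homology a) = hclass a ` cycles a"
    by (auto simp: koszul_homology_def FactRing_def A_RCOSETS_defs hclass_def a_r_coset_def r_coset_def)
  then show ?thesis
    by (simp add: cycles_eq hproj_def image_image)
qed

lemma hproj_eq_iff: "hproj f = hproj g \<longleftrightarrow> f - g \<in> ext_boundaries"
proof -
  have eq: "hproj f = {proj (u + f) |u. u \<in> ext_boundaries}" for f
    by (auto simp: hproj_def hclass_def a_r_coset_def r_coset_def boundaries_eq)
  show ?thesis
  proof
    assume "hproj f = hproj g"
    moreover have "proj f \<in> hproj f"
      unfolding eq using ext_boundaries_closed(1) by (intro CollectI exI[of _ 0]) simp
    ultimately obtain u where u: "u \<in> ext_boundaries" "proj f = proj (u + g)"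
      unfolding eq by blast
    then have "f - (u + g) \<in> ext_boundaries"
      by (intro null_ext_subset_boundaries) (simp add: proj_eq_iff)
    from ext_boundaries_closed(2)[OF this u(1)] show "f - g \<in> ext_boundaries" by simp
  next
    assume fg: "f - g \<in> ext_boundaries"
    have "proj (u + f) \<in> hproj g" if "u \<in> ext_boundaries" for u
      unfolding eq using that fg ext_boundaries_closed(2) by (intro CollectI exI[of _ "u + (f - g)"]) auto
    moreover have "proj (u + g) \<in> hproj f" if "u \<in> ext_boundaries" for u
      unfolding eq using that fg ext_boundaries_closed(3) by (intro CollectI exI[of _ "u - (f - g)"]) auto
    ultimately show "hproj f = hproj g"
      unfolding eq by blast
  qed
qed

text \<open>
  If \<open>x\<^sub>j\<close> divides both multidegrees, both cycles are homologous to multiples of \<open>e\<^sub>j\<close>, and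
  \<open>e\<^sub>j\<close> has square zero.
\<close>

lemma times_boundary_if_not_coprime:
  assumes f: "f \<in> ext_cycles" "f \<in> homogeneous i \<alpha>" and g: "g \<in> ext_cycles" "g \<in> homogeneous i' \<beta>"
    and nc: "\<not> mon_coprime \<alpha> \<beta>"
  shows "f * g \<in> ext_boundaries"
proof -
  obtain j where j: "Poly_Mapping.lookup \<alpha> j \<noteq> 0" "Poly_Mapping.lookup \<beta> j \<noteq> 0"
    using nc by (auto simp: mon_coprime_iff)
  have clear: "\<exists>h. \<forall>F. j \<notin> F \<longrightarrow> ecoef (u - kdiff xvar h) F = 0"
    if u: "u \<in> homogeneous m \<gamma>" and \<gamma>: "Poly_Mapping.lookup \<gamma> j \<noteq> 0" for u m \<gamma>
  proof -
    have "xvar j dvd ecoef u F" if "j \<notin> F" for F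
    proof (cases "ecoef u F = 0")
      case False
      with u obtain \<delta> c where \<delta>: "\<delta> + set_degree F = \<gamma>" "ecoef u F = Poly_Mapping.single \<delta> c"
        by (rule homogeneousE)
      then have "Poly_Mapping.lookup \<delta> j \<noteq> 0"
        using \<gamma> that by (auto simp: lookup_add lookup_set_degree)
      from single_eq_xvar_times[OF this, of c] \<delta>(2) show ?thesis
        by simp
    qed simp
    then show ?thesis using kdiff_clear_index[of j xvar u] by metis
  qed
  obtain h where h: "\<And>F. j \<notin> F \<Longrightarrow> ecoef (f - kdiff xvar h) F = 0"
    using clear[OF f(2) j(1)] by blast
  obtain h' where h': "\<And>F. j \<notin> F \<Longrightarrow> ecoef (g - kdiff xvar h') F = 0"
    using clear[OF g(2) j(2)] by blast
  have "(f - kdiff xvar h) * (g - kdiff xvar h') = 0"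
    by (rule times_eq_0_if_common_index[OF h h'])
  then have "f * g = kdiff xvar h * g + (f - kdiff xvar h) * kdiff xvar h'"
    by (simp add: algebra_simps)
  moreover have "kdiff xvar h \<in> ext_cycles"
    by (intro ext_boundaries_subset kdiff_in_ext_boundaries)
  ultimately show ?thesis
    using f(1) g(1) by (simp add: ext_boundaries_closed ext_boundaries_times kdiff_in_ext_boundaries ext_cycles_closed)
qed

text \<open>In degree \<open>0\<close> the homology is spanned by the unit, since \<open>x\<^sub>j\<close> is the boundary of \<open>e\<^sub>j\<close>.\<close>

lemma remove_degree_0:
  obtains h where "ecoef (f - escalar (xconst (Poly_Mapping.lookup (ecoef f {}) 0)) - kdiff xvar h) {} = 0"
proof -
  obtain q where q: "ecoef f {} = xconst (Poly_Mapping.lookup (ecoef f {}) 0) + (\<Sum>j\<in>UNIV. xvar j * q j)"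
    by (rule mpol_eq_const_plus_vars)
  \<comment> \<open>\<open>h\<close> is the sum of the \<open>q j\<close> e_j; sets of other sizes
    get 0.\<close>
  define h where "h = Exterior (\<lambda>F. if card F = 1 then q (the_elem F) else 0)"
  have "ecoef (kdiff xvar h) {} = (\<Sum>j\<in>UNIV. xvar j * q j)"
    by (simp add: ecoef_kdiff h_def)
  then have "ecoef (f - escalar (xconst (Poly_Mapping.lookup (ecoef f {}) 0)) - kdiff xvar h) {} = 0"
    using q by (simp add: algebra_simps)
  then show ?thesis by (rule that)
qed

text \<open>In degree 0 a boundary lies in \<open>a\<close> plus the ideal of the variables, and
  neither contributes a constant term. This keeps nonzero constants nonzero in the homology.\<close>

lemma lookup_boundary_0:
  assumes "f \<in> ext_boundaries" and a0: "\<And>p. p \<in> a \<Longrightarrow> Poly_Mapping.lookup p 0 = 0"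
  shows "Poly_Mapping.lookup (ecoef f {}) 0 = 0"
proof -
  obtain g where "f - kdiff xvar g \<in> null_ext"
    using assms(1) unfolding ext_boundaries_def by blast
  then have "Poly_Mapping.lookup (ecoef (f - kdiff xvar g) {}) 0 = 0"
    by (intro a0) (simp add: null_ext_def)
  then show ?thesis
    by (simp add: ecoef_kdiff lookup_minus lookup_sum)
qed

end


section \<open>Words and the free algebra\<close>

lemma keys_uminus [simp]: "Poly_Mapping.keys (- p) = Poly_Mapping.keys (p :: _ \<Rightarrow>\<^sub>0 'b::ab_group_add)"
  by (auto simp: in_keys_iff)

lemma carrier_free_algebra:
  "carrier (free_algebra V) = {p. \<forall>w\<in>Poly_Mapping.keys p. set (letters w) \<subseteq> V}"
  by (simp add: free_algebra_def)

lemma free_algebra_simps [simp]: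
  "p \<otimes>\<^bsub>free_algebra V\<^esub> q = p * q"
  "\<one>\<^bsub>free_algebra V\<^esub> = 1"
  "\<zero>\<^bsub>free_algebra V\<^esub> = 0"
  "p \<oplus>\<^bsub>free_algebra V\<^esub> q = p + q"
  by (simp_all add: free_algebra_def)

lemma ring_free_algebra: "ring (free_algebra V :: ('v word \<Rightarrow>\<^sub>0 'k::field) ring)"
proof -
  interpret R: ring "ring_of_type_algebra :: ('v word \<Rightarrow>\<^sub>0 'k) ring"
    by (rule ring_ring_of_type_algebra)
  have "subring {p. \<forall>w\<in>Poly_Mapping.keys p. set (letters w) \<subseteq> V} (ring_of_type_algebra :: ('v word \<Rightarrow>\<^sub>0 'k) ring)"
  proof (rule R.subringI)
    fix p q :: "'v word \<Rightarrow>\<^sub>0 'k"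
    assume pq: "p \<in> {p. \<forall>w\<in>Poly_Mapping.keys p. set (letters w) \<subseteq> V}"
      "q \<in> {p. \<forall>w\<in>Poly_Mapping.keys p. set (letters w) \<subseteq> V}"
    then show "p \<oplus>\<^bsub>ring_of_type_algebra\<^esub> q \<in> {p. \<forall>w\<in>Poly_Mapping.keys p. set (letters w) \<subseteq> V}"
      using keys_add[of p q] by auto
    show "p \<otimes>\<^bsub>ring_of_type_algebra\<^esub> q \<in> {p. \<forall>w\<in>Poly_Mapping.keys p. set (letters w) \<subseteq> V}"
    proof (simp, rule ballI)
      fix w assume "w \<in> Poly_Mapping.keys (p * q)"
      then obtain u v where "w = u + v" "u \<in> Poly_Mapping.keys p" "v \<in> Poly_Mapping.keys q"
        using keys_mult[of p q] by blast
      then show "set (letters w) \<subseteq> V"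
        using pq by (simp add: plus_word_def)
    qed
  qed (auto simp: zero_word_def)
  then show ?thesis
    unfolding free_algebra_def by (rule R.subring_is_ring)
qed

lemma a_inv_free_algebra [simp]:
  "p \<in> carrier (free_algebra V) \<Longrightarrow> \<ominus>\<^bsub>free_algebra V\<^esub> p = - (p :: 'v word \<Rightarrow>\<^sub>0 'k::field)"
proof -
  interpret ring "free_algebra V :: ('v word \<Rightarrow>\<^sub>0 'k) ring" by (rule ring_free_algebra)
  show "p \<in> carrier (free_algebra V) \<Longrightarrow> \<ominus>\<^bsub>free_algebra V\<^esub> p = - p"
    by (rule minus_equality) (auto simp: carrier_free_algebra)
qed

lemma a_minus_free_algebra:
  "p \<in> carrier (free_algebra V) \<Longrightarrow> q \<in> carrier (free_algebra V) \<Longrightarrow>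
    p \<ominus>\<^bsub>free_algebra V\<^esub> q = p - (q :: 'v word \<Rightarrow>\<^sub>0 'k::field)"
  by (simp add: a_minus_def)

lemma free_algebra_closed:
  fixes p q :: "'v word \<Rightarrow>\<^sub>0 'k::field"
  shows "(0 :: 'v word \<Rightarrow>\<^sub>0 'k) \<in> carrier (free_algebra V)" "(1 :: 'v word \<Rightarrow>\<^sub>0 'k) \<in> carrier (free_algebra V)"
    "p \<in> carrier (free_algebra V) \<Longrightarrow> q \<in> carrier (free_algebra V) \<Longrightarrow> p + q \<in> carrier (free_algebra V)"
    "p \<in> carrier (free_algebra V) \<Longrightarrow> q \<in> carrier (free_algebra V) \<Longrightarrow> p * q \<in> carrier (free_algebra V)"
    "p \<in> carrier (free_algebra V) \<Longrightarrow> - p \<in> carrier (free_algebra V)"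
    "p \<in> carrier (free_algebra V) \<Longrightarrow> q \<in> carrier (free_algebra V) \<Longrightarrow> p - q \<in> carrier (free_algebra V)"
    "p \<in> carrier (free_algebra V) \<Longrightarrow> (- 1) ^ n * p \<in> carrier (free_algebra V)"
proof -
  interpret ring "free_algebra V :: ('v word \<Rightarrow>\<^sub>0 'k) ring" by (rule ring_free_algebra)
  show "(0 :: 'v word \<Rightarrow>\<^sub>0 'k) \<in> carrier (free_algebra V)" "(1 :: 'v word \<Rightarrow>\<^sub>0 'k) \<in> carrier (free_algebra V)"
    using zero_closed one_closed by simp_all
  show "p + q \<in> carrier (free_algebra V)" "p * q \<in> carrier (free_algebra V)" "p - q \<in> carrier (free_algebra V)"
    if "p \<in> carrier (free_algebra V)" "q \<in> carrier (free_algebra V)"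
    using a_closed[OF that] m_closed[OF that] minus_closed[OF that] that by (simp_all add: a_minus_free_algebra)
  show neg: "- p \<in> carrier (free_algebra V)" if "p \<in> carrier (free_algebra V)"
    using a_inv_closed[OF that] that by simp
  show "(- 1) ^ n * p \<in> carrier (free_algebra V)" if "p \<in> carrier (free_algebra V)"
    using that neg[OF that] by (cases "even n") simp_all
qed

lemma free_algebra_sum_closed:
  "(\<And>x. x \<in> A \<Longrightarrow> f x \<in> carrier (free_algebra V)) \<Longrightarrow> sum f A \<in> carrier (free_algebra V)"
  by (induction A rule: infinite_finite_induct) (auto intro: free_algebra_closed)

lemma single_in_free_algebra:
  "set (letters w) \<subseteq> V \<Longrightarrow> Poly_Mapping.single w c \<in> carrier (free_algebra V)"
  by (simp add: carrier_free_algebra)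

lemma const_in_free_algebra: "Poly_Mapping.single 0 c \<in> carrier (free_algebra V)"
  by (simp add: carrier_free_algebra zero_word_def)

lemma Yword_in_free_algebra: "set vs \<subseteq> V \<Longrightarrow> Yword vs \<in> carrier (free_algebra V)"
  by (simp add: Yword_def single_in_free_algebra)

definition word_eval :: "('v \<Rightarrow> ('n::{finite,linorder}, ('n, 'k::field) mpol) exterior)
    \<Rightarrow> ('v word \<Rightarrow>\<^sub>0 'k) \<Rightarrow> ('n, ('n, 'k) mpol) exterior" where
  "word_eval h p = (\<Sum>w\<in>Poly_Mapping.keys p.
     escalar (xconst (Poly_Mapping.lookup p w)) * prod_list (map h (letters w)))"

lemma word_eval_superset:
  assumes "finite A" "Poly_Mapping.keys p \<subseteq> A"
  shows "word_eval h p = (\<Sum>w\<in>A. escalar (xconst (Poly_Mapping.lookup p w)) * prod_list (map h (letters w)))"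
  unfolding word_eval_def using assms by (intro sum.mono_neutral_left) (auto simp: in_keys_iff)

lemma word_eval_0 [simp]: "word_eval h 0 = 0"
  by (simp add: word_eval_def)

lemma word_eval_add: "word_eval h (p + q) = word_eval h p + word_eval h q"
proof -
  let ?A = "Poly_Mapping.keys p \<union> Poly_Mapping.keys q"
  have "finite ?A" "Poly_Mapping.keys (p + q) \<subseteq> ?A" by (auto dest: subsetD[OF keys_add])
  then show ?thesis
    by (subst (1 2 3) word_eval_superset[of ?A])
      (auto simp: lookup_add distrib_right sum.distrib)
qed

lemma word_eval_single:
  "word_eval h (Poly_Mapping.single w c) = escalar (xconst c) * prod_list (map h (letters w))"
  by (subst word_eval_superset[of "{w}"]) auto

text \<open>It suffices to multiply two scaled words, and there the constants are central.\<close>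

lemma word_eval_times:
  fixes h :: "'v \<Rightarrow> ('n::{finite,linorder}, ('n, 'k::field) mpol) exterior"
  shows "word_eval h (p * q) = word_eval h p * word_eval h q"
proof (induction p rule: poly_mapping_induct_sum)
  case (single w c)
  show ?case
  proof (induction q rule: poly_mapping_induct_sum)
    case (single w' c')
    have "escalar (xconst c) * escalar (xconst c') * (P * Q) =
        escalar (xconst c) * P * (escalar (xconst c') * Q)" for P Q :: "('n, ('n, 'k) mpol) exterior"
      by (metis (no_types, lifting) escalar_commute mult.assoc)
    then show ?case
      by (simp add: mult_single word_eval_single plus_word_def)
  qed (simp_all add: distrib_left word_eval_add)
qed (simp_all add: distrib_right word_eval_add)

lemma word_eval_1 [simp]: "word_eval h 1 = 1"
proof -
  have "word_eval h (Poly_Mapping.single 0 1) = 1"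
    unfolding word_eval_single by (simp add: zero_word_def)
  then show ?thesis by simp
qed

lemma word_eval_const: "word_eval h (Poly_Mapping.single 0 c) = escalar (xconst c)"
  by (simp add: word_eval_single zero_word_def)

lemma word_eval_uminus: "word_eval h (- p) = - word_eval h p"
proof -
  have "word_eval h p + word_eval h (- p) = 0"
    by (simp flip: word_eval_add)
  then show ?thesis
    by (rule minus_unique[symmetric])
qed

lemma word_eval_diff: "word_eval h (p - q) = word_eval h p - word_eval h q"
  using word_eval_add[of h p "- q"] by (simp add: word_eval_uminus)

lemma word_eval_sum: "word_eval h (sum f A) = (\<Sum>x\<in>A. word_eval h (f x))"
  by (induction A rule: infinite_finite_induct) (auto simp: word_eval_add)

lemma word_eval_Yword: "word_eval h (Yword vs) = prod_list (map h vs)"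
  by (simp add: Yword_def word_eval_single)

lemma word_eval_sign_times: "word_eval h ((- 1) ^ m * p) = (- 1) ^ m * word_eval h p"
  by (cases "even m") (simp_all add: word_eval_uminus)

lemma ideal_gc_ideal: "ideal (gc_ideal V d :: ('v word \<Rightarrow>\<^sub>0 'k::field) set) (free_algebra V)"
proof -
  interpret ring "free_algebra V :: ('v word \<Rightarrow>\<^sub>0 'k) ring" by (rule ring_free_algebra)
  show ?thesis
    unfolding gc_ideal_def
    by (rule genideal_ideal) (auto intro!: free_algebra_closed Yword_in_free_algebra)
qed

lemma gc_class_hom:
  "ring_hom_ring (free_algebra V) (gc_poly_ring V d) (gc_class V d :: ('v word \<Rightarrow>\<^sub>0 'k::field) \<Rightarrow> _)"
proof -
  have "gc_class V d = (+>\<^bsub>free_algebra V :: ('v word \<Rightarrow>\<^sub>0 'k) ring\<^esub>) (gc_ideal V d)"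
    by (simp add: fun_eq_iff gc_class_def)
  then show ?thesis
    using ideal.rcos_ring_hom_ring[OF ideal_gc_ideal[of V d]] by (simp add: gc_poly_ring_def)
qed

lemma carrier_gc_poly_ring: "carrier (gc_poly_ring V d) = gc_class V d ` carrier (free_algebra V)"
  by (auto simp: gc_poly_ring_def FactRing_def A_RCOSETS_defs gc_class_def a_r_coset_def r_coset_def)


section \<open>Homomorphisms on quotient rings\<close>

lemma ring_hom_ring_quotient:
  assumes "ring_hom_ring R S h" "ideal I R" and ker: "\<And>x. x \<in> I \<Longrightarrow> h x = \<zero>\<^bsub>S\<^esub>"
  obtains h' where "ring_hom_ring (R Quot I) S h'" "\<And>x. x \<in> carrier R \<Longrightarrow> h' (I +>\<^bsub>R\<^esub> x) = h x"
proof -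
  interpret h: ring_hom_ring R S h by fact
  interpret I: ideal I R by fact
  \<comment> \<open>\<open>h\<close> is constant on each coset, so its image is a singleton.\<close>
  define h' where "h' A = the_elem (h ` A)" for A
  have coset: "h' (I +>\<^bsub>R\<^esub> x) = h x" if x: "x \<in> carrier R" for x
  proof -
    have "h (u \<oplus>\<^bsub>R\<^esub> x) = h x" if "u \<in> I" for u
      using that x by (simp add: ker I.a_Hcarr)
    then have "h ` (I +>\<^bsub>R\<^esub> x) \<subseteq> {h x}"
      by (auto simp: a_r_coset_def r_coset_def)
    moreover have "x \<in> I +>\<^bsub>R\<^esub> x"
      using x by (rule I.a_rcos_self)
    ultimately have "h ` (I +>\<^bsub>R\<^esub> x) = {h x}"
      by blast
    then show ?thesis by (simp add: h'_def)
  qed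
  have carr: "carrier (R Quot I) = (+>\<^bsub>R\<^esub>) I ` carrier R"
    by (auto simp: FactRing_def A_RCOSETS_defs a_r_coset_def r_coset_def)
  have "h' \<in> ring_hom (R Quot I) S"
  proof (rule ring_hom_memI)
    fix A B assume "A \<in> carrier (R Quot I)" "B \<in> carrier (R Quot I)"
    then obtain x y where xy: "x \<in> carrier R" "y \<in> carrier R" "A = I +>\<^bsub>R\<^esub> x" "B = I +>\<^bsub>R\<^esub> y"
      unfolding carr by blast
    show "h' (A \<otimes>\<^bsub>R Quot I\<^esub> B) = h' A \<otimes>\<^bsub>S\<^esub> h' B"
      using xy by (simp add: FactRing_def I.rcoset_mult_add coset)
    show "h' (A \<oplus>\<^bsub>R Quot I\<^esub> B) = h' A \<oplus>\<^bsub>S\<^esub> h' B"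
      using xy by (simp add: FactRing_def I.a_rcos_sum coset)
  next
    fix A assume "A \<in> carrier (R Quot I)"
    then show "h' A \<in> carrier S"
      unfolding carr by (auto simp: coset)
  next
    show "h' \<one>\<^bsub>R Quot I\<^esub> = \<one>\<^bsub>S\<^esub>"
      by (simp add: FactRing_def coset)
  qed
  then have "ring_hom_ring (R Quot I) S h'"
    by (intro ring_hom_ringI2 I.quotient_is_ring h.S.ring_axioms)
  then show ?thesis using coset that by blast
qed


section \<open>The classes of a set of monomials\<close>

lemma class_rel_subset: "class_rel I \<subseteq> I \<times> I"
  unfolding class_rel_def by (rule trancl_subset_Sigma) auto

text \<open>Reflexivity is the point: a monomial shares a variable with itself unless it is
  1.\<close>

lemma equiv_class_rel:
  assumes "0 \<notin> I"
  shows "equiv I (class_rel I)"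
proof (rule equivI)
  show "class_rel I \<subseteq> I \<times> I" by (rule class_rel_subset)
  have "(m, m) \<in> class_rel I" if "m \<in> I" for m
    unfolding class_rel_def using that assms by (intro r_into_trancl) (auto simp: mon_coprime_self)
  then show "refl_on I (class_rel I)"
    by (auto simp: refl_on_def)
  show "sym (class_rel I)"
    unfolding class_rel_def by (intro sym_trancl) (auto simp: sym_def mon_coprime_commute)
  show "trans (class_rel I)"
    unfolding class_rel_def by (rule trans_trancl)
qed

lemma gcd_classes_coprime:
  assumes "0 \<notin> L" "C \<in> gcd_classes L" "D \<in> gcd_classes L" "C \<noteq> D" "m \<in> C" "m' \<in> D"
  shows "mon_coprime m m'"
proof (rule ccontr)
  note eq = equiv_class_rel[OF assms(1)]
  note q = assms(2,3)[unfolded gcd_classes_def]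
  assume "\<not> mon_coprime m m'"
  moreover have "m \<in> L" "m' \<in> L"
    using in_quotient_imp_subset[OF eq] q assms(5,6) by blast+
  ultimately have "(m, m') \<in> class_rel L"
    unfolding class_rel_def by (intro r_into_trancl) auto
  then have "C = D"
    using quotient_eqI[OF eq q assms(5,6)] by simp
  then show False using assms(4) by simp
qed

text \<open>A chain of non-coprime neighbours that starts in a class never leaves it, so it links
  its ends within the class alone.\<close>

lemma cl_gcd_class:
  assumes "0 \<notin> L" "C \<in> gcd_classes L"
  shows "cl C = 1"
proof -
  note eq = equiv_class_rel[OF assms(1)]
  note C = assms(2)[unfolded gcd_classes_def]
  have sub: "C \<subseteq> L" using in_quotient_imp_subset[OF eq C] .
  have "(m, m') \<in> class_rel C" if m: "m \<in> C" "m' \<in> C" for m m'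
  proof -
    have "(m, m') \<in> class_rel L"
      using quotient_eq_iff[OF eq C C m] by simp
    then have "m' \<in> C \<and> (m, m') \<in> class_rel C"
      unfolding class_rel_def[of L]
    proof (induction rule: trancl_induct)
      case (base y)
      then have "(m, y) \<in> class_rel L"
        unfolding class_rel_def by (rule r_into_trancl)
      then have "y \<in> C"
        using in_quotient_imp_closed[OF eq C m(1)] by simp
      then show ?case
        using base m(1) unfolding class_rel_def by (intro conjI r_into_trancl) auto
    next
      case (step y z)
      then have "(y, z) \<in> class_rel L"
        unfolding class_rel_def by (intro r_into_trancl)
      then have "z \<in> C"
        using in_quotient_imp_closed[OF eq C] step.IH by blast
      then show ?case
        using step unfolding class_rel_def by (auto intro: trancl_into_trancl)
    qed
    then show ?thesis ..
  qed
  then have rel: "class_rel C = C \<times> C"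
    using class_rel_subset[of C] by auto
  have "C \<noteq> {}" using in_quotient_imp_non_empty[OF eq C] .
  then have "gcd_classes C = {C}"
    unfolding gcd_classes_def rel quotient_def by auto
  then show ?thesis by (simp add: cl_def)
qed

lemma set_class_list:
  assumes "L \<subseteq> set gs"
  shows "set (class_list gs L) = gcd_classes L"
proof -
  have "{m \<in> set gs. m \<in> L} = L" using assms by blast
  then show ?thesis
    unfolding class_list_def gcd_classes_def quotient_def by simp blast
qed

lemma Union_gcd_classes: "0 \<notin> L \<Longrightarrow> \<Union>(gcd_classes L) = L"
  unfolding gcd_classes_def by (rule Union_quotient[OF equiv_class_rel])

lemma distinct_class_list [simp]: "distinct (class_list gs L)"
  by (simp add: class_list_def)

text \<open>Each matching lives on the Morse complex of its predecessors, whose basis is a part of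
  the original one.\<close>

lemma acyclic_matching_seq_edges:
  "acyclic_matching_seq C As \<Longrightarrow> \<Union>(set As) \<subseteq> bc_basis C \<times> bc_basis C"
proof (induction C As rule: acyclic_matching_seq.induct)
  case (2 C A As)
  have "A \<subseteq> bc_basis C \<times> bc_basis C"
    using 2(2) by (auto simp: acyclic_matching_def bc_edges_def)
  moreover have "\<Union>(set As) \<subseteq> bc_basis (morse_complex C A) \<times> bc_basis (morse_complex C A)"
    using 2 by simp
  moreover have "bc_basis (morse_complex C A) \<subseteq> bc_basis C"
    by (auto simp: morse_complex_def)
  ultimately show ?case
    unfolding list.set Union_insert by (intro Un_least) (blast intro: subset_trans[OF _ Sigma_mono])+
qed simp

text \<open>
  If a part coprime to the rest were matched, so would be the whole set, because each \<open>\<M>\<^sub>i\<close> is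
  generated from \<open>\<B>\<^sub>i\<close> by adjoining coprime sets.
\<close>

lemma critical_coprime_part:
  fixes gs :: "'n::{finite,linorder} monomial list"
  assumes std: "standard_matching TYPE('k::field) gs Ms"
    and crit: "I \<union> K \<in> critical gs Ms" and I: "I \<noteq> {}" and IK: "mon_coprime (mon_lcm I) (mon_lcm K)"
  shows "I \<in> critical gs Ms"
proof (rule ccontr)
  assume "I \<notin> critical gs Ms"
  have sub: "I \<subseteq> set gs" "K \<subseteq> set gs" using crit by (auto simp: critical_def)
  then have fin: "finite I" "finite K" by (auto intro: finite_subset)
  obtain e where e: "e \<in> all_edges Ms" "I = fst e \<or> I = snd e"
    using \<open>I \<notin> critical gs Ms\<close> I sub by (auto simp: critical_def)
  then obtain A M where M: "M \<in> set Ms" "A \<in> set M" "e \<in> A"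
    unfolding all_edges_def by auto
  then obtain j where "j < length Ms" "Ms ! j = M"
    by (auto simp: in_set_conv_nth[of M])
  with M have j: "j < length Ms" "e \<in> \<Union>(set (Ms ! j))"
    by auto
  from std[unfolded standard_matching_def, THEN conjunct2, THEN conjunct2, THEN conjunct2,
      THEN conjunct2, THEN spec, THEN mp, OF j(1)]
  obtain B where B: "\<Union>(set (Ms ! j)) =
      B \<union> {(I \<union> K, J \<union> K) | I J K. (I, J) \<in> B \<and> K \<subseteq> set gs \<and> mon_coprime (mon_lcm I) (mon_lcm K)}"
    by (elim exE conjE) (rule that)
  have edges: "\<Union>(set (Ms ! j)) \<subseteq> all_edges Ms"
    using j(1) unfolding all_edges_def by fastforce
  have lcm_eq: "mon_lcm U = mon_lcm W" if "(U, W) \<in> B" for U W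
  proof -
    have "(U, W) \<in> all_edges Ms" using that B edges by blast
    then show ?thesis
      using std[unfolded standard_matching_def, THEN conjunct2, THEN conjunct1] by fast
  qed
  have BU: "\<exists>f\<in>all_edges Ms. U \<union> H = fst f" "\<exists>f\<in>all_edges Ms. W \<union> H = snd f"
    if "(U, W) \<in> B" "H \<subseteq> set gs" "mon_coprime (mon_lcm U) (mon_lcm H)" for U W H
  proof -
    have "(U \<union> H, W \<union> H) \<in> all_edges Ms"
      using that B edges by blast
    then show "\<exists>f\<in>all_edges Ms. U \<union> H = fst f" "\<exists>f\<in>all_edges Ms. W \<union> H = snd f"
      by force+
  qed
  have "\<exists>U W H. (U, W) \<in> B \<and> H \<subseteq> set gs \<and> mon_coprime (mon_lcm U) (mon_lcm H) \<and> (I = U \<union> H \<or> I = W \<union> H)"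
  proof (cases "e \<in> B")
    case True
    then show ?thesis
      using e(2) by (intro exI[of _ "fst e"] exI[of _ "snd e"] exI[of _ "{}"]) (auto simp: mon_coprime_iff)
  next
    case False
    then obtain U W H where "e = (U \<union> H, W \<union> H)" "(U, W) \<in> B" "H \<subseteq> set gs" "mon_coprime (mon_lcm U) (mon_lcm H)"
      using j(2) B by blast
    then show ?thesis using e(2) by auto
  qed
  then obtain U W H where UW: "(U, W) \<in> B" and H: "H \<subseteq> set gs" "mon_coprime (mon_lcm U) (mon_lcm H)"
    and I_eq: "I = U \<union> H \<or> I = W \<union> H"
    by blast
  have finH: "finite H" using H(1) by (rule finite_subset) simp
  have "mon_coprime (mon_lcm U) (mon_lcm (H \<union> K))"
  proof -
    \<comment> \<open>\<open>I\<close> is built from one end of the edge, \<open>U\<close> or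
      \<open>W\<close>; as both have the same lcm, either serves to show that the edge is coprime to
      \<open>K\<close>.\<close>
    have "\<exists>T. T \<subseteq> I \<and> mon_lcm T = mon_lcm U"
      using I_eq lcm_eq[OF UW] by (metis Un_upper1)
    then obtain T where T: "T \<subseteq> I" "mon_lcm T = mon_lcm U" by blast
    then have finT: "finite T" using fin by (auto intro: finite_subset)
    show ?thesis
      using IK H(2) T(1) fin finT finH unfolding T(2)[symmetric]
      by (simp add: mon_coprime_lcm_iff) blast
  qed
  from BU[OF UW _ this] have
    "\<exists>f\<in>all_edges Ms. U \<union> (H \<union> K) = fst f" "\<exists>f\<in>all_edges Ms. W \<union> (H \<union> K) = snd f"
    using H(1) sub(2) by simp_all
  moreover have "I \<union> K = U \<union> (H \<union> K) \<or> I \<union> K = W \<union> (H \<union> K)"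
    using I_eq by blast
  ultimately have "\<exists>f\<in>all_edges Ms. I \<union> K = fst f \<or> I \<union> K = snd f"
    by metis
  then show False
    using crit by (auto simp: critical_def)
qed


section \<open>The presentation of the Koszul homology\<close>

locale koszul_data = quotient_koszul a
  for a :: "('n::{finite,linorder}, 'k::field) mpol set" +
  fixes gs :: "'n monomial list" and Ms :: "'n matching_seq"
    and \<phi> :: "'n monomial set \<Rightarrow> 'n set \<Rightarrow> ('n, 'k) mpol set"
  assumes kmap: "koszul_map a gs Ms \<phi>"
begin

abbreviation "crit \<equiv> critical gs Ms"

text \<open>The lift is chosen homogeneous because both graded commutativity and
  \<open>times_boundary_if_not_coprime\<close> depend on it.\<close>

definition lift_phi :: "'n monomial set \<Rightarrow> ('n, ('n, 'k) mpol) exterior" where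
  "lift_phi I = (SOME f. f \<in> homogeneous (card I) (mon_lcm I) \<and> proj f = \<phi> I)"

lemma lift_phi:
  assumes "I \<in> crit"
  shows "lift_phi I \<in> homogeneous (card I) (mon_lcm I)" "proj (lift_phi I) = \<phi> I" "lift_phi I \<in> ext_cycles"
proof -
  have "\<phi> I \<in> KA_hom a (card I) (mon_lcm I)" and cyc: "\<phi> I \<in> cycles a"
    using kmap assms unfolding koszul_map_def by blast+
  then have "\<exists>f. f \<in> homogeneous (card I) (mon_lcm I) \<and> proj f = \<phi> I"
    unfolding KA_hom_eq by auto
  then have f: "lift_phi I \<in> homogeneous (card I) (mon_lcm I) \<and> proj (lift_phi I) = \<phi> I"
    unfolding lift_phi_def by (rule someI_ex)
  then show "lift_phi I \<in> homogeneous (card I) (mon_lcm I)" "proj (lift_phi I) = \<phi> I"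
    by blast+
  with cyc show "lift_phi I \<in> ext_cycles"
    by (simp flip: proj_in_cycles_iff)
qed

definition lincomb :: "('n monomial set \<Rightarrow> 'k) \<Rightarrow> ('n, ('n, 'k) mpol) exterior" where
  "lincomb b = (\<Sum>L\<in>crit. escalar (xconst (b L)) * lift_phi L)"

lemma comb_eq: "comb a \<phi> crit b = proj (lincomb b)"
proof -
  interpret KA: ring "KA a" by (rule ring_KA)
  have "comb a \<phi> crit b = (\<Oplus>\<^bsub>KA a\<^esub>L\<in>crit. proj (escalar (xconst (b L)) * lift_phi L))"
    unfolding comb_def by (rule KA.finsum_cong') (auto simp flip: lift_phi(2))
  then show ?thesis by (simp add: lincomb_def)
qed

text \<open>Independence of the classes of the \<phi>(L): the injective coordinate map is applied to
  \<open>b\<close> and to the zero family.\<close>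

lemma lincomb_inj:
  assumes "lincomb b \<in> ext_boundaries" "\<And>L. L \<notin> crit \<Longrightarrow> b L = 0"
  shows "b = (\<lambda>_. 0)"
proof -
  have "inj_on (\<lambda>b. hclass a (comb a \<phi> crit b)) {b. \<forall>L. L \<notin> crit \<longrightarrow> b L = 0}"
    using kmap unfolding koszul_map_def bij_betw_def by blast
  moreover have "hclass a (comb a \<phi> crit b) = hclass a (comb a \<phi> crit (\<lambda>_. 0))"
    unfolding comb_eq hproj_def[symmetric] hproj_eq_iff using assms(1) by (simp add: lincomb_def)
  ultimately show ?thesis
    using assms(2) by (auto dest: inj_onD)
qed

text \<open>The condition at \<open>{}\<close> says that \<open>f\<close> has no component of degree
  0 over the quotient; the basis indexed by the critical sets covers the positive degrees
  only.\<close>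

lemma lincomb_surj:
  assumes "f \<in> ext_cycles" "ecoef f {} \<in> a"
  obtains b where "\<And>L. L \<notin> crit \<Longrightarrow> b L = 0" "f - lincomb b \<in> ext_boundaries"
proof -
  have image: "(\<lambda>b. hclass a (comb a \<phi> crit b)) ` {b. \<forall>L. L \<notin> crit \<longrightarrow> b L = 0} =
      hclass a ` {z \<in> cycles a. z {} = \<zero>\<^bsub>poly_ring Quot a\<^esub>}"
    using kmap unfolding koszul_map_def bij_betw_def by blast
  have "proj f \<in> {z \<in> cycles a. z {} = \<zero>\<^bsub>poly_ring Quot a\<^esub>}"
    using assms by (simp add: proj_in_cycles_iff quot_class_eq_iff) (simp add: proj_def quot_class_eq_iff)
  then have "hclass a (proj f) \<in> (\<lambda>b. hclass a (comb a \<phi> crit b)) ` {b. \<forall>L. L \<notin> crit \<longrightarrow> b L = 0}"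
    unfolding image by (rule imageI)
  then obtain b where b: "\<forall>L. L \<notin> crit \<longrightarrow> b L = 0" "hclass a (proj f) = hclass a (comb a \<phi> crit b)"
    by blast
  then have "f - lincomb b \<in> ext_boundaries"
    unfolding comb_eq hproj_def[symmetric] hproj_eq_iff by simp
  then show ?thesis using b(1) that by blast
qed

text \<open>If \<open>a\<close> is the whole ring, every element is a boundary, whereas the classes
  of the \<phi>(L) are independent. In the end this excludes the generator 1.\<close>

lemma critical_empty_if_unit:
  assumes "1 \<in> a"
  shows "crit = {}"
proof (rule ccontr)
  assume "crit \<noteq> {}"
  then obtain I where I: "I \<in> crit" by blast
  have "p \<in> a" for p using in_ideal(5)[OF assms, of p] by simp
  then have "lincomb (\<lambda>L. if L = I then 1 else 0) \<in> ext_boundaries"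
    by (intro null_ext_subset_boundaries) (simp add: null_ext_def)
  then have "(\<lambda>L. if L = I then 1 else 0 :: 'k) = (\<lambda>_. 0)"
    by (rule lincomb_inj) (use I in auto)
  from fun_cong[OF this, of I] show False by simp
qed

end

text \<open>\<open>zero_notin\<close> is derived from the hypotheses of the theorem. It makes the
  classes those of an equivalence relation and keeps constants out of \<open>a\<close>.\<close>

locale koszul_presentation = koszul_data a gs Ms \<phi>
  for a :: "('n::{finite,linorder}, 'k::field) mpol set" and gs Ms \<phi> +
  assumes a_eq: "a = mon_ideal (set gs)" and zero_notin: "0 \<notin> set gs"
    and std: "standard_matching TYPE('k) gs Ms"
begin

lemma lookup_0_if_in_a:
  assumes "p \<in> a"
  shows "Poly_Mapping.lookup p 0 = 0"
proof (rule ccontr)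
  assume "Poly_Mapping.lookup p 0 \<noteq> 0"
  then obtain g d where g: "g \<in> set gs" "0 = d + g"
    using assms unfolding a_eq mon_ideal_iff by (metis in_keys_iff)
  have "Poly_Mapping.lookup d j + Poly_Mapping.lookup g j = 0" for j
    using arg_cong[OF g(2), of "\<lambda>m. Poly_Mapping.lookup m j"] by (simp add: lookup_add)
  then have "g = 0"
    by (intro poly_mapping_eqI) simp
  then show False using g(1) zero_notin by simp
qed

abbreviation "V \<equiv> gens gs Ms"

lemma gens_critical: "I \<in> V \<Longrightarrow> I \<in> crit"
  by (simp add: gens_def)

lemma critical_subset: "L \<in> crit \<Longrightarrow> L \<subseteq> set gs" "L \<in> crit \<Longrightarrow> L \<noteq> {}"
    "L \<in> crit \<Longrightarrow> finite L" "L \<in> crit \<Longrightarrow> 0 \<notin> L"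
  using zero_notin by (auto simp: critical_def intro: finite_subset)

lemma phi_times_coprime:
  assumes "I \<in> crit" "J \<in> crit" "I \<union> J \<in> crit" "mon_coprime (mon_lcm I) (mon_lcm J)"
  shows "proj (lift_phi I * lift_phi J) = proj ((- 1) ^ inversions (gpos gs) I J * lift_phi (I \<union> J))"
proof -
  have "\<phi> I \<otimes>\<^bsub>KA a\<^esub> \<phi> J = alt_sign (KA a) (inversions (gpos gs) I J) (\<phi> (I \<union> J))"
    using kmap assms unfolding koszul_map_def by blast
  then show ?thesis
    using assms by (simp flip: lift_phi(2))
qed

text \<open>Split off one set \<open>C\<close>: it is coprime to the union \<open>U\<close> of the
  others, so \<open>C\<close> and \<open>U\<close> are critical along with their union, and the
  product rule applies with the sign of shuffling \<open>C\<close> with \<open>U\<close>. These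
  signs accumulate to \<open>list_inversions\<close>.\<close>

lemma phi_prod_classes:
  assumes "distinct Cs" "Cs \<noteq> []" "{} \<notin> set Cs" "\<Union>(set Cs) \<in> crit"
    and "\<And>C D m m'. C \<in> set Cs \<Longrightarrow> D \<in> set Cs \<Longrightarrow> C \<noteq> D \<Longrightarrow> m \<in> C \<Longrightarrow> m' \<in> D \<Longrightarrow> mon_coprime m m'"
  shows "proj (prod_list (map lift_phi Cs)) =
    proj ((- 1) ^ list_inversions (gpos gs) Cs * lift_phi (\<Union>(set Cs)))"
  using assms
proof (induction Cs)
  case (Cons C Cs)
  show ?case
  \<comment> \<open>The empty union is not critical, so the induction has to start at a single
    set.\<close>
  proof (cases "Cs = []")
    case True
    then show ?thesis by (simp add: inversions_def)
  next
    case False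
    define U where "U = \<Union>(set Cs)"
    have CU: "C \<union> U \<in> crit" and ne: "C \<noteq> {}" "U \<noteq> {}"
      using Cons.prems False by (auto simp: U_def neq_Nil_conv)
    then have "finite C" "finite U"
      using critical_subset(3)[OF CU] by simp_all
    moreover have "mon_coprime m m'" if "m \<in> C" "m' \<in> U" for m m'
      using that Cons.prems(1) Cons.prems(5)[of C _ m m'] by (auto simp: U_def)
    ultimately have cop: "mon_coprime (mon_lcm C) (mon_lcm U)"
      by (simp add: mon_coprime_lcm_iff)
    have C: "C \<in> crit"
      by (rule critical_coprime_part[OF std CU ne(1) cop])
    have U: "U \<in> crit"
      by (rule critical_coprime_part[OF std, of U C]) (use CU ne cop in \<open>simp_all add: Un_commute mon_coprime_commute\<close>)
    have "proj (prod_list (map lift_phi Cs)) = proj ((- 1) ^ list_inversions (gpos gs) Cs * lift_phi U)"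
      unfolding U_def using Cons False U by (intro Cons.IH) (auto simp: U_def)
    then have "proj (prod_list (map lift_phi (C # Cs))) =
        proj (lift_phi C) \<otimes>\<^bsub>KA a\<^esub> proj ((- 1) ^ list_inversions (gpos gs) Cs * lift_phi U)"
      by (simp flip: proj_simps(2))
    also have "\<dots> = proj ((- 1) ^ list_inversions (gpos gs) Cs) \<otimes>\<^bsub>KA a\<^esub> proj (lift_phi C * lift_phi U)"
      by (simp add: minus_one_power_left_commute)
    also have "\<dots> = proj ((- 1) ^ list_inversions (gpos gs) (C # Cs) * lift_phi (\<Union>(set (C # Cs))))"
    proof -
      have "(- 1) ^ list_inversions (gpos gs) Cs * ((- 1) ^ inversions (gpos gs) C U * lift_phi (C \<union> U)) =
          (- 1) ^ list_inversions (gpos gs) (C # Cs) * lift_phi (\<Union>(set (C # Cs)))"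
        by (simp only: mult.assoc[symmetric] power_add[symmetric] list_inversions.simps U_def list.set Union_insert add.commute)
      then show ?thesis
        unfolding phi_times_coprime[OF C U CU cop] by (simp only: proj_simps)
    qed
    finally show ?thesis .
  qed
qed simp

lemma class_list_props:
  assumes L: "L \<in> crit"
  shows "set (class_list gs L) \<subseteq> V" "{} \<notin> set (class_list gs L)" "\<Union>(set (class_list gs L)) = L"
    "class_list gs L \<noteq> []"
    "\<And>C D m m'. C \<in> set (class_list gs L) \<Longrightarrow> D \<in> set (class_list gs L) \<Longrightarrow> C \<noteq> D \<Longrightarrow>
      m \<in> C \<Longrightarrow> m' \<in> D \<Longrightarrow> mon_coprime m m'"
proof -
  note S = set_class_list[OF critical_subset(1)[OF L]]
  note zero = critical_subset(4)[OF L]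
  note eq = equiv_class_rel[OF zero]
  show union: "\<Union>(set (class_list gs L)) = L"
    unfolding S by (rule Union_gcd_classes[OF zero])
  then show "class_list gs L \<noteq> []"
    using critical_subset(2)[OF L] by auto
  show "{} \<notin> set (class_list gs L)"
    unfolding S gcd_classes_def using in_quotient_imp_non_empty[OF eq] by blast
  show cop: "mon_coprime m m'" if "C \<in> set (class_list gs L)" "D \<in> set (class_list gs L)" "C \<noteq> D" "m \<in> C" "m' \<in> D" for C D m m'
    using gcd_classes_coprime[OF zero] that unfolding S by blast
  have "C \<in> V" if C: "C \<in> set (class_list gs L)" for C
  proof -
    have "C \<subseteq> L" using union C by blast
    moreover have "C \<noteq> {}"
      using C in_quotient_imp_non_empty[OF eq] unfolding S gcd_classes_def by blast
    moreover have "mon_coprime m m'" if "m \<in> C" "m' \<in> L - C" for m m'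
    proof -
      obtain D where "D \<in> set (class_list gs L)" "m' \<in> D" using union \<open>m' \<in> L - C\<close> by blast
      then show ?thesis using cop[OF C] that by blast
    qed
    moreover have "finite C" "finite (L - C)"
      using critical_subset(3)[OF L] \<open>C \<subseteq> L\<close> by (auto intro: finite_subset)
    \<comment> \<open>The rest \<open>L - C\<close> lies in the other classes, hence is coprime to
      \<open>C\<close>.\<close>
    ultimately have "C \<in> crit"
      using L by (intro critical_coprime_part[OF std, of C "L - C"]) (simp_all add: mon_coprime_lcm_iff Un_absorb1)
    moreover have "cl C = 1"
      using C cl_gcd_class[OF zero] unfolding S by blast
    ultimately show ?thesis by (simp add: gens_def)
  qed
  then show "set (class_list gs L) \<subseteq> V" by blast
qed

lemma class_list_degrees:
  assumes L: "L \<in> crit"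
  shows "sum_list (map card (class_list gs L)) = card L" "sum_list (map mon_lcm (class_list gs L)) = mon_lcm L"
proof -
  have "sum_list (map card Cs) = card (\<Union>(set Cs)) \<and> sum_list (map mon_lcm Cs) = mon_lcm (\<Union>(set Cs))"
    if "distinct Cs" "finite (\<Union>(set Cs))" "0 \<notin> \<Union>(set Cs)"
      "\<And>C D m m'. C \<in> set Cs \<Longrightarrow> D \<in> set Cs \<Longrightarrow> C \<noteq> D \<Longrightarrow> m \<in> C \<Longrightarrow> m' \<in> D \<Longrightarrow> mon_coprime m m'"
    for Cs :: "'n monomial set list"
    using that
  proof (induction Cs)
    case (Cons C Cs)
    have cop: "mon_coprime m m'" if "m \<in> C" "m' \<in> \<Union>(set Cs)" for m m'
      using that Cons.prems(1) Cons.prems(4)[of C _ m m'] by auto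
    have fin: "finite C" "finite (\<Union>(set Cs))"
      using Cons.prems(2) by simp_all
    \<comment> \<open>A common monomial would be coprime to itself, hence 1.\<close>
    have "C \<inter> \<Union>(set Cs) = {}"
    proof (rule ccontr)
      assume "C \<inter> \<Union>(set Cs) \<noteq> {}"
      then obtain m where m: "m \<in> C" "m \<in> \<Union>(set Cs)" by blast
      then have "m = 0" using cop[OF m] by (simp add: mon_coprime_self)
      then show False using m Cons.prems(3) by simp
    qed
    moreover have "mon_coprime (mon_lcm C) (mon_lcm (\<Union>(set Cs)))"
      using fin cop by (simp only: mon_coprime_lcm_iff) blast
    moreover have "sum_list (map card Cs) = card (\<Union>(set Cs)) \<and> sum_list (map mon_lcm Cs) = mon_lcm (\<Union>(set Cs))"
      by (rule Cons.IH) (use Cons.prems in auto)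
    ultimately show ?case
      using fin by (simp add: card_Un_disjoint mon_lcm_Un_coprime)
  qed simp
  from this[of "class_list gs L"] class_list_props[OF L] critical_subset[OF L]
  show "sum_list (map card (class_list gs L)) = card L" "sum_list (map mon_lcm (class_list gs L)) = mon_lcm L"
    by simp_all
qed

section \<open>Evaluation of words\<close>

abbreviation "\<Theta> \<equiv> word_eval lift_phi"

lemma prod_list_cycle: "set Is \<subseteq> crit \<Longrightarrow> prod_list (map lift_phi Is) \<in> ext_cycles"
  by (induction Is) (auto intro: ext_cycles_closed lift_phi)

lemma prod_list_homogeneous:
  "set Is \<subseteq> crit \<Longrightarrow> prod_list (map lift_phi Is) \<in> homogeneous (sum_list (map card Is)) (sum_list (map mon_lcm Is))"
  by (induction Is) (auto intro: homogeneous_1 homogeneous_times lift_phi)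

lemma word_eval_cycle:
  assumes "p \<in> carrier (free_algebra V)"
  shows "\<Theta> p \<in> ext_cycles"
  unfolding word_eval_def using assms gens_critical
  by (intro ext_cycles_sum ext_cycles_closed prod_list_cycle) (auto simp: carrier_free_algebra)

text \<open>The product rule is an equation of chains over the quotient, so between the lifts it
  holds modulo \<open>null_ext\<close>; the sign in \<open>Ycl\<close> undoes the sign of
  \<open>phi_prod_classes\<close>.\<close>

lemma word_eval_Ycl:
  assumes L: "L \<in> crit"
  shows "\<Theta> (Ycl gs L) - lift_phi L \<in> null_ext"
proof -
  let ?n = "list_inversions (gpos gs) (class_list gs L)"
  have "proj (prod_list (map lift_phi (class_list gs L))) = proj ((- 1) ^ ?n * lift_phi (\<Union>(set (class_list gs L))))"
    by (rule phi_prod_classes) (use class_list_props[OF L] L in auto)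
  then have "prod_list (map lift_phi (class_list gs L)) - (- 1) ^ ?n * lift_phi L \<in> null_ext"
    unfolding class_list_props(3)[OF L] by (simp add: proj_eq_iff)
  then have "(- 1) ^ ?n * (prod_list (map lift_phi (class_list gs L)) - (- 1) ^ ?n * lift_phi L) \<in> null_ext"
    by (rule null_ext_closed)
  then show ?thesis
    unfolding Ycl_def word_eval_sign_times word_eval_Yword right_diff_distrib
    by (simp flip: mult.assoc power_add mult_2)
qed

text \<open>The constant accounts for degree 0, the Y_L for the positive degrees. Coefficients enter
  as constant elements of the free algebra, because a \<open>ring\<close> record has no
  scalars.\<close>

definition normal_form :: "'k \<Rightarrow> ('n monomial set \<Rightarrow> 'k) \<Rightarrow> ('n monomial set word \<Rightarrow>\<^sub>0 'k)" where
  "normal_form c b = Poly_Mapping.single 0 c + (\<Sum>L\<in>crit. Poly_Mapping.single 0 (b L) * Ycl gs L)"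

lemma single_times_Ycl:
  "Poly_Mapping.single 0 d * Ycl gs L =
    Poly_Mapping.single (Word (class_list gs L)) (d * (- 1) ^ list_inversions (gpos gs) (class_list gs L))"
  by (cases "even (list_inversions (gpos gs) (class_list gs L))")
    (simp_all add: Ycl_def Yword_def mult_single single_uminus)

lemma Ycl_in_free_algebra: "L \<in> crit \<Longrightarrow> Ycl gs L \<in> carrier (free_algebra V)"
  unfolding Ycl_def using class_list_props(1) by (intro free_algebra_closed Yword_in_free_algebra)

lemma normal_form_in_free_algebra: "normal_form c b \<in> carrier (free_algebra V)"
  unfolding normal_form_def
  by (intro free_algebra_closed free_algebra_sum_closed const_in_free_algebra Ycl_in_free_algebra)

lemma word_eval_combination:
  "\<Theta> (\<Sum>L\<in>crit. Poly_Mapping.single 0 (b L) * Ycl gs L) - lincomb b \<in> null_ext"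
proof -
  have "\<Theta> (\<Sum>L\<in>crit. Poly_Mapping.single 0 (b L) * Ycl gs L) - lincomb b =
      (\<Sum>L\<in>crit. escalar (xconst (b L)) * (\<Theta> (Ycl gs L) - lift_phi L))"
    by (simp add: lincomb_def word_eval_sum word_eval_times word_eval_const right_diff_distrib sum_subtractf)
  moreover have "sum f A \<in> null_ext" if "\<And>x. x \<in> A \<Longrightarrow> f x \<in> null_ext" for f and A :: "'n monomial set set"
    using that by (induction A rule: infinite_finite_induct) (auto intro: null_ext_closed)
  ultimately show ?thesis
    by (simp add: word_eval_Ycl null_ext_closed)
qed

lemma word_eval_normal_form:
  "\<Theta> (normal_form c b) - (escalar (xconst c) + lincomb b) \<in> null_ext"
  using word_eval_combination[of b] by (simp add: normal_form_def word_eval_add word_eval_const)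

lemma phi_prod_eq: "set Is \<subseteq> crit \<Longrightarrow> phi_prod a \<phi> Is = proj (prod_list (map lift_phi Is))"
  by (induction Is) (simp_all add: phi_prod_def flip: lift_phi(2))

text \<open>Critical sets are nonempty, so a nonempty product of the lifts is homogeneous of
  positive degree. This puts it within reach of \<open>lincomb_surj\<close>.\<close>

lemma prod_list_degree_0:
  assumes "Is \<noteq> []" "set Is \<subseteq> crit"
  shows "ecoef (prod_list (map lift_phi Is)) {} = 0"
proof (rule ccontr)
  assume nz: "ecoef (prod_list (map lift_phi Is)) {} \<noteq> 0"
  have "card ({} :: 'n set) = sum_list (map card Is)"
    by (rule homogeneousE[OF prod_list_homogeneous[OF assms(2)] nz])
  moreover obtain I Is' where Is: "Is = I # Is'" using assms(1) by (cases Is) auto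
  moreover have "card I \<noteq> 0"
    using critical_subset(2,3)[of I] assms(2) Is by simp
  ultimately show False by simp
qed

text \<open>Two letters with a common variable give a boundary by
  \<open>times_boundary_if_not_coprime\<close>. The second kind holds by its own side condition,
  once each Y_L is replaced by the lift of \<phi>(L) modulo \<open>null_ext\<close>; the third holds
  by its side condition directly.\<close>

lemma relations_eval:
  assumes "r \<in> R_relations a gs Ms \<phi>"
  shows "r \<in> carrier (free_algebra V) \<and> \<Theta> r \<in> ext_boundaries"
  using assms unfolding R_relations_def
proof (elim UnE)
  assume "r \<in> {Yword [I, J] |I J. I \<in> V \<and> J \<in> V \<and> \<not> mon_coprime (mon_lcm I) (mon_lcm J)}"
  then obtain I J where r: "r = Yword [I, J]" "I \<in> V" "J \<in> V" "\<not> mon_coprime (mon_lcm I) (mon_lcm J)"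
    by blast
  have "lift_phi I * lift_phi J \<in> ext_boundaries"
    by (rule times_boundary_if_not_coprime[OF lift_phi(3,1) lift_phi(3,1) r(4)])
      (use r gens_critical in auto)
  then show ?thesis
    using r by (simp add: word_eval_Yword Yword_in_free_algebra)
next
  assume "r \<in> {Yword Is - (\<Sum>L\<in>crit. Poly_Mapping.single 0 (b L) * Ycl gs L) |Is b.
      Is \<noteq> [] \<and> set Is \<subseteq> V \<and> (\<exists>u\<in>boundaries a. phi_prod a \<phi> Is = comb a \<phi> crit b \<oplus>\<^bsub>KA a\<^esub> u)}"
  then obtain Is b u where r: "r = Yword Is - (\<Sum>L\<in>crit. Poly_Mapping.single 0 (b L) * Ycl gs L)"
    and Is: "set Is \<subseteq> V" and u: "u \<in> boundaries a" "phi_prod a \<phi> Is = comb a \<phi> crit b \<oplus>\<^bsub>KA a\<^esub> u"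
    by blast
  have Is': "set Is \<subseteq> crit" using Is gens_critical by blast
  obtain f where f: "f \<in> ext_boundaries" "u = proj f"
    using u(1) by (auto simp: boundaries_eq)
  let ?P = "prod_list (map lift_phi Is)" and ?C = "\<Theta> (\<Sum>L\<in>crit. Poly_Mapping.single 0 (b L) * Ycl gs L)"
  have "?P - (lincomb b + f) \<in> null_ext"
    using u(2) unfolding phi_prod_eq[OF Is'] comb_eq f(2) by (simp add: proj_eq_iff)
  from ext_boundaries_closed(3)[OF ext_boundaries_closed(2)[OF null_ext_subset_boundaries[OF this] f(1)]
      null_ext_subset_boundaries[OF word_eval_combination[of b]]]
  have "\<Theta> r \<in> ext_boundaries"
    by (simp add: r word_eval_diff word_eval_Yword)
  moreover have "r \<in> carrier (free_algebra V)"
    unfolding r by (intro free_algebra_closed free_algebra_sum_closed const_in_free_algebra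
        Ycl_in_free_algebra Yword_in_free_algebra Is)
  ultimately show ?thesis by blast
next
  assume "r \<in> {Yword Is |Is. Is \<noteq> [] \<and> set Is \<subseteq> V \<and> phi_prod a \<phi> Is \<in> boundaries a}"
  then obtain Is where r: "r = Yword Is" "set Is \<subseteq> V" "phi_prod a \<phi> Is \<in> boundaries a"
    by blast
  moreover have "set Is \<subseteq> crit" using r gens_critical by blast
  ultimately show ?thesis
    by (simp add: word_eval_Yword Yword_in_free_algebra phi_prod_eq proj_in_boundaries_iff)
qed

section \<open>The ring \<open>R_ring\<close> and its map to the homology\<close>

lemma ideal_R_ideal: "ideal (R_ideal a gs Ms \<phi>) (gc_poly_ring V card)"
proof -
  interpret G: ring_hom_ring "free_algebra V" "gc_poly_ring V card" "gc_class V card :: ('n monomial set word \<Rightarrow>\<^sub>0 'k) \<Rightarrow> _"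
    by (rule gc_class_hom)
  show ?thesis
    unfolding R_ideal_def by (rule G.S.genideal_ideal) (auto dest: relations_eval)
qed

lemma R_class_hom: "ring_hom_ring (free_algebra V) (R_ring a gs Ms \<phi>) (R_class a gs Ms \<phi>)"
proof -
  interpret G: ring_hom_ring "free_algebra V" "gc_poly_ring V card" "gc_class V card :: ('n monomial set word \<Rightarrow>\<^sub>0 'k) \<Rightarrow> _"
    by (rule gc_class_hom)
  interpret I: ideal "R_ideal a gs Ms \<phi>" "gc_poly_ring V card"
    by (rule ideal_R_ideal)
  have "R_class a gs Ms \<phi> = (+>\<^bsub>gc_poly_ring V card\<^esub>) (R_ideal a gs Ms \<phi>) \<circ> gc_class V card"
    by (simp add: fun_eq_iff R_class_def)
  then have "R_class a gs Ms \<phi> \<in> ring_hom (free_algebra V) (R_ring a gs Ms \<phi>)"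
    unfolding R_ring_def using ring_hom_trans[OF G.homh I.rcos_ring_hom] by simp
  then show ?thesis
    unfolding R_ring_def by (intro ring_hom_ringI2 ring_free_algebra I.quotient_is_ring)
qed

lemma R_class_simps:
  assumes "p \<in> carrier (free_algebra V)" "q \<in> carrier (free_algebra V)"
  shows "R_class a gs Ms \<phi> (p + q) = R_class a gs Ms \<phi> p \<oplus>\<^bsub>R_ring a gs Ms \<phi>\<^esub> R_class a gs Ms \<phi> q"
    "R_class a gs Ms \<phi> (p * q) = R_class a gs Ms \<phi> p \<otimes>\<^bsub>R_ring a gs Ms \<phi>\<^esub> R_class a gs Ms \<phi> q"
  using ring_hom_ring.homh[OF R_class_hom] assms by (auto simp: ring_hom_def)

lemma carrier_R_ring: "carrier (R_ring a gs Ms \<phi>) = R_class a gs Ms \<phi> ` carrier (free_algebra V)"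
proof -
  have "carrier (R_ring a gs Ms \<phi>) = (+>\<^bsub>gc_poly_ring V card\<^esub>) (R_ideal a gs Ms \<phi>) ` carrier (gc_poly_ring V card)"
    by (auto simp: R_ring_def FactRing_def A_RCOSETS_defs a_r_coset_def r_coset_def)
  then show ?thesis
    by (simp add: carrier_gc_poly_ring image_image R_class_def)
qed

lemma relation_zero:
  assumes "r \<in> R_relations a gs Ms \<phi>"
  shows "R_class a gs Ms \<phi> r = \<zero>\<^bsub>R_ring a gs Ms \<phi>\<^esub>"
proof -
  interpret G: ring_hom_ring "free_algebra V" "gc_poly_ring V card" "gc_class V card :: ('n monomial set word \<Rightarrow>\<^sub>0 'k) \<Rightarrow> _"
    by (rule gc_class_hom)
  interpret I: ideal "R_ideal a gs Ms \<phi>" "gc_poly_ring V card"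
    by (rule ideal_R_ideal)
  have "gc_class V card ` R_relations a gs Ms \<phi> \<subseteq> R_ideal a gs Ms \<phi>"
    unfolding R_ideal_def by (rule G.S.genideal_self) (auto dest: relations_eval)
  then have "gc_class V card r \<in> R_ideal a gs Ms \<phi>"
    using assms by blast
  then show ?thesis
    unfolding R_class_def R_ring_def by (simp add: I.a_rcos_const FactRing_def)
qed

lemma hproj_word_eval_hom: "ring_hom_ring (free_algebra V) (koszul_homology a) (\<lambda>p. hproj (\<Theta> p))"
proof (intro ring_hom_ringI2 ring_free_algebra ring_koszul_homology ring_hom_memI)
  show "hproj (\<Theta> p) \<in> carrier (koszul_homology a)" if "p \<in> carrier (free_algebra V)" for p
    using word_eval_cycle[OF that] by (simp add: koszul_homology_carrier)
qed (simp_all add: word_eval_times word_eval_add hproj_simps word_eval_cycle hproj_one)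

lemma hproj_zero: "f \<in> ext_boundaries \<Longrightarrow> hproj f = \<zero>\<^bsub>koszul_homology a\<^esub>"
proof -
  interpret h: ring_hom_ring "free_algebra V" "koszul_homology a" "\<lambda>p. hproj (\<Theta> p)"
    by (rule hproj_word_eval_hom)
  have "hproj 0 = \<zero>\<^bsub>koszul_homology a\<^esub>"
    using h.hom_zero by simp
  moreover assume "f \<in> ext_boundaries"
  ultimately show ?thesis
    using hproj_eq_iff[of f 0] by simp
qed

text \<open>The evaluation descends in two stages, along the two quotients in the construction of
  R': first by graded commutativity, which it satisfies exactly, then by the remaining relations,
  which it satisfies up to boundaries.\<close>

lemma presentation_map:
  obtains \<Psi> where "ring_hom_ring (R_ring a gs Ms \<phi>) (koszul_homology a) \<Psi>"
    "\<And>p. p \<in> carrier (free_algebra V) \<Longrightarrow> \<Psi> (R_class a gs Ms \<phi> p) = hproj (\<Theta> p)"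
proof -
  interpret F: ring "free_algebra V :: ('n monomial set word \<Rightarrow>\<^sub>0 'k) ring"
    by (rule ring_free_algebra)
  interpret h: ring_hom_ring "free_algebra V" "koszul_homology a" "\<lambda>p. hproj (\<Theta> p)"
    by (rule hproj_word_eval_hom)
  interpret G: ring_hom_ring "free_algebra V" "gc_poly_ring V card" "gc_class V card :: ('n monomial set word \<Rightarrow>\<^sub>0 'k) \<Rightarrow> _"
    by (rule gc_class_hom)
  have "Yword [I, J] - (- 1) ^ (card I * card J) * Yword [J, I] \<in> a_kernel (free_algebra V) (koszul_homology a) (\<lambda>p. hproj (\<Theta> p))"
    if "I \<in> V" "J \<in> V" for I J
  proof -
    have "\<Theta> (Yword [I, J] - (- 1) ^ (card I * card J) * Yword [J, I]) = 0"
      using homogeneous_graded_commute[OF lift_phi(1)[OF gens_critical[OF that(1)]] lift_phi(1)[OF gens_critical[OF that(2)]]]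
      by (simp add: word_eval_diff word_eval_sign_times word_eval_Yword)
    then have "hproj (\<Theta> (Yword [I, J] - (- 1) ^ (card I * card J) * Yword [J, I])) = \<zero>\<^bsub>koszul_homology a\<^esub>"
      using hproj_zero[OF ext_boundaries_closed(1)] by simp
    moreover have "Yword [I, J] - (- 1) ^ (card I * card J) * Yword [J, I] \<in> carrier (free_algebra V)"
      using that by (intro free_algebra_closed Yword_in_free_algebra) auto
    ultimately show ?thesis
      unfolding a_kernel_def' by blast
  qed
  then have "gc_ideal V card \<subseteq> a_kernel (free_algebra V) (koszul_homology a) (\<lambda>p. hproj (\<Theta> p))"
    unfolding gc_ideal_def by (intro F.genideal_minimal h.kernel_is_ideal) blast
  then have ker: "hproj (\<Theta> x) = \<zero>\<^bsub>koszul_homology a\<^esub>" if "x \<in> gc_ideal V card" for x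
    using that unfolding a_kernel_def' by blast
  obtain g where g: "ring_hom_ring (gc_poly_ring V card) (koszul_homology a) g"
    "\<And>p. p \<in> carrier (free_algebra V) \<Longrightarrow> g (gc_class V card p) = hproj (\<Theta> p)"
    by (rule ring_hom_ring_quotient[OF hproj_word_eval_hom ideal_gc_ideal[where d = card], folded gc_poly_ring_def gc_class_def])
      (rule ker, assumption, rule that)
  interpret g: ring_hom_ring "gc_poly_ring V card" "koszul_homology a" g
    by (rule g)
  have "R_ideal a gs Ms \<phi> \<subseteq> a_kernel (gc_poly_ring V card) (koszul_homology a) g"
    unfolding R_ideal_def
  proof (rule G.S.genideal_minimal[OF g.kernel_is_ideal], rule image_subsetI)
    fix r assume "r \<in> R_relations a gs Ms \<phi>"
    then have r: "r \<in> carrier (free_algebra V)" "\<Theta> r \<in> ext_boundaries"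
      using relations_eval by blast+
    then have "g (gc_class V card r) = \<zero>\<^bsub>koszul_homology a\<^esub>"
      by (simp only: g(2) hproj_zero)
    with G.hom_closed[OF r(1)] show "gc_class V card r \<in> a_kernel (gc_poly_ring V card) (koszul_homology a) g"
      unfolding a_kernel_def' by blast
  qed
  then have gker: "g x = \<zero>\<^bsub>koszul_homology a\<^esub>" if "x \<in> R_ideal a gs Ms \<phi>" for x
    using that unfolding a_kernel_def' by blast
  obtain \<Psi> where \<Psi>: "ring_hom_ring (R_ring a gs Ms \<phi>) (koszul_homology a) \<Psi>"
    "\<And>x. x \<in> carrier (gc_poly_ring V card) \<Longrightarrow> \<Psi> (R_ideal a gs Ms \<phi> +>\<^bsub>gc_poly_ring V card\<^esub> x) = g x"
    by (rule ring_hom_ring_quotient[OF g(1) ideal_R_ideal, folded R_ring_def]) (rule gker, assumption, rule that)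
  have "\<Psi> (R_class a gs Ms \<phi> p) = hproj (\<Theta> p)" if "p \<in> carrier (free_algebra V)" for p
    unfolding R_class_def using that by (simp add: \<Psi>(2) g(2))
  then show ?thesis using \<Psi>(1) that by blast
qed

section \<open>Reduction to normal forms\<close>

lemma normal_form_linear:
  "normal_form c b + normal_form c' b' = normal_form (c + c') (\<lambda>L. b L + b' L)"
  "Poly_Mapping.single 0 d * normal_form c b = normal_form (d * c) (\<lambda>L. d * b L)"
  by (simp_all add: normal_form_def single_add distrib_left distrib_right sum.distrib mult_single
      sum_distrib_left flip: mult.assoc)

text \<open>Term by term. A nonempty word evaluates to a cycle of positive degree, so some
  combination of critical classes represents it, and the relation of the second kind for exactly
  this combination reduces the word.\<close>

lemma R_class_normal_form:
  assumes "p \<in> carrier (free_algebra V)"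
  obtains c b where "\<And>L. L \<notin> crit \<Longrightarrow> b L = 0" "R_class a gs Ms \<phi> p = R_class a gs Ms \<phi> (normal_form c b)"
proof -
  interpret R: ring_hom_ring "free_algebra V" "R_ring a gs Ms \<phi>" "R_class a gs Ms \<phi>"
    by (rule R_class_hom)
  have "p \<in> carrier (free_algebra V) \<and> (\<exists>c b. (\<forall>L. L \<notin> crit \<longrightarrow> b L = 0) \<and>
      R_class a gs Ms \<phi> p = R_class a gs Ms \<phi> (normal_form c b))"
  proof (induction p rule: poly_mapping_induct_sum)
    case zero
    have "normal_form 0 (\<lambda>_. 0) = 0" by (simp add: normal_form_def)
    then show ?case
      by (intro conjI free_algebra_closed exI[of _ 0] exI[of _ "\<lambda>_. 0"]) simp_all
  next
    case (single w d)
    obtain Is where w: "w = Word Is" by (cases w)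
    have Is: "set Is \<subseteq> V" "set Is \<subseteq> crit"
      using assms single gens_critical unfolding w carrier_free_algebra by fastforce+
    have carr: "Poly_Mapping.single w d \<in> carrier (free_algebra V)"
      using Is by (intro single_in_free_algebra) (simp add: w)
    show ?case
    proof (cases "Is = []")
      case True
      then have "Poly_Mapping.single w d = normal_form d (\<lambda>_. 0)"
        by (simp add: w normal_form_def zero_word_def)
      then show ?thesis using carr by (intro conjI exI[of _ d] exI[of _ "\<lambda>_. 0"]) simp_all
    next
      case False
      let ?P = "prod_list (map lift_phi Is)"
      obtain b where b: "\<And>L. L \<notin> crit \<Longrightarrow> b L = 0" "?P - lincomb b \<in> ext_boundaries"
        by (rule lincomb_surj[of ?P]) (use Is prod_list_cycle prod_list_degree_0 False in_ideal(1) in auto)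
      let ?S = "\<Sum>L\<in>crit. Poly_Mapping.single 0 (b L) * Ycl gs L"
      have "phi_prod a \<phi> Is = comb a \<phi> crit b \<oplus>\<^bsub>KA a\<^esub> proj (?P - lincomb b)"
        by (simp add: phi_prod_eq Is comb_eq)
      then have "Yword Is - ?S \<in> R_relations a gs Ms \<phi>"
        unfolding R_relations_def using b(2)[folded proj_in_boundaries_iff] False Is(1)
        by (intro UnI1 UnI2 CollectI exI[of _ Is] exI[of _ b]) blast
      then have zero: "R_class a gs Ms \<phi> (Yword Is - ?S) = \<zero>\<^bsub>R_ring a gs Ms \<phi>\<^esub>"
        by (rule relation_zero)
      have S: "?S = normal_form 0 b" by (simp add: normal_form_def)
      \<comment> \<open>The term is \<open>d\<close> times a relation, which vanishes in
        \<open>R_ring\<close>, plus \<open>d\<close> times a normal form.\<close>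
      have d: "Poly_Mapping.single w d = Poly_Mapping.single 0 d * (Yword Is - ?S) + Poly_Mapping.single 0 d * ?S"
        by (simp add: right_diff_distrib) (simp add: Yword_def mult_single w)
      have Scarr: "?S \<in> carrier (free_algebra V)"
        unfolding S by (rule normal_form_in_free_algebra)
      have Ycarr: "Yword Is - ?S \<in> carrier (free_algebra V)"
        using Scarr Is(1) by (intro free_algebra_closed Yword_in_free_algebra)
      note closed = const_in_free_algebra[of d V] Ycarr Scarr
      have "R_class a gs Ms \<phi> (Poly_Mapping.single w d) =
          R_class a gs Ms \<phi> (Poly_Mapping.single 0 d) \<otimes>\<^bsub>R_ring a gs Ms \<phi>\<^esub> R_class a gs Ms \<phi> (Yword Is - ?S)
            \<oplus>\<^bsub>R_ring a gs Ms \<phi>\<^esub> R_class a gs Ms \<phi> (Poly_Mapping.single 0 d * ?S)"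
        unfolding d
        by (simp only: R_class_simps free_algebra_closed(4)[OF closed(1,2)] free_algebra_closed(4)[OF closed(1,3)] closed)
      also have "\<dots> = R_class a gs Ms \<phi> (Poly_Mapping.single 0 d * ?S)"
        unfolding zero using R.hom_closed[OF closed(1)] R.hom_closed[OF free_algebra_closed(4)[OF closed(1,3)]]
        by simp
      also have "\<dots> = R_class a gs Ms \<phi> (normal_form (d * 0) (\<lambda>L. d * b L))"
        unfolding S normal_form_linear ..
      finally show ?thesis
        using carr b(1) by (intro conjI exI[of _ "d * 0"] exI[of _ "\<lambda>L. d * b L"]) auto
    qed
  next
    case (add q r)
    then obtain c b c' b' where
      "\<forall>L. L \<notin> crit \<longrightarrow> b L = 0" "R_class a gs Ms \<phi> q = R_class a gs Ms \<phi> (normal_form c b)"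
      "\<forall>L. L \<notin> crit \<longrightarrow> b' L = 0" "R_class a gs Ms \<phi> r = R_class a gs Ms \<phi> (normal_form c' b')"
      by blast
    moreover have "q \<in> carrier (free_algebra V)" "r \<in> carrier (free_algebra V)"
      using add by blast+
    moreover from this have "R_class a gs Ms \<phi> (q + r) = R_class a gs Ms \<phi> q \<oplus>\<^bsub>R_ring a gs Ms \<phi>\<^esub> R_class a gs Ms \<phi> r"
      by (rule R_class_simps)
    moreover have "R_class a gs Ms \<phi> (normal_form (c + c') (\<lambda>L. b L + b' L)) =
        R_class a gs Ms \<phi> (normal_form c b) \<oplus>\<^bsub>R_ring a gs Ms \<phi>\<^esub> R_class a gs Ms \<phi> (normal_form c' b')"
      unfolding normal_form_linear[symmetric]
      by (rule R_class_simps[OF normal_form_in_free_algebra normal_form_in_free_algebra])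
    ultimately show ?case
      by (intro conjI free_algebra_closed exI[of _ "c + c'"] exI[of _ "\<lambda>L. b L + b' L"]) simp_all
  qed
  then show ?thesis using that by blast
qed

text \<open>A constant would survive in degree 0, where no \<phi>(L) contributes; so
  \<open>c\<close> vanishes, and then the independence of the classes of the \<phi>(L) forces
  \<open>b\<close> to vanish.\<close>

lemma normal_form_zero:
  assumes "hproj (\<Theta> (normal_form c b)) = \<zero>\<^bsub>koszul_homology a\<^esub>" "\<And>L. L \<notin> crit \<Longrightarrow> b L = 0"
  shows "normal_form c b = 0"
proof -
  have "\<Theta> (normal_form c b) \<in> ext_boundaries"
    using assms(1) hproj_zero[OF ext_boundaries_closed(1)] hproj_eq_iff[of _ 0] by simp
  from ext_boundaries_closed(3)[OF this null_ext_subset_boundaries[OF word_eval_normal_form[of c b]]]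
  have bd: "escalar (xconst c) + lincomb b \<in> ext_boundaries"
    by (simp add: add.commute)
  have "ecoef (lift_phi L) {} = 0" if "L \<in> crit" for L
    using prod_list_degree_0[of "[L]"] that by simp
  then have "ecoef (lincomb b) {} = 0"
    by (simp add: lincomb_def)
  then have c: "c = 0"
    using lookup_boundary_0[OF bd lookup_0_if_in_a] by (simp add: xconst_def)
  have "b = (\<lambda>_. 0)"
    using bd assms(2) by (intro lincomb_inj) (simp_all add: c)
  then show ?thesis by (simp add: normal_form_def c)
qed

text \<open>Up to a boundary, the part of degree 0 can be reduced to its constant term by
  \<open>remove_degree_0\<close>; what remains is spanned by the critical classes.\<close>

lemma cycle_normal_form:
  assumes f: "f \<in> ext_cycles"
  obtains c b where "\<And>L. L \<notin> crit \<Longrightarrow> b L = 0" "f - (escalar (xconst c) + lincomb b) \<in> ext_boundaries"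
proof -
  let ?c = "Poly_Mapping.lookup (ecoef f {}) 0"
  obtain h where h: "ecoef (f - escalar (xconst ?c) - kdiff xvar h) {} = 0"
    by (rule remove_degree_0)
  have cyc: "f - escalar (xconst ?c) - kdiff xvar h \<in> ext_cycles"
    using f by (intro ext_cycles_closed ext_boundaries_subset[OF kdiff_in_ext_boundaries])
  have deg: "ecoef (f - escalar (xconst ?c) - kdiff xvar h) {} \<in> a"
    unfolding h by (rule in_ideal)
  obtain b where b: "\<And>L. L \<notin> crit \<Longrightarrow> b L = 0"
    "f - escalar (xconst ?c) - kdiff xvar h - lincomb b \<in> ext_boundaries"
    using lincomb_surj[OF cyc deg] by blast
  from ext_boundaries_closed(2)[OF b(2) kdiff_in_ext_boundaries[of h]]
  have "f - (escalar (xconst ?c) + lincomb b) \<in> ext_boundaries"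
    by (simp add: algebra_simps)
  then show ?thesis using b(1) that by blast
qed

section \<open>Multidegrees\<close>

lemma graded_part_boundary:
  assumes "f \<in> ext_boundaries"
  shows "graded_part i \<alpha> f \<in> ext_boundaries"
proof -
  obtain g where g: "f - kdiff xvar g \<in> null_ext"
    using assms unfolding ext_boundaries_def by blast
  have "graded_part i \<alpha> f - kdiff xvar (graded_part (Suc i) \<alpha> g) = graded_part i \<alpha> (f - kdiff xvar g)"
    by (simp add: graded_part_linear graded_part_kdiff)
  \<comment> \<open>Here it matters that \<open>a\<close> is a monomial ideal: with a polynomial it
    contains each of its terms.\<close>
  also have "\<dots> \<in> null_ext"
  proof -
    have "monomial_part \<alpha> \<delta> p \<in> a" if "p \<in> a" for \<delta> p
      using monomial_part_in_mon_ideal[of p "set gs"] that by (simp only: a_eq)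
    then show ?thesis
      using g in_ideal(1) by (simp add: null_ext_def ecoef_graded_part del: ecoef_simps)
  qed
  finally show ?thesis by (rule ext_boundariesI)
qed

definition word_degree :: "nat \<Rightarrow> 'n monomial \<Rightarrow> ('n monomial set word \<Rightarrow>\<^sub>0 'k) set" where
  "word_degree i \<alpha> = {p \<in> carrier (free_algebra V). \<forall>w\<in>Poly_Mapping.keys p.
     sum_list (map card (letters w)) = i \<and> sum_list (map mon_lcm (letters w)) = \<alpha>}"

lemma word_eval_homogeneous:
  assumes "p \<in> word_degree i \<alpha>"
  shows "\<Theta> p \<in> homogeneous i \<alpha>"
  unfolding word_eval_def
proof (intro homogeneous_sum homogeneous_scale)
  fix w assume "w \<in> Poly_Mapping.keys p"
  then have "set (letters w) \<subseteq> crit" "sum_list (map card (letters w)) = i" "sum_list (map mon_lcm (letters w)) = \<alpha>"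
    using assms gens_critical by (auto simp: word_degree_def carrier_free_algebra)
  then show "prod_list (map lift_phi (letters w)) \<in> homogeneous i \<alpha>"
    using prod_list_homogeneous[of "letters w"] by simp
qed

text \<open>A normal form of \<open>f\<close> may contain terms of other degrees. Discarding them is
  harmless, because \<open>f\<close> equals its own graded part and graded parts of boundaries are
  boundaries.\<close>

lemma homogeneous_cycle_represented:
  assumes f: "f \<in> ext_cycles" "f \<in> homogeneous i \<alpha>"
  obtains p where "p \<in> word_degree i \<alpha>" "hproj (\<Theta> p) = hproj f"
proof -
  obtain c b where cb: "f - (escalar (xconst c) + lincomb b) \<in> ext_boundaries"
    using cycle_normal_form[OF f(1)] by blast
  \<comment> \<open>The unit sits in degree 0 and in the multidegree of the monomial 1.\<close>
  define c' where "c' = (if i = 0 \<and> \<alpha> = 0 then c else 0)"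
  define b' where "b' = (\<lambda>L. if card L = i \<and> mon_lcm L = \<alpha> then b L else 0)"
  have "graded_part i \<alpha> (escalar (xconst c) * 1) = (if i = 0 \<and> \<alpha> = 0 then escalar (xconst c) * 1 else 0)"
    by (rule graded_part_homogeneous[OF homogeneous_scale[OF homogeneous_1]])
  then have const: "graded_part i \<alpha> (escalar (xconst c)) = escalar (xconst c')"
    by (simp add: c'_def)
  have "graded_part i \<alpha> (escalar (xconst (b L)) * lift_phi L) = escalar (xconst (b' L)) * lift_phi L"
    if "L \<in> crit" for L
    using graded_part_homogeneous[OF lift_phi(1)[OF that]] by (auto simp: graded_part_linear b'_def)
  then have "graded_part i \<alpha> (lincomb b) = lincomb b'"
    by (simp add: lincomb_def graded_part_sum)
  with const graded_part_boundary[OF cb, of i \<alpha>]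
  have "f - (escalar (xconst c') + lincomb b') \<in> ext_boundaries"
    using graded_part_homogeneous[OF f(2), of i \<alpha>] by (simp add: graded_part_linear)
  from ext_boundaries_closed(2)[OF null_ext_subset_boundaries[OF word_eval_normal_form[of c' b']] ext_boundaries_closed(4)[OF this]]
  have "\<Theta> (normal_form c' b') - f \<in> ext_boundaries"
    by simp
  then have "hproj (\<Theta> (normal_form c' b')) = hproj f"
    by (simp add: hproj_eq_iff)
  moreover have "normal_form c' b' \<in> word_degree i \<alpha>"
  proof -
    have "sum_list (map card (letters w)) = i \<and> sum_list (map mon_lcm (letters w)) = \<alpha>"
      if w: "w \<in> Poly_Mapping.keys (normal_form c' b')" for w
    proof -
      consider "w \<in> Poly_Mapping.keys (Poly_Mapping.single (0 :: 'n monomial set word) c')"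
        | L where "L \<in> crit" "w \<in> Poly_Mapping.keys (Poly_Mapping.single 0 (b' L) * Ycl gs L)"
      proof -
        have "w \<in> Poly_Mapping.keys (Poly_Mapping.single (0 :: 'n monomial set word) c') \<or>
            w \<in> Poly_Mapping.keys (\<Sum>L\<in>crit. Poly_Mapping.single 0 (b' L) * Ycl gs L)"
          using subsetD[OF keys_add w[unfolded normal_form_def]] by blast
        moreover have "\<exists>L\<in>crit. w \<in> Poly_Mapping.keys (Poly_Mapping.single 0 (b' L) * Ycl gs L)"
          if "w \<in> Poly_Mapping.keys (\<Sum>L\<in>crit. Poly_Mapping.single 0 (b' L) * Ycl gs L)"
          using that unfolding in_keys_iff lookup_sum by (meson sum.neutral)
        ultimately show thesis using that by blast
      qed
      then show ?thesis
      proof cases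
        case 1
        then show ?thesis
          by (auto simp: c'_def zero_word_def split: if_splits)
      next
        case 2
        then have "w = Word (class_list gs L)" "b' L \<noteq> 0"
          by (auto simp: single_times_Ycl split: if_splits)
        then show ?thesis
          using class_list_degrees[OF 2(1)] by (auto simp: b'_def split: if_splits)
      qed
    qed
    then show ?thesis
      by (simp add: word_degree_def normal_form_in_free_algebra)
  qed
  ultimately show ?thesis using that by blast
qed

lemma koszul_homology_presentation:
  "\<exists>\<Psi> \<in> ring_iso (R_ring a gs Ms \<phi>) (koszul_homology a).
      (\<forall>I\<in>gens gs Ms. \<Psi> (R_class a gs Ms \<phi> (Yword [I])) = hclass a (\<phi> I)) \<and>
      (\<forall>c. \<Psi> (R_class a gs Ms \<phi> (Poly_Mapping.single 0 c)) = hclass a (KA_scale a c \<one>\<^bsub>KA a\<^esub>)) \<and>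
      (\<forall>i \<alpha>. \<Psi> ` R_hom a gs Ms \<phi> i \<alpha> = hclass a ` (cycles a \<inter> KA_hom a i \<alpha>))"
proof -
  obtain \<Psi> where \<Psi>: "ring_hom_ring (R_ring a gs Ms \<phi>) (koszul_homology a) \<Psi>"
    "\<And>p. p \<in> carrier (free_algebra V) \<Longrightarrow> \<Psi> (R_class a gs Ms \<phi> p) = hproj (\<Theta> p)"
    by (rule presentation_map) (rule that)
  interpret \<Psi>: ring_hom_ring "R_ring a gs Ms \<phi>" "koszul_homology a" \<Psi>
    by (rule \<Psi>)
  interpret R: ring_hom_ring "free_algebra V" "R_ring a gs Ms \<phi>" "R_class a gs Ms \<phi>"
    by (rule R_class_hom)
  \<comment> \<open>An element of the kernel is represented by a normal form, and a normal form with
    vanishing class is 0.\<close>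
  have "a_kernel (R_ring a gs Ms \<phi>) (koszul_homology a) \<Psi> \<subseteq> {\<zero>\<^bsub>R_ring a gs Ms \<phi>\<^esub>}"
  proof
    fix x assume "x \<in> a_kernel (R_ring a gs Ms \<phi>) (koszul_homology a) \<Psi>"
    then obtain p where p: "p \<in> carrier (free_algebra V)" "x = R_class a gs Ms \<phi> p" "\<Psi> x = \<zero>\<^bsub>koszul_homology a\<^esub>"
      unfolding a_kernel_def' carrier_R_ring by blast
    obtain c b where b: "\<And>L. L \<notin> crit \<Longrightarrow> b L = 0" and nf: "R_class a gs Ms \<phi> p = R_class a gs Ms \<phi> (normal_form c b)"
      by (rule R_class_normal_form[OF p(1)]) (rule that)
    note cb = b p(2)[unfolded nf]
    then have "normal_form c b = 0"
      using p(3) by (intro normal_form_zero) (simp_all add: \<Psi>(2)[OF normal_form_in_free_algebra])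
    then show "x \<in> {\<zero>\<^bsub>R_ring a gs Ms \<phi>\<^esub>}"
      using cb(2) R.hom_zero by simp
  qed
  moreover have "\<zero>\<^bsub>R_ring a gs Ms \<phi>\<^esub> \<in> a_kernel (R_ring a gs Ms \<phi>) (koszul_homology a) \<Psi>"
    unfolding a_kernel_def' by simp
  ultimately have "a_kernel (R_ring a gs Ms \<phi>) (koszul_homology a) \<Psi> = {\<zero>\<^bsub>R_ring a gs Ms \<phi>\<^esub>}"
    by blast
  then have inj: "inj_on \<Psi> (carrier (R_ring a gs Ms \<phi>))"
    by (rule \<Psi>.trivial_ker_imp_inj)
  have "x \<in> \<Psi> ` carrier (R_ring a gs Ms \<phi>)" if x: "x \<in> carrier (koszul_homology a)" for x
  proof -
    obtain f where f: "f \<in> ext_cycles" "x = hproj f"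
      using x by (auto simp: koszul_homology_carrier)
    obtain c b where "f - (escalar (xconst c) + lincomb b) \<in> ext_boundaries"
      using cycle_normal_form[OF f(1)] by blast
    from ext_boundaries_closed(2)[OF null_ext_subset_boundaries[OF word_eval_normal_form[of c b]] ext_boundaries_closed(4)[OF this]]
    have "\<Theta> (normal_form c b) - f \<in> ext_boundaries"
      by simp
    then have "\<Psi> (R_class a gs Ms \<phi> (normal_form c b)) = x"
      by (simp add: f(2) \<Psi>(2)[OF normal_form_in_free_algebra] hproj_eq_iff)
    then show ?thesis
      using normal_form_in_free_algebra unfolding carrier_R_ring by blast
  qed
  then have "\<Psi> \<in> ring_iso (R_ring a gs Ms \<phi>) (koszul_homology a)"
    using inj \<Psi>.homh \<Psi>.hom_closed unfolding ring_iso_def bij_betw_def by blast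
  moreover have "\<Psi> (R_class a gs Ms \<phi> (Yword [I])) = hclass a (\<phi> I)" if "I \<in> V" for I
    using that gens_critical[OF that]
    by (simp add: \<Psi>(2) Yword_in_free_algebra word_eval_Yword hproj_def lift_phi)
  moreover have "\<Psi> (R_class a gs Ms \<phi> (Poly_Mapping.single 0 c)) = hclass a (KA_scale a c \<one>\<^bsub>KA a\<^esub>)" for c
    by (simp add: \<Psi>(2) const_in_free_algebra word_eval_const hproj_def)
  moreover have "\<Psi> ` R_hom a gs Ms \<phi> i \<alpha> = hclass a ` (cycles a \<inter> KA_hom a i \<alpha>)" for i \<alpha>
  proof -
    have "\<Psi> ` R_hom a gs Ms \<phi> i \<alpha> = (\<lambda>p. hproj (\<Theta> p)) ` word_degree i \<alpha>"
      unfolding R_hom_def word_degree_def[symmetric] image_image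
      by (rule image_cong) (simp_all add: word_degree_def \<Psi>(2))
    \<comment> \<open>One inclusion is the homogeneity of the evaluation; the other needs a
      representative of the right degree.\<close>
    also have "\<dots> = hproj ` (ext_cycles \<inter> homogeneous i \<alpha>)"
    proof (intro subset_antisym image_subsetI)
      fix p assume p: "p \<in> word_degree i \<alpha>"
      then have "\<Theta> p \<in> ext_cycles" by (intro word_eval_cycle) (simp add: word_degree_def)
      with word_eval_homogeneous[OF p] show "hproj (\<Theta> p) \<in> hproj ` (ext_cycles \<inter> homogeneous i \<alpha>)"
        by blast
    next
      fix f assume "f \<in> ext_cycles \<inter> homogeneous i \<alpha>"
      then obtain p where "p \<in> word_degree i \<alpha>" "hproj (\<Theta> p) = hproj f"
        using homogeneous_cycle_represented by blast
      then show "hproj f \<in> (\<lambda>p. hproj (\<Theta> p)) ` word_degree i \<alpha>"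
        by (metis imageI)
    qed
    also have "\<dots> = hclass a ` (proj ` (ext_cycles \<inter> homogeneous i \<alpha>))"
      by (simp add: image_image hproj_def)
    also have "proj ` (ext_cycles \<inter> homogeneous i \<alpha>) = cycles a \<inter> KA_hom a i \<alpha>"
      unfolding KA_hom_eq by (auto simp: proj_in_cycles_iff)
    finally show ?thesis .
  qed
  ultimately show ?thesis by blast
qed

end

theorem theorem5p2:
  fixes a :: "('n::{finite,linorder}, 'k::field) mpol set"
    and gs :: "'n monomial list"
    and Ms :: "'n matching_seq"
    and \<phi> :: "'n monomial set \<Rightarrow> 'n set \<Rightarrow> ('n, 'k) mpol set"
  assumes "monomial_ideal a"
    and "distinct gs" and "minimal_mon_gens (set gs) a"
    and "standard_matching TYPE('k) gs Ms"
    and "koszul_map a gs Ms \<phi>"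
  shows "\<exists>\<Psi> \<in> ring_iso (R_ring a gs Ms \<phi>) (koszul_homology a).
      (\<forall>I\<in>gens gs Ms. \<Psi> (R_class a gs Ms \<phi> (Yword [I])) = hclass a (\<phi> I)) \<and>
      (\<forall>c. \<Psi> (R_class a gs Ms \<phi> (Poly_Mapping.single 0 c)) = hclass a (KA_scale a c \<one>\<^bsub>KA a\<^esub>)) \<and>
      (\<forall>i \<alpha>. \<Psi> ` R_hom a gs Ms \<phi> i \<alpha> = hclass a ` (cycles a \<inter> KA_hom a i \<alpha>))"
proof -
  have a: "a = mon_ideal (set gs)"
    using assms(3) by (simp add: minimal_mon_gens_def)
  interpret koszul_data a gs Ms \<phi>
  proof (intro koszul_data.intro quotient_koszul.intro koszul_data_axioms.intro)
    show "ideal a poly_ring" unfolding a by (rule ideal_mon_ideal)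
  qed (fact assms(5))
  \<comment> \<open>Were 1 a generator, minimality would make it the only one. The only possible
    edge would then join \<open>{0}\<close> to itself, which the sizes forbid, so \<open>{0}\<close>
    would be critical; but over the zero ring there is no critical set.\<close>
  have "0 \<notin> set gs"
  proof
    assume 0: "0 \<in> set gs"
    have unit: "mon_ideal G = (UNIV :: ('n, 'k) mpol set)" if "0 \<in> G" for G :: "'n monomial set"
      using that unfolding set_eq_iff mon_ideal_iff by (auto intro!: bexI[of _ 0])
    then have "\<not> {0} \<subset> set gs"
      using assms(3) 0 by (auto simp: minimal_mon_gens_def)
    then have gs: "set gs = {0}" using 0 by blast
    note std = assms(4)[unfolded standard_matching_def]
    have "all_edges Ms \<subseteq> {I. I \<noteq> {} \<and> I \<subseteq> set gs} \<times> {I. I \<noteq> {} \<and> I \<subseteq> set gs}"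
      using acyclic_matching_seq_edges[OF std[THEN conjunct1]]
      unfolding all_edges_def by (simp add: taylor_def)
    then have "all_edges Ms \<subseteq> {({0}, {0})}"
      unfolding gs by (auto simp: subset_singleton_iff)
    moreover have "({0}, {0}) \<notin> all_edges Ms"
      using std[THEN conjunct2, THEN conjunct1] by (auto dest!: bspec[of _ _ "({0}, {0})"])
    ultimately have "all_edges Ms = {}" by blast
    then have "{0} \<in> critical gs Ms"
      by (simp add: critical_def gs)
    moreover have "critical gs Ms = {}"
      by (rule critical_empty_if_unit) (simp add: a unit[OF 0])
    ultimately show False by simp
  qed
  then interpret koszul_presentation a gs Ms \<phi>
    using a assms(4) by unfold_locales
  show ?thesis by (rule koszul_homology_presentation)
qed

end
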